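(* Let $\mathbb{K}$ be a field of arbitrary characteristic and let $(\mathcal{A},\mathcal{A}')$ be a deletion pair of affine line arrangements in $V=\mathbb{K}^2$. Then $(\mathcal{A},\mathcal{A}')$ is free if and only if $\chi(\mathcal{A},t)$ and $\chi(\mathcal{A}',t)$ have a common root (in $\mathbb{C}$). In particular, the freeness of the deletion pair depends only on the combinatorics.
   Context: An affine line arrangement $\mathcal{A}$ in $V=\mathbb{K}^2$ is a finite set of affine lines in $V$. $L(\mathcal{A})$ is the set of all nonempty intersections of subsets of $\mathcal{A}$ (including $V$, the empty intersection), a poset under inclusion. Define $\mu(V)=1$ and $\mu(X)=-\sum_{Y\in L(\mathcal{A}),\,X\subsetneq Y\subset V}\mu(Y)$; the characteristic polynomial is $\chi(\mathcal{A},t)=\sum_{X\in L(\mathcal{A})}\mu(X)t^{\dim X}$. A deletion pair of affine line arrangements $(\mathcal{A},\mathcal{A}')$ is a pair with $\mathcal{A}\supset\mathcal{A}'$ and $|\mathcal{A}'|+1=|\mathcal{A}|$. It is free if both $\mathcal{A}$ and $\mathcal{A}'$ are free. "Depends only on the combinatorics" means: if $(\mathcal{A}_1,\mathcal{A}_1')$ and $(\mathcal{A}_2,\mathcal{A}_2')$ are deletion pairs in $V$ and there is a poset isomorphism $L(\mathcal{A}_1)\to L(\mathcal{A}_2)$ carrying the lines of $\mathcal{A}_1'$ to the lines of $\mathcal{A}_2'$, then one pair is free if and only if the other is. Freeness: let $S=\mathbb{K}[x,y,z]$. The cone $c\mathcal{A}$ is the central arrangement in $\mathbb{K}^3$ consisting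 of the plane $z=0$ and the planes $cH=\{\alpha_{cH}=0\}$, $H\in\mathcal{A}$, where $\alpha_{cH}$ is the homogenization by $z$ of a degree one polynomial defining $H$. Let $D(c\mathcal{A})=\{\theta\in\mathrm{Der}\,S\mid \theta(\alpha_{cH})\in S\alpha_{cH}\ (\forall H\in\mathcal{A}),\ \theta(z)\in Sz\}$, where $\mathrm{Der}\,S$ is the module of $\mathbb{K}$-derivations of $S$. $\mathcal{A}$ is free with exponents $\exp_0(\mathcal{A})=(d_1,d_2)$ if $D(c\mathcal{A})$ is a free $S$-module with a homogeneous basis $\theta_E=x\partial_x+y\partial_y+z\partial_z,\theta_1,\theta_2$ with $\deg\theta_i=d_i$ (the degree of a homogeneous derivation is the polynomial degree of its coefficients). *)

theory Defs
  imports
    "HOL-Analysis.Cartesian_Space"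
    "HOL-Computational_Algebra.Polynomial"
    "HOL-Library.Poly_Mapping"
    "HOL-Library.Function_Algebras"
begin

section \<open>Affine line arrangements and their intersection posets\<close>

text \<open>The affine polynomial \<open>a x + b y + c\<close> has degree one and zero locus \<open>H\<close>.\<close>

definition defines_line :: "'k::field \<Rightarrow> 'k \<Rightarrow> 'k \<Rightarrow> ('k ^ 2) set \<Rightarrow> bool" where
  "defines_line a b c H \<longleftrightarrow>
     (a \<noteq> 0 \<or> b \<noteq> 0) \<and> H = {v. a * v $ 1 + b * v $ 2 + c = 0}"

definition affine_line :: "('k::field ^ 2) set \<Rightarrow> bool" where
  "affine_line H \<longleftrightarrow> (\<exists>a b c. defines_line a b c H)"

definition line_arrangement :: "('k::field ^ 2) set set \<Rightarrow> bool" where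
  "line_arrangement A \<longleftrightarrow> finite A \<and> (\<forall>H\<in>A. affine_line H)"

definition deletion_pair :: "('k::field ^ 2) set set \<Rightarrow> ('k ^ 2) set set \<Rightarrow> bool" where
  "deletion_pair A A' \<longleftrightarrow>
     line_arrangement A \<and> line_arrangement A' \<and> A' \<subseteq> A \<and> card A' + 1 = card A"

text \<open>The whole plane belongs to the poset, since \<open>\<Inter>{} = UNIV\<close>.\<close>

definition int_poset :: "('k::field ^ 2) set set \<Rightarrow> ('k ^ 2) set set" where
  "int_poset A = {\<Inter>B | B. B \<subseteq> A \<and> \<Inter>B \<noteq> {}}"

lemma finite_int_poset: "finite A \<Longrightarrow> finite (int_poset A)"
  by (rule finite_subset[of _ "Inter ` Pow A"]) (auto simp: int_poset_def)

text \<open>The test \<open>finite A\<close> is only there to make the recursion well-founded; the value \<open>0\<close> for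
  infinite \<open>A\<close> is a dummy.\<close>

function moebius :: "('k::field ^ 2) set set \<Rightarrow> ('k ^ 2) set \<Rightarrow> int" where
  "moebius A X =
     (if X = UNIV then 1
      else if finite A then - (\<Sum>Y\<in>{Y \<in> int_poset A. X \<subset> Y}. moebius A Y)
      else 0)"
  by auto
termination
proof (relation "measure (\<lambda>(A, X). card {Y \<in> int_poset A. X \<subset> Y})", goal_cases)
  case 1
  show ?case by simp
next
  case (2 A X Y)
  then show ?case
    by (auto intro!: psubset_card_mono simp: finite_int_poset)
qed

declare moebius.simps [simp del]

text \<open>The dimension of a (nonempty) affine subspace is the dimension of its direction space.\<close>

definition aff_dim_plane :: "('k::field ^ 2) set \<Rightarrow> nat" where
  "aff_dim_plane X = vec.dim {u - v | u v. u \<in> X \<and> v \<in> X}"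

definition char_poly_arr :: "('k::field ^ 2) set set \<Rightarrow> int poly" where
  "char_poly_arr A = (\<Sum>X\<in>int_poset A. monom (moebius A X) (aff_dim_plane X))"


section \<open>The polynomial ring in three variables and its derivations\<close>

text \<open>\<open>'k mpoly3\<close> is \<open>S = K[x,y,z]\<close>: finitely supported maps from exponent vectors to coefficients,
  with the variables \<open>x\<close>, \<open>y\<close>, \<open>z\<close> indexed by \<open>1\<close>, \<open>2\<close>, \<open>3\<close> in the three-element type \<open>3\<close>.\<close>

type_synonym 'k mpoly3 = "(3 \<Rightarrow>\<^sub>0 nat) \<Rightarrow>\<^sub>0 'k"

definition Const :: "'k::field \<Rightarrow> 'k mpoly3" where
  "Const c = Poly_Mapping.single 0 c"

definition Var :: "3 \<Rightarrow> 'k::field mpoly3" where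
  "Var i = Poly_Mapping.single (Poly_Mapping.single i 1) 1"

definition homogeneous :: "nat \<Rightarrow> 'k::field mpoly3 \<Rightarrow> bool" where
  "homogeneous d p \<longleftrightarrow> (\<forall>m\<in>Poly_Mapping.keys p. (\<Sum>i\<in>UNIV. Poly_Mapping.lookup m i) = d)"

definition partial :: "3 \<Rightarrow> 'k::field mpoly3 \<Rightarrow> 'k mpoly3" where
  "partial i p = (\<Sum>m\<in>Poly_Mapping.keys p.
     Poly_Mapping.single (m - Poly_Mapping.single i 1)
       (of_nat (Poly_Mapping.lookup m i) * Poly_Mapping.lookup p m))"

definition derivations :: "('k::field mpoly3 \<Rightarrow> 'k mpoly3) set" where
  "derivations = {\<theta>.
     (\<forall>p q. \<theta> (p + q) = \<theta> p + \<theta> q) \<and>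
     (\<forall>c p. \<theta> (Const c * p) = Const c * \<theta> p) \<and>
     (\<forall>p q. \<theta> (p * q) = \<theta> p * q + p * \<theta> q)}"

text \<open>All maps \<open>S \<Rightarrow> S\<close> form an \<open>S\<close>-module under pointwise operations; the derivations and the
  modules of logarithmic derivations below are submodules of it.\<close>

definition der_scale ::
    "'k::field mpoly3 \<Rightarrow> ('k mpoly3 \<Rightarrow> 'k mpoly3) \<Rightarrow> ('k mpoly3 \<Rightarrow> 'k mpoly3)" where
  "der_scale f \<theta> = (\<lambda>p. f * \<theta> p)"

interpretation der: module der_scale
  by unfold_locales (simp_all add: der_scale_def fun_eq_iff algebra_simps)

text \<open>The coefficients of \<open>\<theta>\<close> are its values on the variables.\<close>

definition homogeneous_der :: "nat \<Rightarrow> ('k::field mpoly3 \<Rightarrow> 'k mpoly3) \<Rightarrow> bool" where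
  "homogeneous_der d \<theta> \<longleftrightarrow> \<theta> \<in> derivations \<and> (\<forall>i. homogeneous d (\<theta> (Var i)))"

definition euler_der :: "'k::field mpoly3 \<Rightarrow> 'k mpoly3" where
  "euler_der p = Var 1 * partial 1 p + Var 2 * partial 2 p + Var 3 * partial 3 p"


section \<open>Freeness\<close>

text \<open>Linear forms of the cone: \<open>z\<close>, and the homogenizations by \<open>z\<close> of the defining polynomials of
  the lines. The defining polynomial of a line is unique only up to a nonzero scalar; all choices are
  included, which does not affect \<open>log_der\<close>.\<close>

definition cone_forms :: "('k::field ^ 2) set set \<Rightarrow> 'k mpoly3 set" where
  "cone_forms A = insert (Var 3)
     {Const a * Var 1 + Const b * Var 2 + Const c * Var 3 | a b c. \<exists>H\<in>A. defines_line a b c H}"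

definition log_der :: "('k::field ^ 2) set set \<Rightarrow> ('k mpoly3 \<Rightarrow> 'k mpoly3) set" where
  "log_der A = {\<theta> \<in> derivations. \<forall>\<alpha>\<in>cone_forms A. \<alpha> dvd \<theta> \<alpha>}"

definition free_with_exponents :: "('k::field ^ 2) set set \<Rightarrow> nat \<Rightarrow> nat \<Rightarrow> bool" where
  "free_with_exponents A d1 d2 \<longleftrightarrow>
     (\<exists>\<theta>1 \<theta>2. homogeneous_der d1 \<theta>1 \<and> homogeneous_der d2 \<theta>2 \<and>
        distinct [euler_der, \<theta>1, \<theta>2] \<and>
        der.independent {euler_der, \<theta>1, \<theta>2} \<and>
        der.span {euler_der, \<theta>1, \<theta>2} = log_der A)"

definition free_arrangement :: "('k::field ^ 2) set set \<Rightarrow> bool" where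
  "free_arrangement A \<longleftrightarrow> (\<exists>d1 d2. free_with_exponents A d1 d2)"

definition free_pair :: "('k::field ^ 2) set set \<Rightarrow> ('k ^ 2) set set \<Rightarrow> bool" where
  "free_pair A A' \<longleftrightarrow> free_arrangement A \<and> free_arrangement A'"


section \<open>Combinatorial equivalence of pairs\<close>

definition comb_equiv_pairs ::
    "('k::field ^ 2) set set \<Rightarrow> ('k ^ 2) set set \<Rightarrow> ('k ^ 2) set set \<Rightarrow> ('k ^ 2) set set \<Rightarrow> bool" where
  "comb_equiv_pairs A1 A1' A2 A2' \<longleftrightarrow>
     (\<exists>\<phi>. bij_betw \<phi> (int_poset A1) (int_poset A2) \<and>
          (\<forall>X\<in>int_poset A1. \<forall>Y\<in>int_poset A1. X \<subseteq> Y \<longleftrightarrow> \<phi> X \<subseteq> \<phi> Y) \<and>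
          \<phi> ` A1' = A2')"

end

theory Submission
  imports Defs
begin

text \<open>Let \<open>A = insert H A'\<close>, let \<open>a\<close> be the number of lines of \<open>A'\<close>, \<open>n\<close> the number of points in which
  they meet \<open>H\<close>, and \<open>\<beta>\<close> the sum of (multiplicity minus one) over the crossing points of \<open>A'\<close>. Then
  \<open>\<chi>(A', t) = t\<^sup>2 - a t + \<beta>\<close> and \<open>\<chi>(A, t) = \<chi>(A', t) - (t - n)\<close>. A common root can only be \<open>n\<close>, and it
  exists if and only if \<open>\<beta> = n (a - n)\<close> (\<open>common_root_iff\<close>). The theorem therefore says that both
  arrangements are free if and only if \<open>\<beta> = n (a - n)\<close> (\<open>free_pair_iff\<close>).

  Modulo the Euler derivation, logarithmic derivations of the cone are vector fields
  \<open>v = f \<partial>/\<partial>x + g \<partial>/\<partial>y\<close>. Write \<open>L(A)\<^sub>k\<close> for those with coefficients homogeneous of degree \<open>k\<close>. Let \<open>\<alpha>\<close>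
  be the equation of \<open>H\<close>. Two maps into polynomials on \<open>H\<close> relate \<open>L(A)\<close> and \<open>L(A')\<close>:

  \<^item> \<open>v \<mapsto> v(\<alpha>)\<close> restricted to \<open>H\<close>, on \<open>L(A')\<^sub>k\<close>. Its kernel is \<open>L(A)\<^sub>k\<close>. Its values are multiples of a fixed
    polynomial of degree \<open>a - n\<close> (as a form on the projective line), so the image has dimension at most
    \<open>max 0 (k + 1 - (a - n))\<close>.

  \<^item> The component of \<open>v\<close> tangent to \<open>H\<close>, restricted to \<open>H\<close>, on \<open>L(A)\<^sub>k\<close>. Its kernel is \<open>\<alpha> L(A')\<close> in degree
    \<open>k - 1\<close>. Its values vanish at the \<open>n\<close> points, so the image has dimension at most \<open>max 0 (k + 1 - n)\<close>.

  Explicit fields show that the first map is onto the indicated multiples when \<open>k \<ge> a\<close>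
  (\<open>restr_act_surj\<close>). Adding the lines one at a time, this computes \<open>dim L(A)\<^sub>k\<close> for large \<open>k\<close> as a
  quadratic polynomial in \<open>k\<close> whose constant term determines \<open>\<beta>\<close> (\<open>second_betti_insert\<close>).

  Suppose \<open>\<beta> = n (a - n)\<close>. Together the two maps bound the growth of \<open>dim L(A')\<^sub>k\<close>, and the summed bound is
  the Hilbert function of a free module with generators in degrees \<open>n\<close> and \<open>a - n\<close>. For large \<open>k\<close> the
  actual dimension agrees with it, so there was no loss in any degree and both maps are onto in
  every degree (\<open>both_sequences_exact\<close>). Preimages \<open>v\<^sub>1 \<in> L(A)\<^sub>n\<close> and \<open>v\<^sub>2 \<in> L(A')\<close> in degree \<open>a - n\<close> of
  the two generators then form a basis of \<open>L(A')\<close>, and \<open>v\<^sub>1, \<alpha> v\<^sub>2\<close> form a basis of \<open>L(A)\<close>.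

  Conversely, if both arrangements are free, comparing Hilbert functions shows that the exponents are
  the roots of the characteristic polynomials (\<open>free_fields_exponents\<close>). From \<open>\<alpha> L(A') \<subseteq> L(A) \<subseteq> L(A')\<close> the
  lowest exponents differ by at most one, and since the sums of the exponents are \<open>a\<close> and \<open>a + 1\<close>, one
  exponent is shared.

  Only dimension counts and restriction to lines are used, so the field may be finite and of any
  characteristic. Combinatorial invariance follows because \<open>a\<close>, \<open>n\<close> and \<open>\<beta>\<close> can be read off the
  intersection poset, in which the lines are the coatoms (\<open>comb_invariants\<close>).\<close>

section \<open>Dimensions of subspaces and linear maps\<close>

text \<open>The ambient spaces below are infinite-dimensional, where \<open>dim\<close> of an infinite-dimensional
  subspace carries no information; the relation \<open>fdim\<close> records finiteness together with the
  dimension.\<close>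

locale linear_space = vector_space scale
  for scale :: "'a::field \<Rightarrow> 'b::ab_group_add \<Rightarrow> 'b"
begin

definition fdim :: "'b set \<Rightarrow> nat \<Rightarrow> bool" where
  "fdim V d \<longleftrightarrow> (\<exists>B. finite B \<and> independent B \<and> span B = V \<and> card B = d)"

lemma fdim_unique: "fdim V c \<Longrightarrow> fdim V d \<Longrightarrow> c = d"
  unfolding fdim_def by (metis dim_span_eq_card_independent)

lemma fdim_subspace:
  assumes "subspace U" "U \<subseteq> V" "fdim V d"
  obtains c where "c \<le> d" "fdim U c"
proof -
  obtain C where C: "finite C" "independent C" "span C = V" "card C = d"
    using assms(3) unfolding fdim_def by blast
  obtain B where B: "B \<subseteq> U" "independent B" "U \<subseteq> span B"
    using maximal_independent_subset by blast
  have "finite B \<and> card B \<le> d"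
    using independent_span_bound[OF C(1) B(2)] B(1) assms(2) C by blast
  moreover have "span B = U"
    using B assms(1) by (intro span_subspace)
  ultimately show thesis using that B(2) unfolding fdim_def by blast
qed

lemma fdim_eq:
  assumes "U \<subseteq> V" "fdim U d" "fdim V d"
  shows "U = V"
proof -
  obtain B where B: "finite B" "independent B" "span B = U" "card B = d"
    using assms(2) unfolding fdim_def by blast
  have "B \<subseteq> V" using B(3) assms(1) span_superset by blast
  then obtain C where C: "B \<subseteq> C" "C \<subseteq> V" "independent C" "V \<subseteq> span C"
    using maximal_independent_subset_extend B(2) by metis
  obtain D where D: "finite D" "independent D" "span D = V" "card D = d"
    using assms(3) unfolding fdim_def by blast
  have "finite C \<and> card C \<le> d"
    using independent_span_bound[OF D(1) C(3)] C(2) D by auto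
  then have "B = C" using C(1) B by (metis card_seteq)
  then show ?thesis using C B(3) assms(1) by auto
qed

lemma fdim_0: "fdim {0} 0"
  unfolding fdim_def by (intro exI[of _ "{}"]) (simp add: independent_empty)

end

locale linear_space_pair = vs1: linear_space s1 + vs2: linear_space s2 + vector_space_pair s1 s2
  for s1 :: "'a::field \<Rightarrow> 'b::ab_group_add \<Rightarrow> 'b" and s2 :: "'a \<Rightarrow> 'c::ab_group_add \<Rightarrow> 'c"
begin

lemma fdim_inj_image:
  assumes f: "Vector_Spaces.linear s1 s2 f" and V: "vs1.fdim V d" and inj: "\<And>v. v \<in> V \<Longrightarrow> f v = 0 \<Longrightarrow> v = 0"
  shows "vs2.fdim (f ` V) d"
proof -
  obtain B where B: "finite B" "vs1.independent B" "vs1.span B = V" "card B = d"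
    using V unfolding vs1.fdim_def by blast
  have injV: "inj_on f (vs1.span B)"
    using linear_inj_on_iff_eq_0[OF f vs1.subspace_span, of B] inj B(3) by auto
  have "vs2.independent (f ` B)"
    by (rule linear_independent_injective_image[OF f B(2) injV])
  moreover have "vs2.span (f ` B) = f ` V"
    using linear_span_image[OF f, of B] B(3) by simp
  moreover have "card (f ` B) = d"
    using card_image inj_on_subset[OF injV vs1.span_superset] B(4) by blast
  ultimately show ?thesis
    using B(1) unfolding vs2.fdim_def by blast
qed

text \<open>Rank-nullity in the direction that also produces finiteness: lift a basis of the image and
  add a basis of the kernel.\<close>

lemma rank_nullity:
  assumes f: "Vector_Spaces.linear s1 s2 f" and V: "vs1.subspace V"
    and K: "vs1.fdim {v \<in> V. f v = 0} r" and I: "vs2.fdim (f ` V) s"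
  shows "vs1.fdim V (r + s)"
proof -
  obtain B0 where B0: "finite B0" "vs1.independent B0" "vs1.span B0 = {v \<in> V. f v = 0}" "card B0 = r"
    using K unfolding vs1.fdim_def by blast
  have "B0 \<subseteq> V" using B0(3) vs1.span_superset by blast
  then obtain B where B: "B0 \<subseteq> B" "B \<subseteq> V" "vs1.independent B" "V \<subseteq> vs1.span B"
    using vs1.maximal_independent_subset_extend B0(2) by metis
  define C where "C = B - B0"
  have spanB: "vs1.span B = V" using B V by (intro vs1.span_subspace)
  have Cind: "vs1.independent C" using B(3) vs1.independent_mono unfolding C_def by blast
  have injC: "inj_on f (vs1.span C)"
  proof (subst linear_inj_on_iff_eq_0[OF f vs1.subspace_span], intro ballI impI)
    fix x assume x: "x \<in> vs1.span C" "f x = 0"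
    have "x \<in> V" using x(1) spanB vs1.span_mono[of C B] C_def by auto
    then have "x \<in> vs1.span B0" using x B0 by auto
    moreover have rep: "vs1.representation B x = vs1.representation C x"
      "vs1.representation B x = vs1.representation B0 x"
      using vs1.representation_extend[OF B(3), of x C] vs1.representation_extend[OF B(3), of x B0]
        x calculation C_def B(1) by auto
    have "vs1.representation B x b = 0" for b
    proof (cases "b \<in> C")
      case True
      then have "b \<notin> B0" by (auto simp: C_def)
      then show ?thesis using rep(2) vs1.representation_ne_zero[of B0 x b] by metis
    next
      case False
      then show ?thesis using rep(1) vs1.representation_ne_zero[of C x b] by metis
    qed
    then show "x = 0"
      using vs1.sum_nonzero_representation_eq[OF Cind x(1)] rep(1) by simp
  qed
  have imC: "vs2.span (f ` C) = f ` V"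
  proof -
    have "f ` B0 \<subseteq> {0}" using B0(3) vs1.span_superset by blast
    then have "vs2.span (f ` C) = vs2.span (f ` B)"
    proof -
      have "f ` B \<subseteq> insert 0 (f ` C)" using \<open>f ` B0 \<subseteq> {0}\<close> C_def by auto
      then have "vs2.span (f ` B) \<subseteq> vs2.span (f ` C)"
        using vs2.span_mono vs2.span_insert_0 by metis
      moreover have "vs2.span (f ` C) \<subseteq> vs2.span (f ` B)"
        by (intro vs2.span_mono) (auto simp: C_def)
      ultimately show ?thesis by blast
    qed
    then show ?thesis using linear_span_image[OF f, of B] spanB by simp
  qed
  have indC: "vs2.independent (f ` C)"
    by (rule linear_independent_injective_image[OF f Cind injC])
  obtain D where D: "finite D" "vs2.independent D" "vs2.span D = f ` V" "card D = s"
    using I unfolding vs2.fdim_def by blast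
  have "finite (f ` C)"
    using vs2.independent_span_bound[OF D(1) indC] D(3) imC vs2.span_superset by metis
  then have fC: "finite C"
    using finite_imageD inj_on_subset[OF injC vs1.span_superset] by blast
  have "card (f ` C) = s"
    using vs2.fdim_unique[of "f ` V" "card (f ` C)" s] I indC imC \<open>finite (f ` C)\<close>
    unfolding vs2.fdim_def by blast
  then have "card C = s"
    using card_image inj_on_subset[OF injC vs1.span_superset] by metis
  then have "card B = r + s" "finite B"
    using B0 fC B(1) card_Un_disjoint[of B0 C] by (auto simp: C_def Un_absorb1)
  then show ?thesis
    unfolding vs1.fdim_def using B(3) spanB by blast
qed

text \<open>This turns the two exact sequences of logarithmic fields into dimension counts; equality means
  that the map is onto its expected target.\<close>

lemma fdim_le_kernel_plus_target:
  assumes f: "Vector_Spaces.linear s1 s2 f" and V: "vs1.subspace V"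
    and K: "vs1.fdim {v \<in> V. f v = 0} r" and W: "vs2.fdim W s" "f ` V \<subseteq> W"
  obtains d where "d \<le> r + s" "vs1.fdim V d" "d = r + s \<longleftrightarrow> f ` V = W"
proof -
  have sub: "vs2.subspace (f ` V)"
    by (rule linear_subspace_image[OF f V])
  then obtain t where t: "t \<le> s" "vs2.fdim (f ` V) t"
    using vs2.fdim_subspace W by blast
  have "vs1.fdim V (r + t)"
    by (rule rank_nullity[OF f V K t(2)])
  moreover have "r + t = r + s \<longleftrightarrow> f ` V = W"
    using vs2.fdim_eq[OF W(2)] t W vs2.fdim_unique by auto
  ultimately show thesis using that[of "r + t"] t(1) by simp
qed

end

section \<open>The graded ring \<open>K[x,y,z]\<close>\<close>

alias lookup = Poly_Mapping.lookup
alias single = Poly_Mapping.single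
alias keys = Poly_Mapping.keys

abbreviation mdeg :: "(3 \<Rightarrow>\<^sub>0 nat) \<Rightarrow> nat" where
  "mdeg m \<equiv> (\<Sum>i\<in>UNIV. lookup m i)"

lemma mdeg_add: "mdeg (m + n) = mdeg m + mdeg n"
  by (simp add: lookup_add sum.distrib)

lemma mdeg_single: "mdeg (single i n) = n"
  by (simp add: lookup_single when_def)

lemma poly_mapping_as_sum:
  assumes "finite F" "keys p \<subseteq> F"
  shows "p = (\<Sum>m\<in>F. single m (lookup p m))"
proof (rule poly_mapping_eqI)
  fix k
  have "(\<Sum>m\<in>F. if m = k then lookup p m else 0) = lookup p k"
    using assms by (auto simp: sum.delta' in_keys_iff)
  then show "lookup p k =
      lookup (\<Sum>m\<in>F. single m (lookup p m)) k"
    by (simp add: lookup_sum lookup_single when_def)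
qed

lemma single_as_Var_mult:
  assumes "lookup m i > 0"
  shows "single m (c::'k::field)
    = Var i * single (m - single i 1) c"
proof -
  have "single i 1 + (m - single i 1) = m"
    by (rule poly_mapping_eqI) (use assms in \<open>auto simp: lookup_add lookup_minus lookup_single when_def\<close>)
  then show ?thesis
    by (simp add: Var_def mult_single)
qed

text \<open>Constants and multiplication by the variables generate all polynomials; derivations are
  determined on the variables by this induction.\<close>

lemma mpoly3_induct [case_names Const Var add]:
  fixes p :: "'k::field mpoly3"
  assumes C: "\<And>c. P (Const c)" and V: "\<And>i p. P p \<Longrightarrow> P (Var i * p)"
    and A: "\<And>p q. P p \<Longrightarrow> P q \<Longrightarrow> P (p + q)"
  shows "P p"
proof -
  have mono: "P (single m c)" for m c
  proof (induction "mdeg m" arbitrary: m)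
    case 0
    then have "m = 0" by (intro poly_mapping_eqI) simp
    then show ?case using C by (simp add: Const_def)
  next
    case (Suc n)
    then obtain i where i: "lookup m i > 0"
      by (metis gr0I old.nat.distinct(2) sum.neutral)
    have "single i 1 + (m - single i 1) = m"
      by (rule poly_mapping_eqI) (use i in \<open>auto simp: lookup_add lookup_minus lookup_single when_def\<close>)
    then have "mdeg m = 1 + mdeg (m - single i 1)"
      using mdeg_add[of "single i 1" "m - single i 1"] mdeg_single[of i 1]
      by simp
    then have "P (single (m - single i 1) c)"
      using Suc by simp
    then show ?case by (subst single_as_Var_mult[OF i]) (rule V)
  qed
  have "P (\<Sum>m\<in>F. single m (lookup p m))" if "finite F" for F
    using that
  proof (induction F rule: finite_induct)
    case empty
    show ?case using C[of 0] by (simp add: Const_def)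
  next
    case (insert m F)
    then show ?case using A mono by simp
  qed
  then show ?thesis
    by (subst poly_mapping_as_sum[of "keys p" p]) auto
qed

subsection \<open>Constants\<close>

lemma Const_add: "Const (a + b) = Const a + Const b"
  by (simp add: Const_def single_add)
lemma Const_mult: "Const (a * b) = Const a * Const b"
  by (simp add: Const_def mult_single)
lemma Const_0 [simp]: "Const 0 = 0"
  by (simp add: Const_def)
lemma Const_1 [simp]: "Const 1 = 1"
  by (simp add: Const_def)
lemma Const_uminus: "Const (- a) = - Const a"
  by (simp add: Const_def single_uminus)
lemma Const_diff: "Const (a - b) = Const a - Const b"
  by (simp add: Const_def single_diff)
lemmas Const_simps = Const_add Const_mult Const_uminus Const_diff

subsection \<open>Homogeneous components\<close>

lemma homogeneous_0 [simp]: "homogeneous d 0"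
  by (simp add: homogeneous_def)

lemma homogeneous_add: "homogeneous d p \<Longrightarrow> homogeneous d q \<Longrightarrow> homogeneous d (p + q)"
  unfolding homogeneous_def using Poly_Mapping.keys_add[of p q] by blast

lemma homogeneous_uminus: "homogeneous d p \<Longrightarrow> homogeneous d (- p)"
  unfolding homogeneous_def by (simp add: in_keys_iff)

lemma homogeneous_diff: "homogeneous d p \<Longrightarrow> homogeneous d q \<Longrightarrow> homogeneous d (p - q)"
  using homogeneous_add[of d p "- q"] homogeneous_uminus[of d q] by simp

lemma homogeneous_sum: "(\<And>i. i \<in> I \<Longrightarrow> homogeneous d (f i)) \<Longrightarrow> homogeneous d (sum f I)"
  by (induction I rule: infinite_finite_induct) (auto intro: homogeneous_add)

lemma homogeneous_mult: "homogeneous d p \<Longrightarrow> homogeneous e q \<Longrightarrow> homogeneous (d + e) (p * q)"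
  unfolding homogeneous_def
proof (intro ballI)
  fix m
  assume h: "\<forall>m\<in>keys p. mdeg m = d" "\<forall>m\<in>keys q. mdeg m = e"
    and "m \<in> keys (p * q)"
  then obtain a b where "a \<in> keys p" "b \<in> keys q" "m = a + b"
    using Poly_Mapping.keys_mult[of p q] by blast
  then show "mdeg m = d + e" using h mdeg_add[of a b] by metis
qed

lemma homogeneous_Const [simp]: "homogeneous 0 (Const c)"
  by (simp add: homogeneous_def Const_def)

lemma homogeneous_1 [simp]: "homogeneous 0 1"
  using homogeneous_Const[of 1] by simp

lemma homogeneous_Var [simp]: "homogeneous (Suc 0) (Var i)"
  using mdeg_single[of i 1] by (simp add: homogeneous_def Var_def)

lemma homogeneous_Const_mult: "homogeneous d p \<Longrightarrow> homogeneous d (Const c * p)"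
  using homogeneous_mult[of 0 "Const c" d p] by simp

lemma homogeneous_Const_Var [simp]: "homogeneous (Suc 0) (Const c * Var i)"
  by (rule homogeneous_Const_mult[OF homogeneous_Var])

lemma homogeneous_prod:
  "(\<And>i. i \<in> I \<Longrightarrow> homogeneous (d i) (f i)) \<Longrightarrow> homogeneous (sum d I) (prod f I)"
  by (induction I rule: infinite_finite_induct) (auto intro: homogeneous_mult)

lemma homogeneous_power: "homogeneous d p \<Longrightarrow> homogeneous (n * d) (p ^ n)"
  by (induction n) (auto intro: homogeneous_mult)

definition hcomp :: "nat \<Rightarrow> 'k::field mpoly3 \<Rightarrow> 'k mpoly3" where
  "hcomp k p = (\<Sum>m\<in>{m \<in> keys p. mdeg m = k}. single m (lookup p m))"

lemma lookup_hcomp: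
  "lookup (hcomp k p) m = (if mdeg m = k then lookup p m else 0)"
proof -
  have "(\<Sum>n\<in>{n \<in> keys p. mdeg n = k}. if n = m then lookup p n else 0)
      = (if mdeg m = k then lookup p m else 0)"
    by (auto simp: sum.delta' in_keys_iff)
  then show ?thesis by (simp add: hcomp_def lookup_sum lookup_single when_def)
qed

lemma hcomp_add: "hcomp k (p + q) = hcomp k p + hcomp k q"
  by (rule poly_mapping_eqI) (simp add: lookup_hcomp lookup_add)

lemma hcomp_0 [simp]: "hcomp k 0 = 0"
  by (rule poly_mapping_eqI) (simp add: lookup_hcomp)

lemma hcomp_sum: "hcomp k (sum f I) = (\<Sum>i\<in>I. hcomp k (f i))"
  by (induction I rule: infinite_finite_induct) (auto simp: hcomp_add)

lemma homogeneous_hcomp [simp]: "homogeneous k (hcomp k p)"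
  by (auto simp: homogeneous_def in_keys_iff lookup_hcomp split: if_splits)

lemma hcomp_homogeneous:
  assumes "homogeneous d p"
  shows "hcomp k p = (if k = d then p else 0)"
proof (rule poly_mapping_eqI)
  fix m
  show "lookup (hcomp k p) m = lookup (if k = d then p else 0) m"
    using assms by (cases "m \<in> keys p") (auto simp: lookup_hcomp homogeneous_def in_keys_iff)
qed

lemma hcomp_bound:
  obtains N where "\<And>k. k > N \<Longrightarrow> hcomp k p = 0"
proof -
  define N where "N = Max (insert 0 (mdeg ` keys p))"
  have "hcomp k p = 0" if "k > N" for k
  proof -
    have "mdeg m \<noteq> k" if "m \<in> keys p" for m
      using that \<open>k > N\<close> unfolding N_def by (metis (no_types, lifting) Max_ge finite_imageI finite_insert finite_keys image_eqI insertCI leD)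
    then show ?thesis
      by (intro poly_mapping_eqI) (auto simp: lookup_hcomp in_keys_iff)
  qed
  then show thesis using that by blast
qed

lemma sum_hcomp:
  assumes "\<And>k. k > N \<Longrightarrow> hcomp k p = 0"
  shows "p = (\<Sum>k\<le>N. hcomp k p)"
proof (rule poly_mapping_eqI)
  fix m
  have "(\<Sum>k\<le>N. if mdeg m = k then lookup p m else 0) = lookup p m"
  proof (cases "mdeg m \<le> N")
    case True
    then show ?thesis by (simp add: sum.delta)
  next
    case False
    then have "lookup (hcomp (mdeg m) p) m = 0" using assms[of "mdeg m"] by simp
    then show ?thesis by (simp add: lookup_hcomp)
  qed
  then show "lookup p m = lookup (\<Sum>k\<le>N. hcomp k p) m"
    by (simp add: lookup_sum lookup_hcomp)
qed

lemma hcomp_eq_0_imp: "(\<And>k. hcomp k p = 0) \<Longrightarrow> p = 0"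
  using sum_hcomp[of 0 p] by simp

text \<open>Multiplication by a homogeneous polynomial shifts the components. This is what lets divisibility
  by a linear form, and relations between homogeneous elements, be tested degree by degree.\<close>

lemma hcomp_mult:
  assumes "homogeneous d q"
  shows "hcomp k (q * p) = (if d \<le> k then q * hcomp (k - d) p else 0)"
proof -
  obtain N where N: "\<And>k. k > N \<Longrightarrow> hcomp k p = 0" using hcomp_bound by blast
  have "hcomp k (q * p) = (\<Sum>j\<le>N. hcomp k (q * hcomp j p))"
    by (subst sum_hcomp[OF N]) (auto simp: sum_distrib_left hcomp_sum)
  also have "\<dots> = (\<Sum>j\<le>N. if k = d + j then q * hcomp j p else 0)"
    by (intro sum.cong refl hcomp_homogeneous homogeneous_mult assms homogeneous_hcomp)
  also have "\<dots> = (if d \<le> k then q * hcomp (k - d) p else 0)"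
  proof (cases "d \<le> k")
    case True
    then have "(k = d + j) = (j = k - d)" for j by auto
    then show ?thesis using True N[of "k - d"] by (auto simp: sum.delta')
  next
    case False
    then show ?thesis by (auto intro!: sum.neutral)
  qed
  finally show ?thesis .
qed

lemma homogeneous_cofactor:
  assumes "homogeneous k (q * p)" "homogeneous d q" "q \<noteq> 0"
  shows "homogeneous (k - d) p" "k < d \<Longrightarrow> p = 0"
proof -
  have *: "hcomp j p = 0" if "j + d \<noteq> k" for j
  proof -
    have "q * hcomp j p = hcomp (j + d) (q * p)"
      using hcomp_mult[OF assms(2), of "j + d" p] by simp
    also have "\<dots> = 0"
      using hcomp_homogeneous[OF assms(1), of "j + d"] that by simp
    finally show ?thesis using assms(3) by simp
  qed
  show "p = 0" if "k < d"
    by (rule hcomp_eq_0_imp, rule *) (use that in simp)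
  show "homogeneous (k - d) p"
  proof (cases "k < d")
    case True
    have "p = 0" by (rule hcomp_eq_0_imp, rule *) (use True in simp)
    then show ?thesis by simp
  next
    case False
    have "p = hcomp (k - d) p"
    proof -
      have "(\<Sum>j\<le>k. hcomp j p) = (\<Sum>j\<le>k. if j = k - d then hcomp j p else 0)"
        using False by (intro sum.cong) (auto intro: *)
      also have "\<dots> = hcomp (k - d) p" by (simp add: sum.delta')
      finally show ?thesis using sum_hcomp[of k p] * by simp
    qed
    then show ?thesis by (metis homogeneous_hcomp)
  qed
qed

subsection \<open>Partial derivatives and derivations\<close>

lemma partial_superset:
  assumes "finite F" "keys p \<subseteq> F"
  shows "partial i p = (\<Sum>m\<in>F. single (m - single i 1)
       (of_nat (lookup m i) * lookup p m))"
  unfolding partial_def by (rule sum.mono_neutral_left) (use assms in \<open>auto simp: in_keys_iff\<close>)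

lemma partial_add: "partial i (p + q) = partial i p + partial i q"
proof -
  let ?F = "keys p \<union> keys q"
  have "keys (p + q) \<subseteq> ?F" by (rule Poly_Mapping.keys_add)
  then show ?thesis
    by (subst (1 2 3) partial_superset[of ?F])
      (auto simp: lookup_add distrib_left single_add sum.distrib)
qed

lemma partial_single: "partial i (single m c) =
    single (m - single i 1) (of_nat (lookup m i) * c)"
  by (subst partial_superset[of "{m}"]) auto

lemma partial_0 [simp]: "partial i 0 = 0"
  by (simp add: partial_def)

lemma partial_Const [simp]: "partial i (Const c) = 0"
  by (simp add: Const_def partial_single)

lemma partial_Var: "partial i (Var j) = (if i = j then 1 else 0)"
  by (auto simp: Var_def partial_single lookup_single when_def)

lemma partial_sum: "partial i (sum f I) = (\<Sum>j\<in>I. partial i (f j))"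
  by (induction I rule: infinite_finite_induct) (auto simp: partial_add)

lemma partial_mult_single:
  "partial i (single m c * single n d) =
    partial i (single m c) * single n d
    + single m c * partial i (single n (d::'k::field))"
proof -
  let ?e = "single i 1 :: 3 \<Rightarrow>\<^sub>0 nat"
  have 1: "single (m - ?e + n) (of_nat (lookup m i) * c * d)
      = single (m + n - ?e) (of_nat (lookup m i) * c * d)"
  proof (cases "lookup m i = 0")
    case False
    then have "m - ?e + n = m + n - ?e"
      by (intro poly_mapping_eqI) (auto simp: lookup_add lookup_minus lookup_single when_def)
    then show ?thesis by simp
  qed simp
  have 2: "single (m + (n - ?e)) (of_nat (lookup n i) * c * d)
      = single (m + n - ?e) (of_nat (lookup n i) * c * d)"
  proof (cases "lookup n i = 0")
    case False
    then have "m + (n - ?e) = m + n - ?e"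
      by (intro poly_mapping_eqI) (auto simp: lookup_add lookup_minus lookup_single when_def)
    then show ?thesis by simp
  qed simp
  show ?thesis
    using 1 2
    by (simp add: mult_single partial_single lookup_add algebra_simps flip: single_add)
qed

lemma partial_mult: "partial i (p * q) = partial i p * q + p * partial i (q :: 'k::field mpoly3)"
proof -
  define s where "s = (\<lambda>p :: 'k mpoly3. \<lambda>m. single m (lookup p m))"
  have eq: "p = sum (s p) (keys p)" for p :: "'k mpoly3"
    unfolding s_def by (rule poly_mapping_as_sum) auto
  have "partial i (sum (s p) A * sum (s q) B)
      = partial i (sum (s p) A) * sum (s q) B + sum (s p) A * partial i (sum (s q) B)" for A B
    by (simp add: sum_product partial_sum sum.distrib[symmetric] partial_mult_single s_def)
  from this[of "keys p" "keys q"] show ?thesis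
    by (simp only: eq[symmetric])
qed

definition vfield :: "'k::field mpoly3 \<Rightarrow> 'k mpoly3 \<Rightarrow> 'k mpoly3 \<Rightarrow> 'k mpoly3 \<Rightarrow> 'k mpoly3" where
  "vfield f g h = (\<lambda>p. f * partial 1 p + g * partial 2 p + h * partial 3 p)"

lemma vfield_derivation: "vfield f g h \<in> derivations"
  by (auto simp: derivations_def vfield_def partial_add partial_mult algebra_simps)

lemma vfield_Var [simp]:
  "vfield f g h (Var 1) = f" "vfield f g h (Var 2) = g" "vfield f g h (Var 3) = h"
  by (auto simp: vfield_def partial_Var)

lemma derivation_Const:
  assumes "\<theta> \<in> derivations"
  shows "\<theta> (Const c) = 0"
proof -
  have "\<theta> (1 * 1) = \<theta> 1 * 1 + 1 * \<theta> 1"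
    using assms unfolding derivations_def by blast
  then have "\<theta> 1 = \<theta> 1 + \<theta> 1" by (simp only: mult_1_left mult_1_right)
  then have "\<theta> 1 = 0" by (simp only: add_cancel_right_right)
  moreover have "\<theta> (Const c * 1) = Const c * \<theta> 1"
    using assms unfolding derivations_def by blast
  ultimately show ?thesis by simp
qed

lemma derivation_ext:
  assumes "\<theta> \<in> derivations" "\<eta> \<in> derivations" "\<And>i. \<theta> (Var i) = \<eta> (Var i)"
  shows "\<theta> = \<eta>"
proof
  fix p
  show "\<theta> p = \<eta> p"
  proof (induction p rule: mpoly3_induct)
    case (Const c)
    then show ?case using assms derivation_Const by metis
  next
    case (Var i p)
    then show ?case using assms unfolding derivations_def by simp
  next
    case (add p q)
    then show ?case using assms unfolding derivations_def by simp
  qed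
qed

lemma euler_der_vfield: "euler_der = vfield (Var 1) (Var 2) (Var 3)"
  by (rule ext) (simp add: euler_der_def vfield_def)

subsection \<open>Evaluation at univariate polynomials\<close>

definition eval3 :: "(3 \<Rightarrow> 'k::field poly) \<Rightarrow> 'k mpoly3 \<Rightarrow> 'k poly" where
  "eval3 \<phi> p = (\<Sum>m\<in>keys p.
     smult (lookup p m) (\<Prod>i\<in>UNIV. \<phi> i ^ lookup m i))"

lemma eval3_superset:
  assumes "finite F" "keys p \<subseteq> F"
  shows "eval3 \<phi> p = (\<Sum>m\<in>F. smult (lookup p m) (\<Prod>i\<in>UNIV. \<phi> i ^ lookup m i))"
  unfolding eval3_def by (rule sum.mono_neutral_left) (use assms in \<open>auto simp: in_keys_iff\<close>)

lemma eval3_add: "eval3 \<phi> (p + q) = eval3 \<phi> p + eval3 \<phi> q"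
proof -
  let ?F = "keys p \<union> keys q"
  have "keys (p + q) \<subseteq> ?F" by (rule Poly_Mapping.keys_add)
  then show ?thesis
    by (subst (1 2 3) eval3_superset[of ?F])
      (auto simp: lookup_add smult_add_left sum.distrib)
qed

lemma eval3_single:
  "eval3 \<phi> (single m c) = smult c (\<Prod>i\<in>UNIV. \<phi> i ^ lookup m i)"
  by (subst eval3_superset[of "{m}"]) auto

lemma eval3_0 [simp]: "eval3 \<phi> 0 = 0"
  by (simp add: eval3_def)

lemma eval3_sum: "eval3 \<phi> (sum f I) = (\<Sum>i\<in>I. eval3 \<phi> (f i))"
  by (induction I rule: infinite_finite_induct) (auto simp: eval3_add)

lemma eval3_mult: "eval3 \<phi> (p * q) = eval3 \<phi> p * eval3 \<phi> (q :: 'k::field mpoly3)"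
proof -
  define s where "s = (\<lambda>p :: 'k mpoly3. \<lambda>m. single m (lookup p m))"
  have eq: "p = sum (s p) (keys p)" for p :: "'k mpoly3"
    unfolding s_def by (rule poly_mapping_as_sum) auto
  have "eval3 \<phi> (sum (s p) A * sum (s q) B) = eval3 \<phi> (sum (s p) A) * eval3 \<phi> (sum (s q) B)" for A B
    by (simp add: sum_product eval3_sum s_def mult_single eval3_single lookup_add power_add
        prod.distrib mult.commute)
  from this[of "keys p" "keys q"] show ?thesis
    by (simp only: eq[symmetric])
qed

lemma eval3_Const [simp]: "eval3 \<phi> (Const c) = [:c:]"
  by (simp add: Const_def eval3_single)

lemma eval3_1 [simp]: "eval3 \<phi> 1 = 1"
  using eval3_Const[of \<phi> 1] by simp

lemma eval3_Var [simp]: "eval3 \<phi> (Var i) = \<phi> i"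
proof -
  have "(\<Prod>j\<in>UNIV. \<phi> j ^ lookup (single i 1) j)
      = (\<Prod>j\<in>UNIV. if j = i then \<phi> j else 1)"
    by (intro prod.cong) (auto simp: lookup_single when_def)
  then show ?thesis by (simp add: Var_def eval3_single prod.delta')
qed

lemma eval3_uminus: "eval3 \<phi> (- p) = - eval3 \<phi> p"
  using eval3_add[of \<phi> p "- p"] by (simp add: eq_neg_iff_add_eq_0 add.commute)

lemma eval3_diff: "eval3 \<phi> (p - q) = eval3 \<phi> p - eval3 \<phi> q"
  using eval3_add[of \<phi> p "- q"] by (simp add: eval3_uminus)

lemma eval3_prod: "eval3 \<phi> (prod f I) = (\<Prod>i\<in>I. eval3 \<phi> (f i))"
  by (induction I rule: infinite_finite_induct) (auto simp: eval3_mult)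

lemma eval3_power: "eval3 \<phi> (p ^ n) = eval3 \<phi> p ^ n"
  by (induction n) (auto simp: eval3_mult)

lemmas eval3_simps = eval3_add eval3_mult eval3_uminus eval3_diff eval3_sum eval3_prod eval3_power

section \<open>Restriction to a line\<close>

definition linform :: "'k \<times> 'k \<times> 'k \<Rightarrow> 'k::field mpoly3" where
  "linform = (\<lambda>(a, b, c). Const a * Var 1 + Const b * Var 2 + Const c * Var 3)"

lemma homogeneous_linform [simp]: "homogeneous (Suc 0) (linform t)"
  by (auto simp: linform_def split: prod.splits intro!: homogeneous_add)

lemma single_1_eq_iff:
  "single i (Suc 0) = single j (Suc 0) \<longleftrightarrow> i = j"
  using lookup_single_not_eq[of i j "Suc 0"] lookup_single_eq[of j "Suc 0"] by fastforce

text \<open>The line \<open>a x + b y + c = 0\<close> with base point \<open>(x0, y0)\<close> and direction \<open>(- b, a)\<close>. The affine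
  function \<open>l1 x + l2 y + l3\<close> is the corresponding parameter: zero at the base point, and growing with
  slope one along the direction. The linear parts \<open>(a, b)\<close> and \<open>(l1, l2)\<close> then form a
  basis of determinant one, so no division is needed in changing coordinates.\<close>

locale plane_line =
  fixes a b c x0 y0 l1 l2 l3 :: "'k::field"
  assumes on_line: "a * x0 + b * y0 + c = 0"
    and det: "a * l2 - b * l1 = 1"
    and base: "l1 * x0 + l2 * y0 + l3 = 0"
begin

abbreviation "form \<equiv> linform (a, b, c)"
abbreviation "coord \<equiv> linform (l1, l2, l3)"

definition restr :: "'k mpoly3 \<Rightarrow> 'k poly" where
  "restr = eval3 (\<lambda>i. if i = 1 then [:x0, - b:] else if i = 2 then [:y0, a:] else 1)"

lemma restr_linform: "restr (linform (a', b', c')) = [:a' * x0 + b' * y0 + c', b' * a - a' * b:]"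
  by (simp add: restr_def linform_def eval3_simps)

lemma restr_form [simp]: "restr form = 0"
  using on_line by (simp add: restr_linform)

lemma restr_coord [simp]: "restr coord = [:0, 1:]"
  using base det by (simp add: restr_linform algebra_simps)

lemma restr_Var3 [simp]: "restr (Var 3) = 1"
  by (simp add: restr_def)

lemma restr_Const [simp]: "restr (Const u) = [:u:]"
  by (simp add: restr_def)

lemma restr_0 [simp]: "restr 0 = 0"
  by (simp add: restr_def)

lemma restr_add: "restr (p + q) = restr p + restr q"
  and restr_mult: "restr (p * q) = restr p * restr q"
  and restr_uminus: "restr (- p) = - restr p"
  and restr_diff: "restr (p - q) = restr p - restr q"
  and restr_sum: "restr (sum f I) = (\<Sum>i\<in>I. restr (f i))"
  and restr_prod: "restr (prod f I) = (\<Prod>i\<in>I. restr (f i))"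
  and restr_power: "restr (p ^ n) = restr p ^ n"
  by (simp_all add: restr_def eval3_simps)

lemmas restr_simps = restr_add restr_mult restr_uminus restr_diff restr_sum restr_prod restr_power

lemma restr_dvd: "form dvd p \<Longrightarrow> restr p = 0"
  by (auto simp: restr_mult)

lemma form_ne_0: "form \<noteq> 0"
proof
  assume "form = 0"
  then have 0: "lookup form m = 0" for m by simp
  have eq: "form = single (single 1 1) a
      + single (single 2 1) b + single (single 3 1) c"
    by (simp add: linform_def Const_def Var_def mult_single)
  have "a = 0" using 0[of "single 1 1"] unfolding eq
    by (simp add: lookup_add lookup_single when_def single_1_eq_iff)
  moreover have "b = 0" using 0[of "single 2 1"] unfolding eq
    by (simp add: lookup_add lookup_single when_def single_1_eq_iff)
  ultimately show False using det by simp
qed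

lemma degree_restr:
  assumes "homogeneous d p"
  shows "degree (restr p) \<le> d"
proof -
  let ?\<phi> = "\<lambda>i::3. if i = 1 then [:x0, - b:] else if i = 2 then [:y0, a:] else 1 :: 'k poly"
  have \<phi>: "degree (?\<phi> i) \<le> 1" for i by auto
  have "degree (\<Prod>i\<in>UNIV. ?\<phi> i ^ lookup m i) \<le> mdeg m" for m
  proof -
    have "degree (\<Prod>i\<in>UNIV. ?\<phi> i ^ lookup m i)
        \<le> (\<Sum>i\<in>UNIV. degree (?\<phi> i ^ lookup m i))"
      using degree_prod_sum_le[of UNIV "\<lambda>i. ?\<phi> i ^ lookup m i"] by (simp add: o_def)
    also have "\<dots> \<le> mdeg m"
    proof (intro sum_mono)
      fix i :: 3
      have "degree (?\<phi> i ^ lookup m i) \<le> degree (?\<phi> i) * lookup m i"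
        by (rule degree_power_le)
      also have "\<dots> \<le> 1 * lookup m i"
        using \<phi> mult_le_mono1 by blast
      finally show "degree (?\<phi> i ^ lookup m i) \<le> lookup m i" by simp
    qed
    finally show ?thesis .
  qed
  then show ?thesis
    unfolding restr_def eval3_def
    using assms by (intro degree_sum_le) (auto simp: homogeneous_def intro!: order_trans[OF degree_smult_le])
qed

text \<open>The section of the restriction on polynomials of degree at most \<open>k\<close>: substitute the linear
  form of the parameter and homogenize by \<open>z\<close>.\<close>

definition lift :: "nat \<Rightarrow> 'k poly \<Rightarrow> 'k mpoly3" where
  "lift k f = (\<Sum>i\<le>k. Const (coeff f i) * coord ^ i * Var 3 ^ (k - i))"

lemma homogeneous_lift: "homogeneous k (lift k f)"
  unfolding lift_def
proof (intro homogeneous_sum)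
  fix i assume "i \<in> {..k}"
  then have "homogeneous (0 + i * 1 + (k - i) * 1) (Const (coeff f i) * coord ^ i * Var 3 ^ (k - i))"
    by (intro homogeneous_mult homogeneous_power) auto
  then show "homogeneous k (Const (coeff f i) * coord ^ i * Var 3 ^ (k - i))"
    using \<open>i \<in> {..k}\<close> by simp
qed

lemma restr_lift:
  assumes "degree f \<le> k"
  shows "restr (lift k f) = f"
proof -
  have "restr (lift k f) = (\<Sum>i\<le>k. monom (coeff f i) i)"
    by (simp add: lift_def restr_simps monom_altdef mult.commute)
  also have "\<dots> = f"
    by (rule poly_as_sum_of_monoms'[OF assms])
  finally show ?thesis .
qed

lemma lift_0 [simp]: "lift k 0 = 0"
  by (simp add: lift_def)

lemma lift_add: "lift k (f + g) = lift k f + lift k g"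
  by (simp add: lift_def Const_add algebra_simps sum.distrib)

lemma lift_Suc_mult:
  assumes "degree f \<le> k"
  shows "lift (Suc k) ([:u, v:] * f) = (Const u * Var 3 + Const v * coord) * lift k f"
proof -
  have "coeff f (Suc k) = 0" using assms by (simp add: coeff_eq_0)
  then have "lift (Suc k) (smult u f) = Const u * Var 3 * lift k f"
    by (simp add: lift_def sum_distrib_left Const_mult Suc_diff_le algebra_simps)
  moreover have "lift (Suc k) (pCons 0 (smult v f)) = Const v * coord * lift k f"
    by (simp add: lift_def sum.atMost_Suc_shift sum_distrib_left Const_mult algebra_simps del: sum.atMost_Suc)
  ultimately show ?thesis
    by (simp add: lift_add algebra_simps)
qed

text \<open>Modulo the equation of the line, each variable is the homogenization by \<open>z\<close> of its restriction.
  By multiplicativity the same follows for every homogeneous polynomial.\<close>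

lemma form_dvd_Var:
  obtains u v where "restr (Var i) = [:u, v:]" "form dvd Var i - (Const u * Var 3 + Const v * coord)"
proof -
  have c: "c = - (a * x0 + b * y0)" by (rule add_eq_0_iff[THEN iffD1, OF on_line])
  have l3: "l3 = - (l1 * x0 + l2 * y0)" by (rule add_eq_0_iff[THEN iffD1, OF base])
  have det': "a * l2 = 1 + b * l1" using det by (simp add: algebra_simps)
  have C: "Const a * Const l2 = 1 + Const b * Const l1"
    using det' by (metis Const_add Const_mult Const_1)
  consider "i = 1" | "i = 2" | "i = 3" using exhaust_3 by blast
  then show thesis
  proof cases
    case 1
    have "Var 1 - (Const x0 * Var 3 + Const (- b) * coord) = Const l2 * form"
      using C unfolding linform_def c l3 prod.case Const_simps by algebra
    then show ?thesis using that[of x0 "- b"] 1 by (simp add: restr_def)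
  next
    case 2
    have "Var 2 - (Const y0 * Var 3 + Const a * coord) = Const (- l1) * form"
      using C unfolding linform_def c l3 prod.case Const_simps by algebra
    then show ?thesis using that[of y0 a] 2 by (simp add: restr_def)
  next
    case 3
    then show ?thesis using that[of 1 0] by (simp add: pCons_one)
  qed
qed

lemma form_dvd_diff_lift:
  assumes "homogeneous k p"
  shows "form dvd p - lift k (restr p)"
proof -
  have mono: "form dvd single m u - lift (mdeg m) (restr (single m u))" for m u
  proof (induction "mdeg m" arbitrary: m)
    case 0
    then have "m = 0" by (intro poly_mapping_eqI) simp
    then show ?case by (simp add: lift_def flip: Const_def)
  next
    case (Suc n)
    then obtain i where i: "lookup m i > 0"
      by (metis gr0I old.nat.distinct(2) sum.neutral)
    define m' where "m' = m - single i 1"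
    have "single i 1 + m' = m"
      unfolding m'_def
      by (rule poly_mapping_eqI) (use i in \<open>auto simp: lookup_add lookup_minus lookup_single when_def\<close>)
    then have m': "mdeg m = Suc (mdeg m')"
      using mdeg_add[of "single i 1" m'] mdeg_single[of i 1] by simp
    define q where "q = single m' u"
    have q: "single m u = Var i * q"
      using single_as_Var_mult[OF i] by (simp add: m'_def q_def)
    have IH: "form dvd q - lift (mdeg m') (restr q)"
      using Suc m' by (simp add: q_def)
    obtain s t where st: "restr (Var i) = [:s, t:]"
      "form dvd Var i - (Const s * Var 3 + Const t * coord)"
      using form_dvd_Var by metis
    have "homogeneous (mdeg m') q"
      by (auto simp: q_def homogeneous_def in_keys_iff lookup_single when_def split: if_splits)
    then have "lift (mdeg m) (restr (Var i * q)) = (Const s * Var 3 + Const t * coord) * lift (mdeg m') (restr q)"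
      unfolding m' restr_mult st(1) by (intro lift_Suc_mult degree_restr)
    then have "Var i * q - lift (mdeg m) (restr (Var i * q))
        = (Var i - (Const s * Var 3 + Const t * coord)) * q
          + (Const s * Var 3 + Const t * coord) * (q - lift (mdeg m') (restr q))"
      by (simp add: algebra_simps)
    then show ?case unfolding q using IH st(2) by (simp add: dvd_add dvd_mult dvd_mult2)
  qed
  define s where "s = (\<lambda>m. single m (lookup p m))"
  have "form dvd sum s F - lift k (restr (sum s F))" if "F \<subseteq> keys p" for F
    using finite_subset[OF that finite_keys] that
  proof (induction F rule: finite_induct)
    case empty
    then show ?case by simp
  next
    case (insert m F)
    then have "form dvd s m - lift k (restr (s m))"
      using mono[of m] assms by (auto simp: s_def homogeneous_def)
    then show ?case
      using insert dvd_add[of form "s m - lift k (restr (s m))" "sum s F - lift k (restr (sum s F))"]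
      by (simp add: restr_add lift_add algebra_simps)
  qed
  from this[of "keys p"] show ?thesis
    unfolding s_def using poly_mapping_as_sum[of "keys p" p] by simp
qed

text \<open>Restriction sets \<open>z = 1\<close>, so only on homogeneous polynomials is the equation of the line the whole
  kernel.\<close>

lemma form_dvd_iff:
  assumes "homogeneous k p"
  shows "form dvd p \<longleftrightarrow> restr p = 0"
proof
  show "form dvd p" if "restr p = 0"
    using form_dvd_diff_lift[OF assms] that by simp
qed (rule restr_dvd)

lemma restr_eq_0_degree_0:
  assumes "homogeneous 0 p" "restr p = 0"
  shows "p = 0"
proof -
  obtain q where q: "p = form * q"
    using assms(2) form_dvd_iff[OF assms(1)] by (auto elim: dvdE)
  then have "q = 0"
    using homogeneous_cofactor(2)[of 0 form q "Suc 0"] assms(1) form_ne_0 by simp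
  then show ?thesis using q by simp
qed

lemma restr_eq_0_factor:
  assumes "homogeneous (Suc k) p" "restr p = 0"
  shows "\<exists>q. p = form * q \<and> homogeneous k q"
proof -
  obtain q where q: "p = form * q"
    using assms(2) form_dvd_iff[OF assms(1)] by (auto elim: dvdE)
  then have "homogeneous k q"
    using homogeneous_cofactor(1)[of "Suc k" form q "Suc 0"] assms(1) form_ne_0 by simp
  with q show ?thesis by blast
qed

end

lemma plane_line_exists:
  assumes "a \<noteq> 0 \<or> b \<noteq> (0::'k::field)"
  obtains x0 y0 l1 l2 l3 where "plane_line a b c x0 y0 l1 l2 l3"
proof (cases "a = 0")
  case True
  then have "plane_line a b c 0 (- c / b) (- 1 / b) 0 0"
    using assms by unfold_locales auto
  then show ?thesis using that by blast
next
  case False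
  then have "plane_line a b c (- c / a) 0 0 (1 / a) 0"
    by unfold_locales auto
  then show ?thesis using that by blast
qed

section \<open>Univariate polynomials\<close>

text \<open>Powers of distinct linear polynomials are coprime; over a general field this is read off from the
  root orders.\<close>

lemma prod_linear_powers_dvd:
  fixes q :: "'k::field poly"
  assumes "finite A" "\<And>u. u \<in> A \<Longrightarrow> [:- u, 1:] ^ m u dvd q"
  shows "(\<Prod>u\<in>A. [:- u, 1:] ^ m u) dvd q"
proof (cases "q = 0")
  case False
  show ?thesis using assms
  proof (induction A rule: finite_induct)
    case (insert u A)
    then obtain g where g: "q = (\<Prod>u\<in>A. [:- u, 1:] ^ m u) * g" by (auto elim: dvdE)
    have "poly (\<Prod>u\<in>A. [:- u, 1:] ^ m u) u \<noteq> 0"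
      using insert by (auto simp: poly_prod)
    then have "order u (\<Prod>u\<in>A. [:- u, 1:] ^ m u) = 0"
      by (simp add: order_0I)
    then have "order u q = order u g"
      using False unfolding g by (subst order_mult) auto
    moreover have "m u \<le> order u q"
      using insert(4)[of u] False order_divides by blast
    ultimately have "[:- u, 1:] ^ m u dvd g" by (simp add: order_divides)
    then show ?case
      using insert(1,2) g by (simp add: mult.commute mult_dvd_mono)
  qed simp
qed simp

lemma degree_prod_linear_powers:
  "degree (\<Prod>u\<in>A. [:- u, 1:] ^ m u :: 'k::field poly) = sum m A"
  by (cases "finite A") (simp_all add: degree_prod_sum_eq degree_linear_power)

lemma degree_prod_linear: "degree (\<Prod>u\<in>A. [:- u, 1:] :: 'k::field poly) = card A"
  using degree_prod_linear_powers[of "\<lambda>_. 1" A] by simp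

text \<open>The difference of the two sides has degree below \<open>card A\<close> and vanishes on \<open>A\<close>.\<close>

lemma lagrange_interpolation:
  fixes r :: "'k::field poly"
  assumes "finite A" "r = 0 \<or> degree r < card A"
  shows "r = (\<Sum>u\<in>A. smult (poly r u / poly (\<Prod>w\<in>A - {u}. [:- w, 1:]) u) (\<Prod>w\<in>A - {u}. [:- w, 1:]))"
    (is "r = (\<Sum>u\<in>A. smult (?c u) (?P u))")
proof (cases "A = {}")
  case True
  then show ?thesis using assms by auto
next
  case False
  define D where "D = r - (\<Sum>u\<in>A. smult (?c u) (?P u))"
  have P: "degree (?P u) \<le> card A - 1" if "u \<in> A" for u
    using that assms(1) by (simp add: degree_prod_linear)
  have pos: "card A > 0" using False assms(1) by (simp add: card_gt_0_iff)
  have "degree (\<Sum>u\<in>A. smult (?c u) (?P u)) \<le> card A - 1"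
    by (rule degree_sum_le[OF assms(1)]) (rule order_trans[OF degree_smult_le P])
  moreover have "degree r \<le> card A - 1" using assms pos by auto
  ultimately have deg: "degree D < card A"
    unfolding D_def using pos degree_diff_le[of r "card A - 1"] by fastforce
  have "poly D w = 0" if w: "w \<in> A" for w
  proof -
    have "poly (?P u) w = 0" if "u \<in> A" "u \<noteq> w" for u
      using that w assms(1) by (auto simp: poly_prod)
    then have "(\<Sum>u\<in>A. ?c u * poly (?P u) w) = (\<Sum>u\<in>A. if u = w then ?c u * poly (?P u) w else 0)"
      by (intro sum.cong) auto
    also have "\<dots> = ?c w * poly (?P w) w"
      using w assms(1) by (simp add: sum.delta')
    also have "\<dots> = poly r w"
      using assms(1) by (auto simp: poly_prod)
    finally show ?thesis by (simp add: D_def poly_sum)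
  qed
  then have "A \<subseteq> {w. poly D w = 0}" by auto
  then have "D = 0"
    using deg card_poly_roots_bound[of D] card_mono[OF poly_roots_finite[of D], of A]
    by (metis le_trans not_less)
  then show ?thesis unfolding D_def by (rule eq_iff_diff_eq_0[THEN iffD2])
qed

section \<open>Vector spaces of homogeneous polynomials\<close>

definition pscale :: "'k::field \<Rightarrow> 'k mpoly3 \<times> 'k mpoly3 \<Rightarrow> 'k mpoly3 \<times> 'k mpoly3" where
  "pscale c v = (Const c * fst v, Const c * snd v)"

lemma linear_space_pairI: "linear_space s1 \<Longrightarrow> linear_space s2 \<Longrightarrow> linear_space_pair s1 s2"
  by (simp add: linear_space_pair_def vector_space_pair_def linear_space_def)

lemma linear_space_upoly: "linear_space (smult :: 'k::field \<Rightarrow> 'k poly \<Rightarrow> 'k poly)"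
  by unfold_locales (auto simp: smult_add_left smult_add_right)

lemma linear_space_mpoly: "linear_space (\<lambda>c (p::'k::field mpoly3). Const c * p)"
  by unfold_locales (auto simp: Const_simps algebra_simps)

lemma linear_space_mpair: "linear_space (pscale :: 'k::field \<Rightarrow> _)"
  by unfold_locales (simp_all add: pscale_def Const_add Const_mult distrib_left distrib_right mult.assoc)

interpretation upoly: linear_space "smult :: 'k::field \<Rightarrow> 'k poly \<Rightarrow> 'k poly"
  by (rule linear_space_upoly)
interpretation mpoly: linear_space "\<lambda>c (p::'k::field mpoly3). Const c * p"
  by (rule linear_space_mpoly)
interpretation mpair: linear_space "pscale :: 'k::field \<Rightarrow> _"
  by (rule linear_space_mpair)

interpretation upoly_upoly: linear_space_pair "smult :: 'k::field \<Rightarrow> 'k poly \<Rightarrow> 'k poly" "smult :: 'k \<Rightarrow> 'k poly \<Rightarrow> 'k poly"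
  by (intro linear_space_pairI linear_space_upoly)
interpretation mpoly_upoly: linear_space_pair "\<lambda>c (p::'k::field mpoly3). Const c * p" "smult :: 'k \<Rightarrow> 'k poly \<Rightarrow> 'k poly"
  by (intro linear_space_pairI linear_space_mpoly linear_space_upoly)
interpretation mpoly_mpoly: linear_space_pair "\<lambda>c (p::'k::field mpoly3). Const c * p" "\<lambda>c (p::'k mpoly3). Const c * p"
  by (intro linear_space_pairI linear_space_mpoly)
interpretation mpoly_mpair: linear_space_pair "\<lambda>c (p::'k::field mpoly3). Const c * p" "pscale :: 'k \<Rightarrow> _"
  by (intro linear_space_pairI linear_space_mpoly linear_space_mpair)
interpretation mpair_mpoly: linear_space_pair "pscale :: 'k::field \<Rightarrow> _" "\<lambda>c (p::'k mpoly3). Const c * p"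
  by (intro linear_space_pairI linear_space_mpair linear_space_mpoly)
interpretation mpair_upoly: linear_space_pair "pscale :: 'k::field \<Rightarrow> _" "smult :: 'k \<Rightarrow> 'k poly \<Rightarrow> 'k poly"
  by (intro linear_space_pairI linear_space_mpair linear_space_upoly)
interpretation mpair_mpair: linear_space_pair "pscale :: 'k::field \<Rightarrow> _" "pscale :: 'k \<Rightarrow> _"
  by (intro linear_space_pairI linear_space_mpair)

definition upto_degree :: "nat \<Rightarrow> 'k::field poly set" where
  "upto_degree m = {f. \<forall>i\<ge>m. coeff f i = 0}"

lemma upto_degree_iff: "f \<in> upto_degree m \<longleftrightarrow> f = 0 \<or> degree f < m"
  unfolding upto_degree_def
  by (auto simp: coeff_eq_0) (metis leading_coeff_0_iff not_less)

lemma subspace_upto_degree: "upoly.subspace (upto_degree m)"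
  by (auto simp: upoly.subspace_def upto_degree_def)

lemma fdim_upto_degree: "upoly.fdim (upto_degree m :: 'k::field poly set) m"
proof (induction m)
  case 0
  have "upto_degree 0 = {0 :: 'k poly}" by (auto simp: upto_degree_iff)
  then show ?case using upoly.fdim_0 by simp
next
  case (Suc m)
  have shift: "Vector_Spaces.linear smult smult (\<lambda>f::'k poly. pCons 0 f)"
    by unfold_locales auto
  have ev: "Vector_Spaces.linear smult smult (\<lambda>f::'k poly. [:coeff f 0:])"
    by unfold_locales auto
  have "{f \<in> upto_degree (Suc m). [:coeff f 0:] = 0} = (\<lambda>f. pCons 0 f) ` (upto_degree m :: 'k poly set)"
  proof (intro equalityI subsetI)
    fix f :: "'k poly" assume f: "f \<in> {f \<in> upto_degree (Suc m). [:coeff f 0:] = 0}"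
    obtain c g where g: "f = pCons c g" by (cases f)
    have "c = 0" using f g by simp
    moreover have "g \<in> upto_degree m"
      using f unfolding upto_degree_def g by (auto simp: coeff_pCons split: nat.splits)
    ultimately show "f \<in> (\<lambda>f. pCons 0 f) ` upto_degree m" using g by blast
  qed (auto simp: upto_degree_def coeff_pCons split: nat.splits)
  then have 1: "upoly.fdim {f \<in> upto_degree (Suc m). [:coeff f 0:] = (0 :: 'k poly)} m"
    using upoly_upoly.fdim_inj_image[OF shift Suc] by simp
  have "(\<lambda>f::'k poly. [:coeff f 0:]) ` upto_degree (Suc m) = upoly.span {1}"
  proof (intro equalityI subsetI)
    fix g :: "'k poly" assume "g \<in> upoly.span {1}"
    then obtain c where "g = [:c:]" by (auto simp: upoly.span_singleton smult_one)
    then show "g \<in> (\<lambda>f::'k poly. [:coeff f 0:]) ` upto_degree (Suc m)"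
      by (intro image_eqI[of _ _ "[:c:]"]) (auto simp: upto_degree_iff)
  qed (auto simp: upoly.span_singleton image_iff smult_one)
  then have 2: "upoly.fdim ((\<lambda>f::'k poly. [:coeff f 0:]) ` upto_degree (Suc m)) 1"
    unfolding upoly.fdim_def by (intro exI[of _ "{1}"]) (auto simp: upoly.dependent_single)
  show ?case
    using upoly_upoly.rank_nullity[OF ev subspace_upto_degree 1 2] by simp
qed

lemma fdim_mult_upto_degree:
  assumes "q \<noteq> (0 :: 'k::field poly)"
  shows "upoly.fdim ((*) q ` upto_degree m) m"
proof (rule upoly_upoly.fdim_inj_image[OF _ fdim_upto_degree])
  show "Vector_Spaces.linear smult smult ((*) q)"
    by unfold_locales (auto simp: algebra_simps)
qed (use assms in auto)

fun sdim :: "nat \<Rightarrow> nat" where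
  "sdim 0 = 1"
| "sdim (Suc k) = sdim k + (k + 2)"

lemma sdim_closed: "2 * sdim k = (k + 1) * (k + 2)"
  by (induction k) auto

abbreviation homs :: "nat \<Rightarrow> 'k::field mpoly3 set" where
  "homs k \<equiv> {p. homogeneous k p}"

lemma subspace_homs: "mpoly.subspace (homs k)"
  by (auto simp: mpoly.subspace_def intro: homogeneous_add homogeneous_Const_mult)

context plane_line
begin

lemma linear_restr: "Vector_Spaces.linear (\<lambda>c p. Const c * p) smult restr"
  by unfold_locales (auto simp: restr_simps)

lemma restr_image: "restr ` homs k = upto_degree (Suc k)"
proof (intro equalityI subsetI)
  fix f :: "'k poly" assume "f \<in> upto_degree (Suc k)"
  then have "degree f \<le> k" by (auto simp: upto_degree_iff)
  then show "f \<in> restr ` homs k"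
    using restr_lift[of f k] homogeneous_lift[of k f] by (metis imageI mem_Collect_eq)
next
  fix f assume "f \<in> restr ` homs k"
  then show "f \<in> upto_degree (Suc k)"
    using degree_restr by (fastforce simp: upto_degree_iff)
qed

text \<open>Restriction to any line has kernel the multiples of its equation, which gives the recursion
  defining \<open>sdim\<close>.\<close>

lemma fdim_homs_via_restriction: "mpoly.fdim (homs k :: 'k mpoly3 set) (sdim k)"
proof (induction k)
  case 0
  have "{p \<in> homs 0. restr p = 0} = {0 :: 'k mpoly3}" using restr_eq_0_degree_0 by auto
  then have "mpoly.fdim (homs 0 :: 'k mpoly3 set) (0 + Suc 0)"
    using mpoly.fdim_0 fdim_upto_degree[of "Suc 0"] restr_image[of 0]
    by (intro mpoly_upoly.rank_nullity[OF linear_restr subspace_homs]) auto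
  then show ?case by simp
next
  case (Suc k)
  have lin: "Vector_Spaces.linear (\<lambda>c p. Const c * p) (\<lambda>c p. Const c * p) ((*) form)"
    by unfold_locales (auto simp: algebra_simps)
  have "{p \<in> homs (Suc k). restr p = 0} = (*) form ` homs k"
  proof (intro equalityI subsetI)
    fix p assume "p \<in> {p \<in> homs (Suc k). restr p = 0}"
    then show "p \<in> (*) form ` homs k"
      using restr_eq_0_factor[of k p] by auto
  qed (use homogeneous_mult[of "Suc 0" form k] in \<open>auto simp: restr_mult\<close>)
  moreover have "mpoly.fdim ((*) form ` homs k) (sdim k)"
    by (rule mpoly_mpoly.fdim_inj_image[OF lin Suc]) (use form_ne_0 in auto)
  ultimately have "mpoly.fdim (homs (Suc k) :: 'k mpoly3 set) (sdim k + Suc (Suc k))"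
    using fdim_upto_degree[of "Suc (Suc k)"] restr_image[of "Suc k"]
    by (intro mpoly_upoly.rank_nullity[OF linear_restr subspace_homs]) auto
  then show ?case by simp
qed

end

lemma fdim_homs: "mpoly.fdim (homs k :: 'k::field mpoly3 set) (sdim k)"
proof -
  obtain x0 y0 l1 l2 l3 :: 'k where "plane_line 1 0 0 x0 y0 l1 l2 l3"
    using plane_line_exists[of 1 0 0] zero_neq_one by metis
  then show ?thesis by (rule plane_line.fdim_homs_via_restriction)
qed

lemma fdim_homs_Times: "mpair.fdim (homs i \<times> homs j :: ('k::field mpoly3 \<times> 'k mpoly3) set) (sdim i + sdim j)"
proof -
  have f: "Vector_Spaces.linear pscale (\<lambda>c p. Const c * p) (fst :: 'k mpoly3 \<times> 'k mpoly3 \<Rightarrow> _)"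
    by unfold_locales (auto simp: pscale_def)
  have g: "Vector_Spaces.linear (\<lambda>c p. Const c * p) pscale (\<lambda>p :: 'k mpoly3. (0, p))"
    by unfold_locales (auto simp: pscale_def)
  have sub: "mpair.subspace (homs i \<times> homs j :: ('k mpoly3 \<times> 'k mpoly3) set)"
    by (auto simp: mpair.subspace_def pscale_def zero_prod_def intro: homogeneous_add homogeneous_Const_mult)
  have "{v \<in> homs i \<times> homs j. fst v = (0 :: 'k mpoly3)} = (\<lambda>p. (0, p)) ` (homs j :: 'k mpoly3 set)"
    by auto
  moreover have "mpair.fdim ((\<lambda>p. (0 :: 'k mpoly3, p)) ` (homs j :: 'k mpoly3 set)) (sdim j)"
    by (rule mpoly_mpair.fdim_inj_image[OF g fdim_homs]) (auto simp: zero_prod_def)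
  moreover have "fst ` (homs i \<times> homs j :: ('k mpoly3 \<times> 'k mpoly3) set) = homs i"
    using homogeneous_0 by (auto simp only: fst_image_times split: if_splits)
  ultimately have "mpair.fdim (homs i \<times> homs j :: ('k mpoly3 \<times> 'k mpoly3) set) (sdim j + sdim i)"
    using fdim_homs[of i] by (intro mpair_mpoly.rank_nullity[OF f sub]) (simp_all only:)
  then show ?thesis by (simp add: add.commute)
qed

section \<open>Logarithmic vector fields\<close>

text \<open>A pair \<open>(f, g)\<close> stands for the vector field \<open>f \<partial>/\<partial>x + g \<partial>/\<partial>y\<close>, which kills \<open>z\<close>. Modulo the Euler
  derivation every logarithmic derivation of the cone is of this kind. \<open>act t v\<close> is the value of the
  field \<open>v\<close> at the linear form with coefficients \<open>t\<close>.\<close>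

definition act :: "'k \<times> 'k \<times> 'k \<Rightarrow> 'k mpoly3 \<times> 'k mpoly3 \<Rightarrow> 'k::field mpoly3" where
  "act = (\<lambda>(a, b, c) v. Const a * fst v + Const b * snd v)"

definition log_fields :: "('k::field \<times> 'k \<times> 'k) set \<Rightarrow> nat \<Rightarrow> ('k mpoly3 \<times> 'k mpoly3) set" where
  "log_fields T k = {v. homogeneous k (fst v) \<and> homogeneous k (snd v) \<and> (\<forall>t\<in>T. linform t dvd act t v)}"

definition fmult :: "'k::field mpoly3 \<Rightarrow> 'k mpoly3 \<times> 'k mpoly3 \<Rightarrow> 'k mpoly3 \<times> 'k mpoly3" where
  "fmult p v = (p * fst v, p * snd v)"

text \<open>Two triples that define lines define the same line exactly when they are proportional.\<close>

definition proportional :: "'k \<times> 'k \<times> 'k \<Rightarrow> 'k \<times> 'k \<times> 'k \<Rightarrow> 'k::field \<Rightarrow> bool" where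
  "proportional = (\<lambda>(a', b', c') (a, b, c) \<mu>. a' = \<mu> * a \<and> b' = \<mu> * b \<and> c' = \<mu> * c)"

definition distinct_lines :: "('k::field \<times> 'k \<times> 'k) set \<Rightarrow> bool" where
  "distinct_lines T \<longleftrightarrow> finite T \<and> (\<forall>(a, b, c)\<in>T. a \<noteq> 0 \<or> b \<noteq> 0) \<and>
     (\<forall>s\<in>T. \<forall>t\<in>T. (\<exists>\<mu>. proportional s t \<mu>) \<longrightarrow> s = t)"

lemma distinct_lines_subset: "distinct_lines T \<Longrightarrow> S \<subseteq> T \<Longrightarrow> distinct_lines S"
  unfolding distinct_lines_def by (meson finite_subset subsetD)

lemma act_add: "act t (v + w) = act t v + act t w"
  by (simp add: act_def split_beta algebra_simps)
lemma act_diff: "act t (v - w) = act t v - act t w"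
  by (simp add: act_def split_beta algebra_simps)
lemma act_0 [simp]: "act t 0 = 0"
  by (simp add: act_def split_beta)
lemma act_fmult: "act t (fmult p v) = p * act t v"
  by (simp add: act_def fmult_def split_beta algebra_simps)
lemma act_pscale: "act t (pscale c v) = Const c * act t v"
  by (simp add: act_def pscale_def split_beta algebra_simps)

lemma fmult_add: "fmult p (v + w) = fmult p v + fmult p w"
  and fmult_add_left: "fmult (p + q) v = fmult p v + fmult q v"
  and fmult_0 [simp]: "fmult 0 v = 0"
  and fmult_0_right [simp]: "fmult p 0 = 0"
  and fmult_fmult: "fmult p (fmult q v) = fmult (p * q) v"
  and fmult_pscale: "fmult p (pscale c v) = pscale c (fmult p v)"
  by (auto simp: fmult_def pscale_def prod_eq_iff algebra_simps)

lemma fmult_eq_0_iff: "fmult p v = 0 \<longleftrightarrow> p = 0 \<or> v = 0"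
  by (auto simp: fmult_def prod_eq_iff)

lemma homogeneous_act:
  assumes "v \<in> log_fields T k"
  shows "homogeneous k (act t v)"
  using assms by (auto simp: log_fields_def act_def split_beta intro!: homogeneous_add homogeneous_Const_mult)

lemma log_fields_0 [simp]: "0 \<in> log_fields T k"
  by (simp add: log_fields_def)

lemma log_fields_add: "v \<in> log_fields T k \<Longrightarrow> w \<in> log_fields T k \<Longrightarrow> v + w \<in> log_fields T k"
  by (auto simp: log_fields_def act_add intro: homogeneous_add)

lemma log_fields_fmult:
  "homogeneous d p \<Longrightarrow> v \<in> log_fields T k \<Longrightarrow> fmult p v \<in> log_fields T (d + k)"
  by (auto simp: log_fields_def act_fmult) (auto simp: fmult_def intro: homogeneous_mult)

lemma log_fields_pscale: "v \<in> log_fields T k \<Longrightarrow> pscale c v \<in> log_fields T k"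
  by (auto simp: log_fields_def act_pscale) (auto simp: pscale_def intro: homogeneous_Const_mult)

lemma log_fields_diff: "v \<in> log_fields T k \<Longrightarrow> w \<in> log_fields T k \<Longrightarrow> v - w \<in> log_fields T k"
  by (auto simp: log_fields_def act_diff intro: homogeneous_diff)

lemma log_fields_mono: "S \<subseteq> T \<Longrightarrow> log_fields T k \<subseteq> log_fields S k"
  by (auto simp: log_fields_def)

lemma subspace_log_fields: "mpair.subspace (log_fields T k)"
  by (auto simp: mpair.subspace_def intro: log_fields_add log_fields_pscale)

lemma linear_fmult: "Vector_Spaces.linear pscale pscale (fmult p)"
  by unfold_locales (auto simp: fmult_add fmult_pscale)

lemma log_fields_empty: "log_fields {} k = homs k \<times> homs k"
  by (auto simp: log_fields_def)

context plane_line
begin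

text \<open>The two components of a field along the line, as polynomials in the parameter.\<close>

abbreviation normal :: "'k mpoly3 \<times> 'k mpoly3 \<Rightarrow> 'k poly" where
  "normal v \<equiv> restr (act (a, b, c) v)"

abbreviation tangential :: "'k mpoly3 \<times> 'k mpoly3 \<Rightarrow> 'k poly" where
  "tangential v \<equiv> restr (act (l1, l2, l3) v)"

text \<open>Every linear form is a combination of the equation of the line, the coordinate on it and \<open>z\<close>;
  the last two coefficients are those of the restricted form.\<close>

lemma linform_decompose:
  assumes "s = (a', b', c')"
  shows "linform s = Const (a' * l2 - b' * l1) * form + Const (a * b' - b * a') * coord
      + Const (a' * x0 + b' * y0 + c') * Var 3"
    and "act s v = Const (a' * l2 - b' * l1) * act (a, b, c) v + Const (a * b' - b * a') * act (l1, l2, l3) v"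
proof -
  have C: "Const a * Const l2 = 1 + Const b * Const l1"
    using det by (metis Const_add Const_mult Const_1 diff_eq_eq)
  have c: "c = - (a * x0 + b * y0)" by (rule add_eq_0_iff[THEN iffD1, OF on_line])
  have l3: "l3 = - (l1 * x0 + l2 * y0)" by (rule add_eq_0_iff[THEN iffD1, OF base])
  show "linform s = Const (a' * l2 - b' * l1) * form + Const (a * b' - b * a') * coord
      + Const (a' * x0 + b' * y0 + c') * Var 3"
    using C unfolding assms linform_def c l3 prod.case Const_simps by algebra
  show "act s v = Const (a' * l2 - b' * l1) * act (a, b, c) v + Const (a * b' - b * a') * act (l1, l2, l3) v"
    using C unfolding assms act_def prod.case Const_simps by algebra
qed

lemma restr_linform_eq_0:
  assumes "restr (linform s) = 0"
  obtains \<mu> where "proportional s (a, b, c) \<mu>"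
proof -
  obtain a' b' c' where s: "s = (a', b', c')" by (cases s)
  define \<mu> where "\<mu> = a' * l2 - b' * l1"
  have 0: "a * b' = b * a'" "a' * x0 + b' * y0 + c' = 0"
    using assms by (auto simp: s restr_linform algebra_simps)
  have "a' = \<mu> * a" "b' = \<mu> * b"
    unfolding \<mu>_def using det 0(1) by algebra+
  moreover have "c' = \<mu> * c"
    using calculation 0(2) on_line by algebra
  ultimately show thesis using that[of \<mu>] by (simp add: s proportional_def)
qed

text \<open>The values on the two linear forms attached to a line determine a field, because their
  coefficient matrix has determinant one.\<close>

lemma fst_snd_from_act:
  "fst v = Const l2 * act (a, b, c) v - Const b * act (l1, l2, l3) v"
  "snd v = Const a * act (l1, l2, l3) v - Const l1 * act (a, b, c) v"
proof -
  have C: "Const a * Const l2 = 1 + Const b * Const l1"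
    using det by (metis Const_add Const_mult Const_1 diff_eq_eq)
  show "fst v = Const l2 * act (a, b, c) v - Const b * act (l1, l2, l3) v"
    using C unfolding act_def prod.case by algebra
  show "snd v = Const a * act (l1, l2, l3) v - Const l1 * act (a, b, c) v"
    using C unfolding act_def prod.case by algebra
qed

end

lemma linform_ne_0:
  assumes "a \<noteq> 0 \<or> b \<noteq> 0"
  shows "linform (a, b, c) \<noteq> 0"
proof -
  obtain x0 y0 l1 l2 l3 where "plane_line a b c x0 y0 l1 l2 l3"
    using plane_line_exists[OF assms] by metis
  then show ?thesis by (rule plane_line.form_ne_0)
qed

lemma distinct_lines_linform_ne_0:
  assumes "distinct_lines T" "t \<in> T"
  shows "linform t \<noteq> 0"
proof -
  obtain a b c where t: "t = (a, b, c)" by (cases t)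
  have "a \<noteq> 0 \<or> b \<noteq> 0" using assms by (auto simp: distinct_lines_def t)
  then show ?thesis unfolding t by (rule linform_ne_0)
qed

text \<open>Linear forms of distinct lines are coprime: restricted to the line of \<open>s\<close>, the product of the
  other forms is nonzero in a domain.\<close>

lemma linform_dvd_cofactor:
  assumes "distinct_lines (insert s T)" "s \<notin> T" "finite T" "homogeneous d p"
    and "linform s dvd (\<Prod>t\<in>T. linform t) * p"
  shows "linform s dvd p"
proof -
  obtain a b c where s: "s = (a, b, c)" by (cases s)
  have ab: "a \<noteq> 0 \<or> b \<noteq> 0" using assms(1) by (auto simp: distinct_lines_def s)
  obtain x0 y0 l1 l2 l3 where "plane_line a b c x0 y0 l1 l2 l3"
    using plane_line_exists[OF ab] by metis
  then interpret plane_line a b c x0 y0 l1 l2 l3 .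
  have "restr (linform t) \<noteq> 0" if "t \<in> T" for t
  proof
    assume "restr (linform t) = 0"
    then obtain \<mu> where "proportional t s \<mu>" using restr_linform_eq_0 s by metis
    then show False using assms(1,2) that unfolding distinct_lines_def by blast
  qed
  moreover have "(\<Prod>t\<in>T. restr (linform t)) * restr p = 0"
    using restr_dvd[of "(\<Prod>t\<in>T. linform t) * p"] assms(5) by (simp add: s restr_simps)
  ultimately have "restr p = 0" using assms(3) by auto
  then show ?thesis using form_dvd_iff[OF assms(4)] s by simp
qed

lemma prod_linform_dvd:
  assumes "distinct_lines T" "homogeneous d p" "\<And>t. t \<in> T \<Longrightarrow> linform t dvd p"
  shows "(\<Prod>t\<in>T. linform t) dvd p"
proof -
  have "finite T" using assms(1) by (simp add: distinct_lines_def)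
  then show ?thesis using assms
  proof (induction T rule: finite_induct)
    case (insert s T)
    have "distinct_lines T" using insert(4) distinct_lines_subset by blast
    then have "(\<Prod>t\<in>T. linform t) dvd p"
      by (rule insert(3)) (use insert(5,6) in auto)
    then obtain q where q: "p = (\<Prod>t\<in>T. linform t) * q" by (rule dvdE)
    have "homogeneous (\<Sum>t\<in>T. Suc 0) (\<Prod>t\<in>T. linform t)"
      by (rule homogeneous_prod) simp
    moreover have "(\<Prod>t\<in>T. linform t) \<noteq> 0"
      using insert(1) distinct_lines_linform_ne_0[OF \<open>distinct_lines T\<close>] by simp
    ultimately have "homogeneous (d - (\<Sum>t\<in>T. Suc 0)) q"
      using homogeneous_cofactor(1) insert(5) q by metis
    then have "linform s dvd q"
      using linform_dvd_cofactor[OF insert(4,2,1)] insert(6)[of s] q by blast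
    then show ?case using insert(1,2) q by (simp add: mult.commute mult_dvd_mono)
  qed simp
qed

text \<open>The new line has equation \<open>(a, b, c)\<close>, and \<open>T\<close> holds the equations of the lines already there.\<close>

locale line_deletion = plane_line a b c x0 y0 l1 l2 l3
  for a b c x0 y0 l1 l2 l3 :: "'k::field" +
  fixes T :: "('k \<times> 'k \<times> 'k) set"
  assumes distinct: "distinct_lines (insert (a, b, c) T)"
    and new_line: "(a, b, c) \<notin> T"
begin

lemma finite_T: "finite T"
  using distinct by (simp add: distinct_lines_def)

lemma distinct_lines_T: "distinct_lines T"
  by (rule distinct_lines_subset[OF distinct]) auto

abbreviation through :: "'k \<Rightarrow> ('k \<times> 'k \<times> 'k) set" where
  "through u \<equiv> {s \<in> T. poly (restr (linform s)) u = 0}"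

text \<open>Points of the new line are identified with their parameters. A line of \<open>T\<close> that is parallel to
  it restricts to a nonzero constant.\<close>

definition points :: "'k set" where
  "points = {u. through u \<noteq> {}}"

definition parallel :: "('k \<times> 'k \<times> 'k) set" where
  "parallel = {s \<in> T. degree (restr (linform s)) = 0}"

definition npoints :: nat where "npoints = card points"

text \<open>Restricted to the line, the value of a logarithmic field of \<open>T\<close> at the equation of the line is
  divisible by this polynomial: a line \<open>v = c u\<close> through the point \<open>u = v = 0\<close> forces
  \<open>v \<theta>(u) - u \<theta>(v)\<close> into its ideal, so \<open>m\<close> such lines force \<open>v ^ m\<close> to divide \<open>v \<theta>(u)\<close> on \<open>u = 0\<close>.\<close>

definition contact :: "'k poly" where
  "contact = (\<Prod>u\<in>points. [:- u, 1:] ^ (card (through u) - 1))"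

abbreviation point_poly :: "'k poly" where
  "point_poly \<equiv> \<Prod>u\<in>points. [:- u, 1:]"

lemma restr_linform_ne_0: "s \<in> T \<Longrightarrow> restr (linform s) \<noteq> 0"
proof
  assume "s \<in> T" "restr (linform s) = 0"
  then obtain \<mu> where "proportional s (a, b, c) \<mu>" using restr_linform_eq_0 by metis
  then show False using distinct new_line \<open>s \<in> T\<close> unfolding distinct_lines_def by blast
qed

lemma finite_points: "finite points"
proof -
  have "points \<subseteq> (\<Union>s\<in>T. {u. poly (restr (linform s)) u = 0})"
    by (auto simp: points_def)
  moreover have "finite (\<Union>s\<in>T. {u. poly (restr (linform s)) u = 0})"
    using finite_T restr_linform_ne_0 poly_roots_finite by blast
  ultimately show ?thesis by (rule finite_subset)
qed

lemma card_through_pos: "u \<in> points \<Longrightarrow> 0 < card (through u)"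
  using finite_T by (auto simp: points_def card_gt_0_iff)

lemma restr_linform_through:
  assumes "poly (restr (linform (a', b', c'))) u = 0"
  shows "restr (linform (a', b', c')) = smult (a * b' - b * a') [:- u, 1:]"
  using assms by (simp add: restr_linform algebra_simps eq_neg_iff_add_eq_0)

lemma slope_ne_0:
  assumes "(a', b', c') \<in> T" "poly (restr (linform (a', b', c'))) u = 0"
  shows "a * b' - b * a' \<noteq> 0"
  using restr_linform_through[OF assms(2)] restr_linform_ne_0[OF assms(1)] by auto

lemma through_disjoint: "u \<noteq> w \<Longrightarrow> through u \<inter> through w = {}"
proof (rule equals0I)
  fix s assume uw: "u \<noteq> w" and s: "s \<in> through u \<inter> through w"
  obtain a' b' c' where [simp]: "s = (a', b', c')" by (cases s)
  have "poly (smult (a * b' - b * a') [:- u, 1:]) w = 0"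
    using s restr_linform_through[of a' b' c' u] by auto
  then show False using s uw slope_ne_0[of a' b' c' u] by auto
qed

lemma T_split: "T = parallel \<union> (\<Union>u\<in>points. through u)" "parallel \<inter> (\<Union>u\<in>points. through u) = {}"
proof -
  have "s \<in> parallel \<or> (\<exists>u\<in>points. s \<in> through u)" if "s \<in> T" for s
  proof (cases "degree (restr (linform s)) = 0")
    case False
    obtain a' b' c' where s: "s = (a', b', c')" by (cases s)
    define r where "r = - (a' * x0 + b' * y0 + c') / (b' * a - a' * b)"
    have "poly (restr (linform s)) r = 0"
      using False by (auto simp: r_def s restr_linform split: if_splits)
    then have "s \<in> through r" using that by simp
    moreover from this have "r \<in> points" unfolding points_def by blast
    ultimately show ?thesis by blast
  qed (use that in \<open>simp add: parallel_def\<close>)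
  moreover have "parallel \<subseteq> T" unfolding parallel_def by blast
  ultimately show "T = parallel \<union> (\<Union>u\<in>points. through u)"
    by blast
  have "False" if "s \<in> parallel" "s \<in> through u" for s u
  proof -
    obtain a' b' c' where s: "s = (a', b', c')" by (cases s)
    show False
      using that restr_linform_through[of a' b' c' u] slope_ne_0[of a' b' c' u]
      by (simp add: parallel_def s)
  qed
  then show "parallel \<inter> (\<Union>u\<in>points. through u) = {}" by blast
qed

lemma card_T: "card T = card parallel + (\<Sum>u\<in>points. card (through u))"
proof -
  have "card (\<Union>u\<in>points. through u) = (\<Sum>u\<in>points. card (through u))"
    using finite_points finite_T through_disjoint by (intro card_UN_disjoint) auto
  moreover have "card T = card parallel + card (\<Union>u\<in>points. through u)"
  proof -
    have "finite parallel" "finite (\<Union>u\<in>points. through u)"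
      using finite_T finite_points by (auto simp: parallel_def)
    from card_Un_disjoint[OF this T_split(2)] show ?thesis
      by (simp only: T_split(1)[symmetric])
  qed
  ultimately show ?thesis by simp
qed

lemma contact_ne_0 [simp]: "contact \<noteq> 0"
  using finite_points by (auto simp: contact_def)

lemma point_poly_ne_0 [simp]: "point_poly \<noteq> 0"
  using finite_points by auto

lemma degree_contact: "degree contact + npoints + card parallel = card T"
proof -
  have "(\<Sum>u\<in>points. card (through u) - 1) + npoints = (\<Sum>u\<in>points. card (through u) - 1 + 1)"
    unfolding npoints_def card_eq_sum by (rule sum.distrib[symmetric])
  also have "\<dots> = (\<Sum>u\<in>points. card (through u))"
    using card_through_pos by (intro sum.cong) (auto simp: Suc_leI)
  finally show ?thesis
    by (simp add: card_T contact_def degree_prod_linear_powers)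
qed

lemma npoints_le: "npoints \<le> card T"
  using degree_contact by linarith

lemma prod_through:
  assumes "u \<in> points"
  obtains \<kappa> where "\<kappa> \<noteq> 0" "(\<Prod>s\<in>through u. restr (linform s)) = smult \<kappa> ([:- u, 1:] ^ card (through u))"
proof -
  define slope where "slope = (\<lambda>(a', b', c'::'k). a * b' - b * a')"
  have "(\<Prod>s\<in>through u. restr (linform s)) = (\<Prod>s\<in>through u. smult (slope s) [:- u, 1:])"
    using restr_linform_through by (intro prod.cong) (auto simp: slope_def)
  also have "\<dots> = smult (\<Prod>s\<in>through u. slope s) ([:- u, 1:] ^ card (through u))"
    by (simp only: prod_smult prod_constant)
  finally have eq: "(\<Prod>s\<in>through u. restr (linform s))
      = smult (\<Prod>s\<in>through u. slope s) ([:- u, 1:] ^ card (through u))" .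
  have "(\<Prod>s\<in>through u. slope s) \<noteq> 0"
    using slope_ne_0 finite_T by (auto simp: slope_def)
  then show thesis using that eq by blast
qed

lemma prod_parallel:
  obtains \<kappa> where "\<kappa> \<noteq> 0" "(\<Prod>s\<in>parallel. restr (linform s)) = [:\<kappa>:]"
proof -
  have "(\<Prod>s\<in>parallel. restr (linform s)) = (\<Prod>s\<in>parallel. [:coeff (restr (linform s)) 0:])"
    by (intro prod.cong) (auto simp: parallel_def elim!: degree_eq_zeroE)
  also have "\<dots> = [:\<Prod>s\<in>parallel. coeff (restr (linform s)) 0:]"
    by (simp add: prod_to_poly)
  finally have eq: "(\<Prod>s\<in>parallel. restr (linform s)) = [:\<Prod>s\<in>parallel. coeff (restr (linform s)) 0:]" .
  moreover have "(\<Prod>s\<in>parallel. restr (linform s)) \<noteq> 0"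
    using restr_linform_ne_0 finite_T by (auto simp: parallel_def)
  ultimately show thesis using that by auto
qed

text \<open>Each line of \<open>T\<close> that is not parallel restricts to a multiple of \<open>[:- u, 1:]\<close> for the point \<open>u\<close> where it
  meets the new line, and \<open>u\<close> is hit \<open>card (through u)\<close> times.\<close>

lemma prod_restr:
  obtains \<kappa> where "\<kappa> \<noteq> 0" "(\<Prod>s\<in>T. restr (linform s)) = smult \<kappa> (contact * point_poly)"
proof -
  obtain \<kappa>1 where \<kappa>1: "\<kappa>1 \<noteq> 0" "(\<Prod>s\<in>parallel. restr (linform s)) = [:\<kappa>1:]"
    by (rule prod_parallel)
  have "\<forall>u\<in>points. \<exists>\<kappa>. \<kappa> \<noteq> 0 \<and>
      (\<Prod>s\<in>through u. restr (linform s)) = smult \<kappa> ([:- u, 1:] ^ card (through u))"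
  proof
    fix u assume "u \<in> points"
    then show "\<exists>\<kappa>. \<kappa> \<noteq> 0 \<and>
        (\<Prod>s\<in>through u. restr (linform s)) = smult \<kappa> ([:- u, 1:] ^ card (through u))"
      by (rule prod_through) (rule exI, rule conjI)
  qed
  from bchoice[OF this] obtain \<kappa>2 where \<kappa>2': "\<forall>u\<in>points. \<kappa>2 u \<noteq> 0 \<and>
      (\<Prod>s\<in>through u. restr (linform s)) = smult (\<kappa>2 u) ([:- u, 1:] ^ card (through u))"
    by (rule exE)
  have \<kappa>2: "\<kappa>2 u \<noteq> 0"
    "(\<Prod>s\<in>through u. restr (linform s)) = smult (\<kappa>2 u) ([:- u, 1:] ^ card (through u))"
    if "u \<in> points" for u
    using bspec[OF \<kappa>2' that] by (rule conjunct1, rule conjunct2)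
  have "finite parallel" "finite (\<Union>u\<in>points. through u)"
    using finite_T finite_points by (auto simp: parallel_def)
  from prod.union_disjoint[OF this T_split(2), of "\<lambda>s. restr (linform s)"]
  have "(\<Prod>s\<in>T. restr (linform s))
      = (\<Prod>s\<in>parallel. restr (linform s)) * (\<Prod>s\<in>(\<Union>u\<in>points. through u). restr (linform s))"
    by (simp only: T_split(1)[symmetric])
  also have "(\<Prod>s\<in>(\<Union>u\<in>points. through u). restr (linform s))
      = (\<Prod>u\<in>points. \<Prod>s\<in>through u. restr (linform s))"
    using finite_T finite_points through_disjoint by (intro prod.UNION_disjoint) auto
  also have "\<dots> = (\<Prod>u\<in>points. smult (\<kappa>2 u) ([:- u, 1:] ^ (card (through u) - 1) * [:- u, 1:]))"
  proof (intro prod.cong refl)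
    fix u assume u: "u \<in> points"
    obtain j where "card (through u) = Suc j" using gr0_implies_Suc[OF card_through_pos[OF u]] by (rule exE)
    then show "(\<Prod>s\<in>through u. restr (linform s))
        = smult (\<kappa>2 u) ([:- u, 1:] ^ (card (through u) - 1) * [:- u, 1:])"
      by (simp only: \<kappa>2(2)[OF u] power_Suc2 diff_Suc_1)
  qed
  also have "\<dots> = smult (\<Prod>u\<in>points. \<kappa>2 u) (contact * point_poly)"
    by (simp only: prod_smult prod.distrib contact_def)
  finally show thesis
    using that[of "\<kappa>1 * (\<Prod>u\<in>points. \<kappa>2 u)"] \<kappa>1 \<kappa>2(1) finite_points by simp
qed

subsection \<open>Adding the line: the values at its equation\<close>

lemma log_fields_insert_iff:
  assumes "v \<in> log_fields T k"
  shows "v \<in> log_fields (insert (a, b, c) T) k \<longleftrightarrow> normal v = 0"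
proof -
  have "form dvd act (a, b, c) v \<longleftrightarrow> normal v = 0"
    by (rule form_dvd_iff[OF homogeneous_act[OF assms]])
  then show ?thesis using assms unfolding log_fields_def by blast
qed

text \<open>With \<open>U\<close>, \<open>W\<close> the values of the field at \<open>\<alpha>\<close> and at the coordinate, the polynomial
  \<open>F = W \<alpha> - (coord - u z) U\<close> lies in the ideal of every line through the point, hence is divisible by their
  product; on the new line only the second term survives.\<close>

lemma contact_at_point:
  assumes v: "v \<in> log_fields T k" and u: "u \<in> points"
  shows "[:- u, 1:] ^ (card (through u) - 1) dvd normal v"
proof -
  define U where "U = act (a, b, c) v"
  define W where "W = act (l1, l2, l3) v"
  define F where "F = W * form - (coord - Const u * Var 3) * U"
  have hom: "homogeneous k U" "homogeneous k W"
    using homogeneous_act[OF v] by (auto simp: U_def W_def)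
  have "homogeneous (k + Suc 0) (W * form)"
    by (rule homogeneous_mult[OF hom(2) homogeneous_linform])
  moreover have "homogeneous (Suc 0 + k) ((coord - Const u * Var 3) * U)"
    by (rule homogeneous_mult[OF homogeneous_diff[OF homogeneous_linform homogeneous_Const_Var] hom(1)])
  ultimately have homF: "homogeneous (k + 1) F"
    by (simp add: F_def homogeneous_diff)
  have "linform s dvd F" if s: "s \<in> through u" for s
  proof -
    obtain a' b' c' where s': "s = (a', b', c')" by (cases s)
    define c1 where "c1 = a' * l2 - b' * l1"
    define c2 where "c2 = a * b' - b * a'"
    have c2: "c2 \<noteq> 0" using slope_ne_0[of a' b' c' u] s s' by (simp add: c2_def)
    have "a' * x0 + b' * y0 + c' + u * (b' * a - a' * b) = 0"
      using s by (simp add: s' restr_linform)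
    then have "a' * x0 + b' * y0 + c' = - (c2 * u)"
      unfolding c2_def by algebra
    then have lin: "linform s = Const c1 * form + Const c2 * coord - Const c2 * Const u * Var 3"
      using linform_decompose(1)[OF s'] by (simp add: c1_def c2_def Const_uminus Const_mult)
    have act: "act s v = Const c1 * U + Const c2 * W"
      using linform_decompose(2)[OF s'] by (simp add: c1_def c2_def U_def W_def)
    have "Const c2 * F = act s v * form - linform s * U"
      unfolding F_def lin act by (simp add: algebra_simps)
    moreover have "linform s dvd act s v" using v s by (auto simp: log_fields_def)
    ultimately have "linform s dvd Const c2 * F" by (simp add: dvd_diff)
    then have "linform s dvd Const (inverse c2) * (Const c2 * F)" by (rule dvd_mult)
    then show ?thesis using c2 by (simp add: mult.assoc[symmetric] flip: Const_mult)
  qed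
  then have "(\<Prod>s\<in>through u. linform s) dvd F"
    using distinct_lines_subset[OF distinct_lines_T] homF by (intro prod_linform_dvd[of _ "k + 1"]) auto
  then have "restr (\<Prod>s\<in>through u. linform s) dvd restr F"
    by (auto elim!: dvdE simp: restr_mult)
  also have "restr F = - ([:- u, 1:] * restr U)"
    by (simp add: F_def restr_simps)
  finally have dvd: "(\<Prod>s\<in>through u. restr (linform s)) dvd [:- u, 1:] * restr U"
    by (simp only: dvd_minus_iff restr_prod)
  obtain \<kappa> where \<kappa>: "\<kappa> \<noteq> 0"
    "(\<Prod>s\<in>through u. restr (linform s)) = smult \<kappa> ([:- u, 1:] ^ card (through u))"
    using prod_through[OF u] by blast
  obtain j where j: "card (through u) = Suc j" using gr0_implies_Suc[OF card_through_pos[OF u]] by (rule exE)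
  have "[:- u, 1:] ^ Suc j dvd [:- u, 1:] * restr U"
    using dvd \<kappa> by (simp add: smult_dvd_iff j)
  then have "[:- u, 1:] ^ j dvd restr U"
    unfolding power_Suc by (subst (asm) dvd_mult_cancel_left) auto
  then show ?thesis by (simp add: j U_def)
qed

text \<open>Parallel lines meet the line at infinity, where the same mechanism lowers the degree.\<close>

lemma degree_restr_act:
  assumes v: "v \<in> log_fields T k" and ne: "normal v \<noteq> 0"
  shows "degree (normal v) + card parallel \<le> k"
proof -
  define U where "U = act (a, b, c) v"
  have hom: "homogeneous k U" using homogeneous_act[OF v] by (simp add: U_def)
  have "linform s dvd U" if s: "s \<in> parallel" for s
  proof -
    obtain a' b' c' where s': "s = (a', b', c')" by (cases s)
    define c1 where "c1 = a' * l2 - b' * l1"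
    have 0: "a * b' - b * a' = 0"
      using s by (simp add: parallel_def s' restr_linform algebra_simps split: if_splits)
    have "c1 \<noteq> 0"
    proof
      assume "c1 = 0"
      then have "a' = 0" "b' = 0" using 0 det unfolding c1_def by algebra+
      moreover have "a' \<noteq> 0 \<or> b' \<noteq> 0"
        using distinct s s' by (auto simp: distinct_lines_def parallel_def)
      ultimately show False by simp
    qed
    have "act s v = Const c1 * U"
      using linform_decompose(2)[OF s'] 0 by (simp add: c1_def U_def)
    then have "linform s dvd Const c1 * U"
      using v s by (auto simp: log_fields_def parallel_def)
    then have "linform s dvd Const (inverse c1) * (Const c1 * U)" by (rule dvd_mult)
    then show ?thesis using \<open>c1 \<noteq> 0\<close> by (simp add: mult.assoc[symmetric] flip: Const_mult)
  qed
  then have "(\<Prod>s\<in>parallel. linform s) dvd U"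
    using distinct_lines_subset[OF distinct_lines_T] hom
    by (intro prod_linform_dvd[of _ k]) (auto simp: parallel_def)
  then obtain g where g: "U = (\<Prod>s\<in>parallel. linform s) * g" by (auto elim: dvdE)
  have "homogeneous (\<Sum>s\<in>parallel. Suc 0) (\<Prod>s\<in>parallel. linform s)"
    by (rule homogeneous_prod) simp
  then have homP: "homogeneous (card parallel) (\<Prod>s\<in>parallel. linform s)" by simp
  obtain \<kappa> where \<kappa>: "\<kappa> \<noteq> 0" "(\<Prod>s\<in>parallel. restr (linform s)) = [:\<kappa>:]"
    by (rule prod_parallel)
  have ne': "g \<noteq> 0" "(\<Prod>s\<in>parallel. linform s) \<noteq> 0" using ne g by (auto simp: U_def)
  have "\<not> k < card parallel" "homogeneous (k - card parallel) g"
    using homogeneous_cofactor[OF _ homP ne'(2), of k g] hom g ne'(1) by auto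
  moreover have "restr U = smult \<kappa> (restr g)"
    using g \<kappa>(2) by (simp add: restr_simps)
  ultimately show ?thesis
    using degree_restr[of "k - card parallel" g] \<kappa>(1) by (simp add: U_def)
qed

text \<open>The exponent counts both effects: divisibility by \<open>contact\<close> and the drop of the degree caused by the
  parallel lines.\<close>

lemma restr_act_mem:
  assumes "v \<in> log_fields T k"
  shows "normal v \<in> (*) contact ` upto_degree (k + 1 - (card T - npoints))"
proof -
  have "contact dvd normal v"
    unfolding contact_def using finite_points contact_at_point[OF assms]
    by (intro prod_linear_powers_dvd) auto
  then obtain f where f: "normal v = contact * f" by (auto elim: dvdE)
  have "f \<in> upto_degree (k + 1 - (card T - npoints))"
  proof (cases "f = 0")
    case False
    then have "degree contact + degree f + card parallel \<le> k"
      using degree_restr_act[OF assms] f by (simp add: degree_mult_eq)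
    then show ?thesis using degree_contact by (auto simp: upto_degree_iff)
  qed (simp add: upto_degree_iff)
  then show ?thesis using f by blast
qed

subsection \<open>Restricting to the line: the tangential component\<close>

text \<open>At a crossing point the field is tangent to two different lines, so it vanishes there.\<close>

lemma restr_tangential_mem:
  assumes "v \<in> log_fields (insert (a, b, c) T) k"
  shows "tangential v \<in> (*) point_poly ` upto_degree (k + 1 - npoints)"
proof -
  have U: "normal v = 0"
    using assms restr_dvd by (simp add: log_fields_def)
  have "[:- u, 1:] ^ 1 dvd tangential v" if u: "u \<in> points" for u
  proof -
    obtain a' b' c' where s: "(a', b', c') \<in> T" "poly (restr (linform (a', b', c'))) u = 0"
      using u by (auto simp: points_def)
    define c2 where "c2 = a * b' - b * a'"
    have "linform (a', b', c') dvd act (a', b', c') v"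
      using assms s by (auto simp: log_fields_def)
    then have "poly (restr (act (a', b', c') v)) u = 0"
      using s(2) by (auto elim!: dvdE simp: restr_mult)
    moreover have "restr (act (a', b', c') v) = smult c2 (tangential v)"
      using arg_cong[OF linform_decompose(2)[OF refl, of a' b' c' v], of restr]
      by (simp add: restr_add restr_mult U c2_def)
    ultimately have "poly (tangential v) u = 0"
      using slope_ne_0[OF s] by (simp add: c2_def)
    then show ?thesis by (simp add: poly_eq_0_iff_dvd)
  qed
  then have "(\<Prod>u\<in>points. [:- u, 1:] ^ 1) dvd tangential v"
    using finite_points by (intro prod_linear_powers_dvd) auto
  then obtain f where f: "tangential v = point_poly * f" by (auto elim: dvdE)
  have "f \<in> upto_degree (k + 1 - npoints)"
  proof (cases "f = 0")
    case False
    have "degree point_poly + degree f \<le> k"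
      using degree_restr[OF homogeneous_act[OF assms], of "(l1, l2, l3)"] False
      by (simp add: f degree_mult_eq)
    then show ?thesis by (auto simp: upto_degree_iff npoints_def degree_prod_linear)
  qed (simp add: upto_degree_iff)
  then show ?thesis using f by blast
qed

text \<open>If both components vanish on the new line, its equation divides the field; dividing it out only
  destroys tangency to that line itself.\<close>

lemma tangential_kernel:
  assumes v: "v \<in> log_fields (insert (a, b, c) T) k" and W: "tangential v = 0"
  shows "k = 0 \<Longrightarrow> v = 0" and "k = Suc j \<Longrightarrow> \<exists>w\<in>log_fields T j. v = fmult form w"
proof -
  have U: "normal v = 0"
    using v restr_dvd by (simp add: log_fields_def)
  have 0: "restr (fst v) = 0" "restr (snd v) = 0"
    using U W by (subst fst_snd_from_act, simp add: restr_simps)+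
  have hom: "homogeneous k (fst v)" "homogeneous k (snd v)"
    using v by (auto simp: log_fields_def)
  show "v = 0" if "k = 0"
    using hom 0 that restr_eq_0_degree_0 by (simp add: prod_eq_iff)
  show "\<exists>w\<in>log_fields T j. v = fmult form w" if k: "k = Suc j"
  proof -
    obtain p q where pq: "fst v = form * p" "homogeneous j p" "snd v = form * q" "homogeneous j q"
      using restr_eq_0_factor 0 hom unfolding k by metis
    define w where "w = (p, q)"
    have vw: "v = fmult form w" using pq by (simp add: w_def fmult_def prod_eq_iff)
    have "linform s dvd act s w" if s: "s \<in> T" for s
    proof -
      have "linform s dvd form * act s w"
        using v s by (simp add: log_fields_def vw act_fmult)
      then have dvd: "linform s dvd (\<Prod>t\<in>{(a, b, c)}. linform t) * act s w" by simp
      have ok: "distinct_lines (insert s {(a, b, c)})"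
        by (rule distinct_lines_subset[OF distinct]) (use s in blast)
      have hom: "homogeneous j (act s w)"
        using pq by (auto simp: w_def act_def split_beta intro!: homogeneous_add homogeneous_Const_mult)
      have "s \<notin> {(a, b, c)}" using s new_line by blast
      then show ?thesis
        by (rule linform_dvd_cofactor[OF ok _ _ hom dvd]) simp
    qed
    then have "w \<in> log_fields T j" using pq by (auto simp: log_fields_def w_def)
    then show ?thesis using vw by blast
  qed
qed

end

section \<open>Hilbert functions\<close>

definition hilb :: "('k::field \<times> 'k \<times> 'k) set \<Rightarrow> nat \<Rightarrow> nat" where
  "hilb T k = (THE d. mpair.fdim (log_fields T k) d)"

lemma hilb_eqI: "mpair.fdim (log_fields T k) d \<Longrightarrow> hilb T k = d"
  unfolding hilb_def using mpair.fdim_unique by blast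

lemma fdim_hilb: "mpair.fdim (log_fields T k) (hilb T k)"
proof -
  have "mpair.fdim (log_fields {} k :: ('a mpoly3 \<times> 'a mpoly3) set) (sdim k + sdim k)"
    unfolding log_fields_empty by (rule fdim_homs_Times)
  then obtain d where "mpair.fdim (log_fields T k) d"
    using mpair.fdim_subspace[OF subspace_log_fields log_fields_mono[OF empty_subsetI]] by metis
  then show ?thesis using hilb_eqI by metis
qed

lemma hilb_empty: "hilb {} k = 2 * sdim k"
  using hilb_eqI[of "{}" k "sdim k + sdim k"] fdim_homs_Times[of k k]
  unfolding log_fields_empty[symmetric] by (simp add: mult_2)

context line_deletion
begin

abbreviation "T' \<equiv> insert (a, b, c) T"

text \<open>When both arrangements are free, \<open>npoints\<close> and this number are the exponents of \<open>T\<close>.\<close>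

abbreviation "coexponent \<equiv> card T - npoints"

abbreviation "normal_target k \<equiv> (*) contact ` upto_degree (k + 1 - coexponent)"

abbreviation "tangential_target k \<equiv> (*) point_poly ` upto_degree (k + 1 - npoints)"

lemma linear_restr_act: "Vector_Spaces.linear pscale smult (\<lambda>v. restr (act t v))"
  by unfold_locales (simp_all add: act_add act_pscale restr_add restr_mult)

text \<open>The sequence \<open>0 \<rightarrow> L(T')\<^sub>k \<rightarrow> L(T)\<^sub>k \<rightarrow> K[s]\<close>, in terms of dimensions.\<close>

lemma hilb_delete:
  shows "hilb T k \<le> hilb T' k + (k + 1 - coexponent)"
    and "hilb T k = hilb T' k + (k + 1 - coexponent) \<longleftrightarrow>
      normal ` log_fields T k = normal_target k"
proof -
  have "{v \<in> log_fields T k. normal v = 0} = log_fields T' k"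
    using log_fields_insert_iff log_fields_mono[of T T' k] by blast
  then have K: "mpair.fdim {v \<in> log_fields T k. normal v = 0} (hilb T' k)"
    using fdim_hilb[of T' k] by simp
  have sub: "normal ` log_fields T k \<subseteq> normal_target k"
    using restr_act_mem by blast
  obtain d where d: "d \<le> hilb T' k + (k + 1 - coexponent)" "mpair.fdim (log_fields T k) d"
    "d = hilb T' k + (k + 1 - coexponent) \<longleftrightarrow>
      normal ` log_fields T k = normal_target k"
    by (rule mpair_upoly.fdim_le_kernel_plus_target[OF linear_restr_act subspace_log_fields K
        fdim_mult_upto_degree[OF contact_ne_0] sub])
  have h: "hilb T k = d" by (rule hilb_eqI[OF d(2)])
  show "hilb T k \<le> hilb T' k + (k + 1 - coexponent)"
    "hilb T k = hilb T' k + (k + 1 - coexponent) \<longleftrightarrow>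
      normal ` log_fields T k = normal_target k"
    unfolding h by (rule d(1), rule d(3))
qed

lemma hilb_restrict_kernel:
  assumes K: "mpair.fdim {v \<in> log_fields T' k. tangential v = 0} r"
  shows "hilb T' k \<le> r + (k + 1 - npoints)"
    and "hilb T' k = r + (k + 1 - npoints) \<longleftrightarrow>
      tangential ` log_fields T' k = tangential_target k"
proof -
  have sub: "tangential ` log_fields T' k \<subseteq> tangential_target k"
    using restr_tangential_mem by blast
  obtain d where d: "d \<le> r + (k + 1 - npoints)" "mpair.fdim (log_fields T' k) d"
    "d = r + (k + 1 - npoints) \<longleftrightarrow>
      tangential ` log_fields T' k = tangential_target k"
    by (rule mpair_upoly.fdim_le_kernel_plus_target[OF linear_restr_act subspace_log_fields K
        fdim_mult_upto_degree[OF point_poly_ne_0] sub])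
  have h: "hilb T' k = d" by (rule hilb_eqI[OF d(2)])
  show "hilb T' k \<le> r + (k + 1 - npoints)"
    "hilb T' k = r + (k + 1 - npoints) \<longleftrightarrow>
      tangential ` log_fields T' k = tangential_target k"
    unfolding h by (rule d(1), rule d(3))
qed

lemma fmult_form_mem:
  assumes "w \<in> log_fields T k"
  shows "fmult form w \<in> log_fields T' (Suc k)" "restr (act t (fmult form w)) = 0"
proof -
  have "fmult form w \<in> log_fields T (Suc k)"
    using log_fields_fmult[OF homogeneous_linform assms, of "(a, b, c)"] by simp
  then show "fmult form w \<in> log_fields T' (Suc k)"
    by (simp add: log_fields_insert_iff act_fmult restr_mult)
  show "restr (act t (fmult form w)) = 0"
    by (simp add: act_fmult restr_mult)
qed

text \<open>In degree \<open>0\<close> there is no field of degree \<open>k - 1\<close>, which the case distinction records.\<close>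

lemma fdim_tangential_kernel:
  "mpair.fdim {v \<in> log_fields T' k. tangential v = 0}
    (case k of 0 \<Rightarrow> 0 | Suc j \<Rightarrow> hilb T j)"
proof (cases k)
  case 0
  have "{v \<in> log_fields T' k. tangential v = 0} = {0}"
    using tangential_kernel(1) 0 by auto
  then show ?thesis using mpair.fdim_0 0 by simp
next
  case (Suc j)
  have "{v \<in> log_fields T' k. tangential v = 0} = fmult form ` log_fields T j"
    using tangential_kernel(2)[OF _ _ Suc] fmult_form_mem unfolding Suc by blast
  moreover have "mpair.fdim (fmult form ` log_fields T j) (hilb T j)"
    by (rule mpair_mpair.fdim_inj_image[OF linear_fmult fdim_hilb])
      (simp add: fmult_eq_0_iff form_ne_0)
  ultimately show ?thesis using Suc by simp
qed

lemmas hilb_restrict = hilb_restrict_kernel[OF fdim_tangential_kernel]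

subsection \<open>Surjectivity in large degrees\<close>

text \<open>Multiplied by the equations of the lines in \<open>S\<close>, a constant field becomes logarithmic if it is
  tangent to the remaining lines.\<close>

lemma log_field_constant_direction:
  assumes S: "S \<subseteq> T" and tangent: "\<And>s. s \<in> T - S \<Longrightarrow> act s (Const e1, Const e2) = 0"
    and p: "homogeneous d p"
  obtains v where "v \<in> log_fields T (d + card S)"
    "normal v = smult (a * e1 + b * e2) (restr p * (\<Prod>t\<in>S. restr (linform t)))"
proof -
  define P where "P = p * (\<Prod>t\<in>S. linform t)"
  define v where "v = fmult P (Const e1, Const e2)"
  have "homogeneous (\<Sum>t\<in>S. Suc 0) (\<Prod>t\<in>S. linform t)"
    by (rule homogeneous_prod) simp
  then have "homogeneous (d + card S) P"
    using homogeneous_mult[OF p, of "card S"] by (simp add: P_def)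
  then have hom: "homogeneous (d + card S) (fst v)" "homogeneous (d + card S) (snd v)"
    using homogeneous_Const_mult[of "d + card S" P] by (simp_all add: v_def fmult_def mult.commute)
  have "linform t dvd act t v" if t: "t \<in> T" for t
  proof (cases "t \<in> S")
    case True
    then have "linform t dvd (\<Prod>t\<in>S. linform t)"
      using finite_subset[OF S finite_T] by (intro dvd_prodI)
    then show ?thesis unfolding v_def act_fmult P_def by (intro dvd_mult2 dvd_mult)
  next
    case False
    then show ?thesis using t tangent by (simp add: v_def act_fmult)
  qed
  then have "v \<in> log_fields T (d + card S)"
    using hom by (simp add: log_fields_def)
  moreover have "act (a, b, c) (Const e1, Const e2) = Const (a * e1 + b * e2)"
    by (simp add: act_def Const_add Const_mult)
  then have "normal v = smult (a * e1 + b * e2) (restr p * (\<Prod>t\<in>S. restr (linform t)))"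
    by (simp add: v_def act_fmult restr_mult restr_prod P_def)
  ultimately show thesis by (rule that)
qed

text \<open>Products of all but one of the linear forms, times the constant field along the remaining line,
  give a Lagrange basis at the points of the new line; the product of all of them supplies the
  multiples of \<open>point_poly\<close>.\<close>

lemma restr_act_surj:
  assumes k: "card T \<le> k"
  shows "normal ` log_fields T k = normal_target k"
proof (intro equalityI subsetI)
  fix q assume "q \<in> normal ` log_fields T k"
  then show "q \<in> normal_target k" using restr_act_mem by blast
next
  fix q assume "q \<in> normal_target k"
  then obtain f where q: "q = contact * f" and f: "f \<in> upto_degree (k + 1 - coexponent)" by blast
  define I where "I = normal ` log_fields T k"
  have subI: "upoly.subspace I"
    unfolding I_def by (rule mpair_upoly.linear_subspace_image[OF linear_restr_act subspace_log_fields])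
  obtain \<kappa> where \<kappa>: "\<kappa> \<noteq> 0" "(\<Prod>s\<in>T. restr (linform s)) = smult \<kappa> (contact * point_poly)"
    by (rule prod_restr)
  have lagr: "contact * smult e (\<Prod>w\<in>points - {u}. [:- w, 1:]) \<in> I" if u: "u \<in> points" for u e
  proof -
    obtain a' b' c' where s: "(a', b', c') \<in> T" "poly (restr (linform (a', b', c'))) u = 0"
      using u by (auto simp: points_def)
    define m where "m = a * b' - b * a'"
    have m: "m \<noteq> 0" using slope_ne_0[OF s] by (simp add: m_def)
    let ?R = "\<Prod>t\<in>T - {(a', b', c')}. restr (linform t)"
    let ?L = "\<Prod>w\<in>points - {u}. [:- w, 1:]"
    have "restr (linform (a', b', c')) * ?R = (\<Prod>s\<in>T. restr (linform s))"
      by (rule prod.remove[OF finite_T s(1), symmetric])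
    also have "\<dots> = smult \<kappa> (contact * ([:- u, 1:] * ?L))"
      using \<kappa>(2) prod.remove[OF finite_points u, of "\<lambda>w. [:- w, 1:]"] by simp
    finally have "[:- u, 1:] * smult m ?R = [:- u, 1:] * smult \<kappa> (contact * ?L)"
      unfolding restr_linform_through[OF s(2)] m_def[symmetric]
      by (simp only: mult_smult_left mult_smult_right mult.left_commute)
    then have R: "smult m ?R = smult \<kappa> (contact * ?L)"
      by (subst (asm) mult_left_cancel) auto
    have pos: "0 < card T" using s(1) finite_T by (auto simp: card_gt_0_iff)
    define d where "d = k - (card T - 1)"
    have d: "d + (card T - 1) = k" using k by (simp add: d_def)
    define p where "p = lift d [:e / \<kappa>:]"
    have p: "homogeneous d p" "restr p = [:e / \<kappa>:]"
      by (auto simp: p_def homogeneous_lift restr_lift)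
    have card: "card (T - {(a', b', c')}) = card T - 1" using s(1) finite_T by simp
    have tangent: "act t (Const b', Const (- a')) = 0" if "t \<in> T - (T - {(a', b', c')})" for t
      using that by (auto simp: act_def Const_uminus)
    obtain v where v: "v \<in> log_fields T (d + card (T - {(a', b', c')}))"
      "normal v = smult (a * b' + b * - a') (restr p * ?R)"
      using log_field_constant_direction[OF _ tangent p(1), where S = "T - {(a', b', c')}"] by blast
    have v: "v \<in> log_fields T k" "normal v = smult m (restr p * ?R)"
      using v unfolding card d by (simp_all add: m_def)
    have "normal v = smult (e / \<kappa>) (smult m ?R)"
      unfolding v(2) p(2) by simp
    also have "\<dots> = contact * smult e ?L"
      unfolding R using \<kappa>(1) by simp
    finally show ?thesis using v(1) unfolding I_def by (metis image_eqI)
  qed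
  have transv: "contact * (point_poly * g) \<in> I" if g: "degree g \<le> k - card T" for g
  proof -
    define p where "p = lift (k - card T) (smult (inverse \<kappa>) g)"
    have p: "homogeneous (k - card T) p" "restr p = smult (inverse \<kappa>) g"
      using g by (auto simp: p_def homogeneous_lift restr_lift)
    obtain v where "v \<in> log_fields T (k - card T + card T)"
      "normal v = smult (a * l2 + b * - l1) (restr p * (\<Prod>t\<in>T. restr (linform t)))"
      using log_field_constant_direction[OF subset_refl _ p(1)] by blast
    then have v: "v \<in> log_fields T (k - card T + card T)"
      "normal v = restr p * (\<Prod>t\<in>T. restr (linform t))"
      using det by simp_all
    have "normal v = contact * (point_poly * g)"
      unfolding v(2) p(2) \<kappa>(2) using \<kappa>(1) by (simp add: algebra_simps)
    then show ?thesis using v(1) k unfolding I_def by (metis image_eqI le_add_diff_inverse2)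
  qed
  \<comment> \<open>Division with remainder: the quotient is handled by \<open>transv\<close>, the remainder by interpolation.\<close>
  define g where "g = f div point_poly"
  define r where "r = f mod point_poly"
  have fgr: "f = point_poly * g + r" by (simp add: g_def r_def)
  have degM: "degree point_poly = npoints" by (simp add: npoints_def degree_prod_linear)
  have r: "r = 0 \<or> degree r < npoints"
    using degree_mod_less[OF point_poly_ne_0, of f] unfolding r_def degM .
  have "degree g \<le> k - card T"
  proof (cases "g = 0")
    case False
    then have dMg: "degree (point_poly * g) = npoints + degree g"
      by (simp add: degree_mult_eq degM del: mult_eq_0_iff)
    then have "degree f = npoints + degree g"
    proof (cases "r = 0")
      case False
      then have "degree r < degree (point_poly * g)" using r dMg by simp
      then show ?thesis unfolding fgr using degree_add_eq_left dMg by metis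
    qed (simp add: fgr)
    moreover have "f \<noteq> 0"
    proof
      assume "f = 0"
      then have "g = 0" by (simp add: g_def)
      then show False using False by simp
    qed
    ultimately have "npoints + degree g < k + 1 - coexponent" using f by (simp add: upto_degree_iff)
    then show ?thesis using npoints_le k by linarith
  qed simp
  then have 1: "contact * (point_poly * g) \<in> I" by (rule transv)
  have "contact * r = (\<Sum>u\<in>points. contact * smult (poly r u / poly (\<Prod>w\<in>points - {u}. [:- w, 1:]) u)
      (\<Prod>w\<in>points - {u}. [:- w, 1:]))"
    using arg_cong[OF lagrange_interpolation[OF finite_points r[unfolded npoints_def]], of "(*) contact"]
    unfolding sum_distrib_left .
  also have "\<dots> \<in> I"
    by (rule upoly.subspace_sum[OF subI]) (rule lagr)
  finally have 2: "contact * r \<in> I" .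
  have "q = contact * (point_poly * g) + contact * r"
    unfolding q using arg_cong[OF fgr, of "(*) contact"] by (simp only: distrib_left)
  then show "q \<in> normal ` log_fields T k"
    using upoly.subspace_add[OF subI 1 2] unfolding I_def by simp
qed

lemma hilb_insert_large:
  assumes "card T \<le> k"
  shows "hilb T k = hilb T' k + (k + 1 - coexponent)"
  using hilb_delete(2) restr_act_surj[OF assms] by blast

end

section \<open>Free modules of logarithmic fields\<close>

text \<open>The coefficients \<open>p\<close> and \<open>q\<close> may be arbitrary polynomials: by \<open>fmult_combination_component\<close> below they can
  always be replaced by homogeneous ones.\<close>

definition free_fields :: "('k::field \<times> 'k \<times> 'k) set \<Rightarrow> nat \<Rightarrow> nat \<Rightarrow> bool" where
  "free_fields T d1 d2 \<longleftrightarrow> (\<exists>v1\<in>log_fields T d1. \<exists>v2\<in>log_fields T d2.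
     (\<forall>k. \<forall>v\<in>log_fields T k. \<exists>p q. v = fmult p v1 + fmult q v2) \<and>
     (\<forall>p q. fmult p v1 + fmult q v2 = 0 \<longrightarrow> p = 0 \<and> q = 0))"

text \<open>The second Betti number is the constant term of the characteristic polynomial. It enters the algebra
  only through the Hilbert function in large degrees; for a free module with exponents \<open>d1\<close>, \<open>d2\<close> the
  displayed quadratic is the one with \<open>d1 + d2 = card T\<close> and \<open>d1 d2 = \<beta>\<close>.\<close>

definition second_betti :: "('k::field \<times> 'k \<times> 'k) set \<Rightarrow> int \<Rightarrow> bool" where
  "second_betti T \<beta> \<longleftrightarrow> (\<forall>k\<ge>card T. 2 * int (hilb T k) =
     2 * (int k + 1) * (int k + 2) - 2 * int (card T) * int k + int (card T) * (int (card T) - 3) - 2 * \<beta>)"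

lemma second_betti_empty: "second_betti {} 0"
proof -
  have "2 * int (2 * sdim k) = 2 * (int k + 1) * (int k + 2)" for k
    using arg_cong[OF sdim_closed[of k], of int] by (simp add: algebra_simps)
  then show ?thesis by (simp add: second_betti_def hilb_empty)
qed

lemma fmult_combination_component:
  assumes v: "v \<in> log_fields T k" and v1: "v1 \<in> log_fields T d1" and v2: "v2 \<in> log_fields T d2"
    and eq: "v = fmult p v1 + fmult q v2"
  shows "v = fmult (if d1 \<le> k then hcomp (k - d1) p else 0) v1
    + fmult (if d2 \<le> k then hcomp (k - d2) q else 0) v2"
proof -
  have *: "hcomp k (p * f) = (if d \<le> k then hcomp (k - d) p else 0) * f" if "homogeneous d f" for p f d
    using hcomp_mult[OF that, of k p] by (simp add: mult.commute)
  have hom: "homogeneous d1 (fst v1)" "homogeneous d1 (snd v1)" "homogeneous d2 (fst v2)"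
    "homogeneous d2 (snd v2)" "homogeneous k (fst v)" "homogeneous k (snd v)"
    using v v1 v2 by (auto simp: log_fields_def)
  have "fst v = hcomp k (fst v)" "snd v = hcomp k (snd v)"
    using hcomp_homogeneous[OF hom(5), of k] hcomp_homogeneous[OF hom(6), of k] by simp_all
  then have "fst v = hcomp k (p * fst v1) + hcomp k (q * fst v2)"
    "snd v = hcomp k (p * snd v1) + hcomp k (q * snd v2)"
    by (simp_all add: eq fmult_def hcomp_add)
  then show ?thesis
    unfolding *[OF hom(1)] *[OF hom(2)] *[OF hom(3)] *[OF hom(4)]
    by (simp add: prod_eq_iff fmult_def)
qed

lemma free_fields_hilb:
  assumes "free_fields T d1 d2" "d1 \<le> k" "d2 \<le> k"
  shows "hilb T k = sdim (k - d1) + sdim (k - d2)"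
proof -
  obtain v1 v2 where v1: "v1 \<in> log_fields T d1" and v2: "v2 \<in> log_fields T d2"
    and gen: "\<forall>k. \<forall>v\<in>log_fields T k. \<exists>p q. v = fmult p v1 + fmult q v2"
    and ind: "\<forall>p q. fmult p v1 + fmult q v2 = 0 \<longrightarrow> p = 0 \<and> q = 0"
    using assms(1) unfolding free_fields_def by blast
  define F where "F = (\<lambda>w. fmult (fst w) v1 + fmult (snd w) v2)"
  have lin: "Vector_Spaces.linear pscale pscale F"
    by unfold_locales (auto simp: F_def pscale_def fmult_def prod_eq_iff algebra_simps)
  have "F ` (homs (k - d1) \<times> homs (k - d2)) = log_fields T k"
  proof (intro equalityI subsetI)
    fix v assume v: "v \<in> log_fields T k"
    then obtain p q where "v = fmult p v1 + fmult q v2" using gen by blast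
    then have "v = F (hcomp (k - d1) p, hcomp (k - d2) q)"
      using fmult_combination_component[OF v v1 v2] assms(2,3) by (simp add: F_def)
    then show "v \<in> F ` (homs (k - d1) \<times> homs (k - d2))" by simp
  next
    fix v assume "v \<in> F ` (homs (k - d1) \<times> homs (k - d2))"
    then obtain p q where "homogeneous (k - d1) p" "homogeneous (k - d2) q"
      "v = fmult p v1 + fmult q v2"
      by (auto simp: F_def)
    then show "v \<in> log_fields T k"
      using log_fields_fmult[OF _ v1, of "k - d1" p] log_fields_fmult[OF _ v2, of "k - d2" q] assms(2,3)
      by (auto intro: log_fields_add)
  qed
  moreover have "mpair.fdim (F ` (homs (k - d1) \<times> homs (k - d2))) (sdim (k - d1) + sdim (k - d2))"
  proof (rule mpair_mpair.fdim_inj_image[OF lin fdim_homs_Times])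
    fix w :: "'a mpoly3 \<times> 'a mpoly3"
    assume "F w = 0"
    then have "fst w = 0 \<and> snd w = 0" using ind unfolding F_def by blast
    then show "w = 0" by (simp add: prod_eq_iff)
  qed
  ultimately show ?thesis using hilb_eqI by metis
qed

lemma free_fields_generator:
  assumes "free_fields T d1 d2"
  shows "\<exists>v\<in>log_fields T d1. v \<noteq> 0"
proof -
  obtain v1 v2 where "v1 \<in> log_fields T d1"
    "\<forall>p q. fmult p v1 + fmult q v2 = 0 \<longrightarrow> p = 0 \<and> q = 0"
    using assms unfolding free_fields_def by blast
  moreover have "v1 \<noteq> 0"
  proof
    assume "v1 = 0"
    then have "fmult 1 v1 + fmult 0 v2 = 0" by simp
    then show False using calculation(2) one_neq_zero by blast
  qed
  ultimately show ?thesis by blast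
qed

text \<open>Below both exponents there are no homogeneous coefficients left.\<close>

lemma free_fields_min_degree:
  assumes "free_fields T d1 d2" "d1 \<le> d2" "v \<in> log_fields T k" "v \<noteq> 0"
  shows "d1 \<le> k"
proof (rule ccontr)
  assume k: "\<not> d1 \<le> k"
  obtain v1 v2 where v1: "v1 \<in> log_fields T d1" and v2: "v2 \<in> log_fields T d2"
    and gen: "\<forall>k. \<forall>v\<in>log_fields T k. \<exists>p q. v = fmult p v1 + fmult q v2"
    using assms(1) unfolding free_fields_def by blast
  obtain p q where "v = fmult p v1 + fmult q v2" using gen assms(3) by blast
  from fmult_combination_component[OF assms(3) v1 v2 this] k assms(2,4) show False by simp
qed

lemma free_fields_sym: "free_fields T d1 d2 \<Longrightarrow> free_fields T d2 d1"
  unfolding free_fields_def by (metis add.commute)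

text \<open>Two quadratics agreeing in large degrees have the same coefficients; two consecutive values
  suffice to see the sum and the product of the exponents.\<close>

lemma free_fields_exponents:
  assumes "free_fields T d1 d2" "second_betti T \<beta>"
  shows "d1 + d2 = card T" "int d1 * int d2 = \<beta>"
proof -
  \<comment> \<open>Large enough for the quadratic to be valid and for no dimension to be truncated.\<close>
  define k where "k = d1 + d2 + card T"
  define s where "s = int (card T)"
  have eq: "(j - int d1 + 1) * (j - int d1 + 2) + (j - int d2 + 1) * (j - int d2 + 2)
      = 2 * (j + 1) * (j + 2) - 2 * s * j + s * (s - 3) - 2 * \<beta>"
    if j: "j = int k \<or> j = int k + 1" for j
  proof -
    define n where "n = nat j"
    have n: "j = int n" "d1 \<le> n" "d2 \<le> n" "card T \<le> n" using j by (auto simp: n_def k_def)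
    have "2 * int (sdim (n - d)) = (j - int d + 1) * (j - int d + 2)" if "d \<le> n" for d
      using arg_cong[OF sdim_closed[of "n - d"], of int]
      by (simp only: of_nat_mult of_nat_add of_nat_1 of_nat_numeral of_nat_diff[OF that] n(1))
    then have "2 * int (hilb T n) = (j - int d1 + 1) * (j - int d1 + 2) + (j - int d2 + 1) * (j - int d2 + 2)"
      using free_fields_hilb[OF assms(1) n(2,3)] n by simp
    then show ?thesis
      using assms(2) n(4) unfolding second_betti_def s_def n(1) by simp
  qed
  have "2 * (int d1 + int d2) = 2 * s"
    using eq[of "int k"] eq[of "int k + 1"] by (simp add: algebra_simps)
  then have sum: "int d1 + int d2 = s" by simp
  then show "d1 + d2 = card T" by (simp add: s_def)
  show "int d1 * int d2 = \<beta>"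
    using eq[of "int k"] unfolding sum[symmetric] by (simp add: algebra_simps)
qed

context line_deletion
begin

text \<open>In large degrees the first sequence is exact, so the dimension drops by the size of its target, a
  linear function of the degree; its constant term carries the number of points.\<close>

lemma second_betti_insert:
  assumes "second_betti T \<beta>"
  shows "second_betti T' (\<beta> + int npoints)"
  unfolding second_betti_def
proof (intro allI impI)
  fix k assume k: "card T' \<le> k"
  have card: "card T' = Suc (card T)" using finite_T new_line by simp
  have "card T \<le> k" using k card by simp
  then have "int (hilb T' k) = int (hilb T k) - (int k + 1 - (int (card T) - int npoints))"
    using hilb_insert_large[of k] npoints_le by (simp add: of_nat_diff)
  moreover have "2 * int (hilb T k) = 2 * (int k + 1) * (int k + 2) - 2 * int (card T) * int k
      + int (card T) * (int (card T) - 3) - 2 * \<beta>"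
    using assms \<open>card T \<le> k\<close> by (simp add: second_betti_def)
  ultimately show "2 * int (hilb T' k) = 2 * (int k + 1) * (int k + 2) - 2 * int (card T') * int k
      + int (card T') * (int (card T') - 3) - 2 * (\<beta> + int npoints)"
    unfolding card by (simp add: algebra_simps)
qed

subsection \<open>From the numerical condition to free bases\<close>

text \<open>Both sequences together, eliminating the larger arrangement.\<close>

lemma hilb_growth:
  "hilb T 0 \<le> (1 - npoints) + (1 - coexponent)"
  "hilb T (Suc k) \<le> hilb T k + ((Suc k + 1 - npoints) + (Suc k + 1 - coexponent))"
  using hilb_delete(1)[of 0] hilb_restrict(1)[of 0] hilb_delete(1)[of "Suc k"] hilb_restrict(1)[of "Suc k"]
  by simp_all

lemma hilb_le_sum: "hilb T k \<le> (\<Sum>j\<le>k. (j + 1 - npoints) + (j + 1 - coexponent))"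
proof (induction k)
  case 0
  then show ?case using hilb_growth(1) by simp
next
  case (Suc k)
  then show ?case using hilb_growth(2)[of k] by simp
qed

text \<open>The gap between the bound \<open>hilb_le_sum\<close> and the Hilbert function can only grow with the degree, so if it
  is zero in some degree it is zero in all smaller ones.\<close>

lemma hilb_deficiency_mono:
  assumes "hilb T (k + i) = (\<Sum>j\<le>k + i. (j + 1 - npoints) + (j + 1 - coexponent))"
  shows "hilb T k = (\<Sum>j\<le>k. (j + 1 - npoints) + (j + 1 - coexponent))"
  using assms
proof (induction i)
  case (Suc i)
  have "hilb T (k + i) = (\<Sum>j\<le>k + i. (j + 1 - npoints) + (j + 1 - coexponent))"
    using Suc(2) hilb_growth(2)[of "k + i"] hilb_le_sum[of "k + i"] by simp
  then show ?case by (rule Suc(1))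
qed simp

lemma sum_truncated: "e \<le> k + 1 \<Longrightarrow> 2 * int (\<Sum>j\<le>k. j + 1 - e) = (int k + 1 - int e) * (int k + 2 - int e)"
proof (induction k)
  case 0
  then have "e = 0 \<or> e = 1" by auto
  then show ?case by auto
next
  case (Suc k)
  show ?case
  proof (cases "e \<le> k + 1")
    case True
    then show ?thesis using Suc.IH by (simp add: of_nat_diff algebra_simps)
  next
    case False
    then have "e = Suc (Suc k)" using Suc.prems by simp
    then show ?thesis by simp
  qed
qed

text \<open>In large degrees the summed bound is a sum of two quadratics, and it equals the Hilbert
  function given by the second Betti number because \<open>npoints + coexponent = card T\<close>.\<close>

lemma hilb_eq_sum:
  assumes "second_betti T (int npoints * int coexponent)"
  shows "hilb T k = (\<Sum>j\<le>k. (j + 1 - npoints) + (j + 1 - coexponent))"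
proof (rule hilb_deficiency_mono[where i = "card T"])
  \<comment> \<open>A degree that is at least \<open>k\<close> and lies in the range where the quadratic is valid.\<close>
  define K where "K = k + card T"
  define s where "s = int (card T)"
  have n: "npoints \<le> K + 1" "coexponent \<le> K + 1" "card T \<le> K"
    using npoints_le by (auto simp: K_def)
  have s: "s = int npoints + int coexponent" using npoints_le by (simp add: s_def)
  have "2 * int (\<Sum>j\<le>K. (j + 1 - npoints) + (j + 1 - coexponent))
      = (int K + 1 - int npoints) * (int K + 2 - int npoints) + (int K + 1 - int coexponent) * (int K + 2 - int coexponent)"
    using sum_truncated[OF n(1)] sum_truncated[OF n(2)] by (simp add: sum.distrib)
  also have "\<dots> = 2 * (int K + 1) * (int K + 2) - 2 * s * int K + s * (s - 3) - 2 * (int npoints * int coexponent)"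
    unfolding s by (simp add: algebra_simps)
  also have "\<dots> = 2 * int (hilb T K)"
    using assms n(3) unfolding second_betti_def s_def by simp
  finally have "int (\<Sum>j\<le>K. (j + 1 - npoints) + (j + 1 - coexponent)) = int (hilb T K)"
    by (simp only: mult_cancel_left numeral_neq_zero simp_thms)
  from this[symmetric] show "hilb T (k + card T) = (\<Sum>j\<le>k + card T. (j + 1 - npoints) + (j + 1 - coexponent))"
    by (simp only: of_nat_eq_iff K_def)
qed

lemma both_sequences_exact:
  assumes "second_betti T (int npoints * int coexponent)"
  shows "normal ` log_fields T k = normal_target k"
    and "tangential ` log_fields T' k = tangential_target k"
proof -
  define r where "r = (case k of 0 \<Rightarrow> 0 | Suc j \<Rightarrow> hilb T j)"
  have "hilb T k = r + ((k + 1 - npoints) + (k + 1 - coexponent))"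
  proof (cases k)
    case 0
    then show ?thesis using hilb_eq_sum[OF assms, of 0] by (simp add: r_def)
  next
    case (Suc j)
    then show ?thesis using hilb_eq_sum[OF assms, of k] hilb_eq_sum[OF assms, of j] by (simp add: r_def)
  qed
  then have "hilb T k = hilb T' k + (k + 1 - coexponent)" "hilb T' k = r + (k + 1 - npoints)"
    using hilb_delete(1)[of k] hilb_restrict(1)[of k] by (simp_all add: r_def)
  then show "normal ` log_fields T k = normal_target k"
    "tangential ` log_fields T' k = tangential_target k"
    using hilb_delete(2)[of k] hilb_restrict(2)[of k] unfolding r_def by blast+
qed

text \<open>In degree \<open>npoints\<close>, respectively \<open>coexponent\<close>, the target of the sequence is spanned by its
  generator.\<close>

lemma special_fields:
  assumes "second_betti T (int npoints * int coexponent)"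
  obtains v1 v2 where "v1 \<in> log_fields T' npoints" "tangential v1 = point_poly"
    "v2 \<in> log_fields T coexponent" "normal v2 = contact"
proof -
  have one: "1 \<in> upto_degree (m + 1 - m)" for m by (simp add: upto_degree_iff)
  have "point_poly * 1 \<in> tangential ` log_fields T' npoints"
    unfolding both_sequences_exact(2)[OF assms] using one by (rule imageI)
  moreover have "contact * 1 \<in> normal ` log_fields T coexponent"
    unfolding both_sequences_exact(1)[OF assms] using one by (rule imageI)
  ultimately show thesis using that by auto
qed

text \<open>One step of reduction: \<open>f\<close> is a quotient found on the line, and its lift cancels the corresponding
  part of \<open>v\<close>. When \<open>k < d\<close> the membership of \<open>f\<close> forces \<open>f = 0\<close>, so the truncated degree is harmless.\<close>

lemma lift_subtract:
  assumes V: "v \<in> log_fields S k" and w: "w \<in> log_fields S d" and f: "f \<in> upto_degree (k + 1 - d)"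
  shows "v - fmult (lift (k - d) f) w \<in> log_fields S k"
    and "restr (act t (v - fmult (lift (k - d) f) w)) = restr (act t v) - f * restr (act t w)"
proof -
  have "fmult (lift (k - d) f) w \<in> log_fields S k"
  proof (cases "f = 0")
    case False
    then have "d \<le> k" using f by (simp add: upto_degree_iff)
    then show ?thesis using log_fields_fmult[OF homogeneous_lift w, of "k - d" f] by simp
  qed simp
  then show "v - fmult (lift (k - d) f) w \<in> log_fields S k"
    using V by (rule log_fields_diff[rotated])
  have "restr (lift (k - d) f) = f"
    using f by (cases "f = 0") (auto simp: upto_degree_iff restr_lift)
  then show "restr (act t (v - fmult (lift (k - d) f) w)) = restr (act t v) - f * restr (act t w)"
    by (simp only: act_diff act_fmult restr_diff restr_mult)
qed

context
  fixes v1 v2 :: "'k mpoly3 \<times> 'k mpoly3"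
  assumes v1: "v1 \<in> log_fields T' npoints" "tangential v1 = point_poly"
    and v2: "v2 \<in> log_fields T coexponent" "normal v2 = contact"
begin

lemma v1_tangent: "normal v1 = 0"
  using v1 restr_dvd by (simp add: log_fields_def)

lemma log_fields_inserted_step:
  assumes "v \<in> log_fields T' k"
  obtains p w where "v - fmult p v1 = fmult form w" "w = 0 \<or> (\<exists>j. k = Suc j \<and> w \<in> log_fields T j)"
proof -
  obtain f where f: "f \<in> upto_degree (k + 1 - npoints)" "tangential v = point_poly * f"
    using restr_tangential_mem[OF assms] by blast
  define v' where "v' = v - fmult (lift (k - npoints) f) v1"
  have v': "v' \<in> log_fields T' k" "tangential v' = 0"
    using lift_subtract[OF assms v1(1) f(1)] by (simp_all add: v'_def f(2) v1(2))
  show thesis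
  proof (cases k)
    case 0
    then have "v' = fmult form 0" using tangential_kernel(1)[OF v'] by simp
    then show ?thesis using that unfolding v'_def by blast
  next
    case (Suc j)
    then show ?thesis using tangential_kernel(2)[OF v' Suc] that unfolding v'_def by blast
  qed
qed

text \<open>Reduce first modulo \<open>v2\<close>, to land in the larger arrangement, then modulo \<open>v1\<close>; what remains is the
  equation of the new line times a field of smaller degree.\<close>

lemma log_fields_generated: "v \<in> log_fields T k \<Longrightarrow> \<exists>p q. v = fmult p v1 + fmult q v2"
proof (induction k arbitrary: v rule: less_induct)
  case (less k)
  obtain f where f: "f \<in> upto_degree (k + 1 - coexponent)" "normal v = contact * f"
    using restr_act_mem[OF less(2)] by blast
  define q where "q = lift (k - coexponent) f"
  have v': "v - fmult q v2 \<in> log_fields T k" "normal (v - fmult q v2) = 0"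
    using lift_subtract[OF less(2) v2(1) f(1)] by (simp_all add: q_def f(2) v2(2))
  then have "v - fmult q v2 \<in> log_fields T' k" using log_fields_insert_iff by blast
  then obtain p w where w: "v - fmult q v2 - fmult p v1 = fmult form w"
    "w = 0 \<or> (\<exists>j. k = Suc j \<and> w \<in> log_fields T j)"
    by (rule log_fields_inserted_step)
  have "\<exists>p' q'. w = fmult p' v1 + fmult q' v2"
    using w(2)
  proof
    assume "w = 0"
    then have "w = fmult 0 v1 + fmult 0 v2" by simp
    then show ?thesis by blast
  next
    assume "\<exists>j. k = Suc j \<and> w \<in> log_fields T j"
    then show ?thesis using less(1) by blast
  qed
  then obtain p' q' where "w = fmult p' v1 + fmult q' v2" by blast
  then have "v = fmult (p + form * p') v1 + fmult (q + form * q') v2"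
    using w(1) by (simp add: fmult_add fmult_add_left fmult_fmult algebra_simps)
  then show ?case by blast
qed

text \<open>In the coordinates given by the line, the determinant of the two fields restricts to minus
  the product of \<open>point_poly\<close> and \<open>contact\<close>.\<close>

lemma det_ne_0: "fst v1 * snd v2 - snd v1 * fst v2 \<noteq> 0"
proof
  assume 0: "fst v1 * snd v2 - snd v1 * fst v2 = 0"
  have C: "Const a * Const l2 = 1 + Const b * Const l1"
    using det by (metis Const_add Const_mult Const_1 diff_eq_eq)
  have "act (a, b, c) v1 * act (l1, l2, l3) v2 - act (l1, l2, l3) v1 * act (a, b, c) v2
      = fst v1 * snd v2 - snd v1 * fst v2"
    using C unfolding act_def prod.case by algebra
  then have "restr (act (a, b, c) v1 * act (l1, l2, l3) v2 - act (l1, l2, l3) v1 * act (a, b, c) v2) = 0"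
    using 0 by simp
  then have "point_poly * contact = 0"
    by (simp only: restr_diff restr_mult v1_tangent v1(2) v2(2)) simp
  then show False using contact_ne_0 point_poly_ne_0 by (metis mult_eq_0_iff)
qed

lemma independent_pair: "fmult p v1 + fmult q v2 = 0 \<Longrightarrow> p = 0 \<and> q = 0"
proof -
  assume "fmult p v1 + fmult q v2 = 0"
  then have "p * fst v1 + q * fst v2 = 0" "p * snd v1 + q * snd v2 = 0"
    by (simp_all add: fmult_def prod_eq_iff)
  then have "p * (fst v1 * snd v2 - snd v1 * fst v2) = 0" "q * (fst v1 * snd v2 - snd v1 * fst v2) = 0"
    by algebra+
  then show "p = 0 \<and> q = 0" using det_ne_0 by simp
qed

lemma free_fields_deleted: "free_fields T npoints coexponent"
proof -
  have "v1 \<in> log_fields T npoints" using v1(1) log_fields_mono[of T T'] by blast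
  then show ?thesis
    unfolding free_fields_def using v2(1) log_fields_generated independent_pair by blast
qed

text \<open>A field of the larger arrangement needs no reduction modulo \<open>v2\<close> in the first step, so the
  coefficient of \<open>v2\<close> is a multiple of the equation of the new line.\<close>

lemma free_fields_inserted: "free_fields T' npoints (Suc coexponent)"
proof -
  have gen: "\<exists>p q. v = fmult p v1 + fmult q (fmult form v2)" if v: "v \<in> log_fields T' k" for v k
  proof -
    obtain p w where w: "v - fmult p v1 = fmult form w" "w = 0 \<or> (\<exists>j. k = Suc j \<and> w \<in> log_fields T j)"
      by (rule log_fields_inserted_step[OF v])
    have "w \<in> log_fields T (k - 1)" using w(2) by auto
    then obtain p' q' where "w = fmult p' v1 + fmult q' v2" using log_fields_generated by blast
    then have "v = fmult (p + form * p') v1 + fmult q' (fmult form v2)"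
      using w(1) by (simp add: fmult_add fmult_add_left fmult_fmult algebra_simps)
    then show ?thesis by blast
  qed
  have ind: "p = 0 \<and> q = 0" if "fmult p v1 + fmult q (fmult form v2) = 0" for p q
    using independent_pair[of p "q * form"] that form_ne_0 by (simp add: fmult_fmult)
  show ?thesis
    unfolding free_fields_def using v1(1) fmult_form_mem(1)[OF v2(1)] gen ind by blast
qed

end

text \<open>Freeness of both arrangements forces a common exponent, because the lowest exponents differ by
  at most one; the factorizations of the two Hilbert functions then give the numerical condition.\<close>

theorem both_free_iff:
  assumes betti: "second_betti T \<beta>"
  shows "(\<exists>d1 d2. free_fields T d1 d2) \<and> (\<exists>d1 d2. free_fields T' d1 d2) \<longleftrightarrow> \<beta> = int npoints * int coexponent"
proof
  assume "\<beta> = int npoints * int coexponent"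
  then have "second_betti T (int npoints * int coexponent)" using betti by simp
  then obtain v1 v2 where "v1 \<in> log_fields T' npoints" "tangential v1 = point_poly"
    "v2 \<in> log_fields T coexponent" "normal v2 = contact"
    by (rule special_fields)
  then show "(\<exists>d1 d2. free_fields T d1 d2) \<and> (\<exists>d1 d2. free_fields T' d1 d2)"
    using free_fields_deleted free_fields_inserted by blast
next
  have order: "\<exists>d1 d2. free_fields S d1 d2 \<and> d1 \<le> d2" if "\<exists>d1 d2. free_fields S d1 d2"
    for S :: "('k \<times> 'k \<times> 'k) set"
    using that free_fields_sym nat_le_linear by metis
  assume "(\<exists>d1 d2. free_fields T d1 d2) \<and> (\<exists>d1 d2. free_fields T' d1 d2)"
  then obtain d1 d2 e1 e2 where d: "free_fields T d1 d2" "d1 \<le> d2" and e: "free_fields T' e1 e2" "e1 \<le> e2"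
    using order by meson
  have card: "card T' = Suc (card T)" using finite_T new_line by simp
  have D: "d1 + d2 = card T" "int d1 * int d2 = \<beta>"
    using free_fields_exponents[OF d(1) betti] .
  have E: "e1 + e2 = Suc (card T)" "int e1 * int e2 = \<beta> + int npoints"
    using free_fields_exponents[OF e(1) second_betti_insert[OF betti]] card by auto
  obtain v where v: "v \<in> log_fields T' e1" "v \<noteq> 0" using free_fields_generator[OF e(1)] by blast
  then have "v \<in> log_fields T e1" using log_fields_mono[of T T'] by blast
  then have "d1 \<le> e1" using free_fields_min_degree[OF d] v(2) by blast
  moreover obtain w where w: "w \<in> log_fields T d1" "w \<noteq> 0" using free_fields_generator[OF d(1)] by blast
  then have "fmult form w \<in> log_fields T' (Suc d1)" "fmult form w \<noteq> 0"
    using fmult_form_mem(1) form_ne_0 by (auto simp: fmult_eq_0_iff)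
  then have "e1 \<le> Suc d1" using free_fields_min_degree[OF e] by blast
  ultimately consider "e1 = d1" "e2 = Suc d2" | "e1 = Suc d1" "e2 = d2"
    using D E by linarith
  then show "\<beta> = int npoints * int coexponent"
  proof cases
    case 1
    then have "int npoints = int d1" using D(2) E(2) by (simp add: algebra_simps)
    then show ?thesis using D by auto
  next
    case 2
    then have "int npoints = int d2" using D(2) E(2) by (simp add: algebra_simps)
    then show ?thesis using D by (auto simp: mult.commute)
  qed
qed

end

section \<open>Derivations of the cone and vector fields\<close>

subsection \<open>Equations of lines\<close>

definition line_coeffs :: "('k::field ^ 2) set \<Rightarrow> 'k \<times> 'k \<times> 'k" where
  "line_coeffs H = (SOME t. case t of (a, b, c) \<Rightarrow> defines_line a b c H)"

lemma defines_line_coeffs: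
  assumes "affine_line H" "line_coeffs H = (a, b, c)"
  shows "defines_line a b c H"
proof -
  obtain a' b' c' where "defines_line a' b' c' H" using assms(1) by (auto simp: affine_line_def)
  then have "case (a', b', c') of (a, b, c) \<Rightarrow> defines_line a b c H" by simp
  then have "case line_coeffs H of (a, b, c) \<Rightarrow> defines_line a b c H"
    unfolding line_coeffs_def by (rule someI)
  then show ?thesis using assms(2) by simp
qed

text \<open>Two points of \<open>H\<close> suffice, and every line has two points even over the field with two elements.\<close>

lemma defines_line_subset_proportional:
  assumes "defines_line a b c H" "defines_line a' b' c' H'" "H \<subseteq> H'"
  obtains \<mu> where "\<mu> \<noteq> 0" "proportional (a', b', c') (a, b, c) \<mu>"
proof -
  have "a \<noteq> 0 \<or> b \<noteq> 0" using assms(1) by (simp add: defines_line_def)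
  then obtain x0 y0 l1 l2 l3 where "plane_line a b c x0 y0 l1 l2 l3"
    using plane_line_exists by metis
  then interpret plane_line a b c x0 y0 l1 l2 l3 .
  define P :: "'a ^ 2" where "P = (\<chi> i. if i = 1 then x0 else y0)"
  define Q :: "'a ^ 2" where "Q = (\<chi> i. if i = 1 then x0 - b else y0 + a)"
  have "P \<in> H" "Q \<in> H"
    using assms(1) on_line by (auto simp: defines_line_def P_def Q_def algebra_simps)
  then have "P \<in> H'" "Q \<in> H'" using assms(3) by auto
  then have "a' * x0 + b' * y0 + c' = 0" "a' * (x0 - b) + b' * (y0 + a) + c' = 0"
    using assms(2) by (auto simp: defines_line_def P_def Q_def)
  moreover from this have "b' * a - a' * b = 0" by algebra
  ultimately have "restr (linform (a', b', c')) = 0"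
    by (simp add: restr_linform)
  then obtain \<mu> where \<mu>: "proportional (a', b', c') (a, b, c) \<mu>" by (rule restr_linform_eq_0)
  moreover have "\<mu> \<noteq> 0"
    using \<mu> assms(2) by (auto simp: proportional_def defines_line_def)
  ultimately show thesis using that by blast
qed

lemma proportional_same_line:
  assumes "defines_line a b c H" "defines_line a' b' c' H'" "proportional (a', b', c') (a, b, c) \<mu>"
  shows "H = H'"
proof -
  have \<mu>: "\<mu> \<noteq> 0" using assms(2,3) by (auto simp: proportional_def defines_line_def)
  have "\<mu> * a * x + \<mu> * b * y + \<mu> * c = \<mu> * (a * x + b * y + c)" for x y by (simp add: algebra_simps)
  then show ?thesis using assms \<mu> by (auto simp: proportional_def defines_line_def)
qed

lemma line_coeffs_inj:
  assumes "affine_line H" "affine_line H'" "proportional (line_coeffs H') (line_coeffs H) \<mu>"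
  shows "H = H'"
proof -
  obtain a b c a' b' c' where e: "line_coeffs H = (a, b, c)" "line_coeffs H' = (a', b', c')"
    by (metis prod_cases3)
  show ?thesis
    by (rule proportional_same_line[OF defines_line_coeffs[OF assms(1) e(1)] defines_line_coeffs[OF assms(2) e(2)]])
      (use assms(3) e in simp)
qed

lemma proportional_refl: "proportional t t 1"
  by (simp add: proportional_def split_beta)

lemma inj_on_line_coeffs: "line_arrangement A \<Longrightarrow> inj_on line_coeffs A"
  by (rule inj_onI) (metis line_arrangement_def line_coeffs_inj proportional_refl)

lemma distinct_lines_coeffs:
  assumes "line_arrangement A"
  shows "distinct_lines (line_coeffs ` A)"
  unfolding distinct_lines_def
proof (intro conjI ballI impI)
  show "finite (line_coeffs ` A)" using assms by (simp add: line_arrangement_def)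
  show "case t of (a, b, c) \<Rightarrow> a \<noteq> 0 \<or> b \<noteq> 0" if t: "t \<in> line_coeffs ` A" for t
  proof -
    obtain H where H: "H \<in> A" "t = line_coeffs H" using t by blast
    obtain a b c where e: "t = (a, b, c)" by (cases t)
    have "defines_line a b c H"
      using assms H e by (intro defines_line_coeffs) (auto simp: line_arrangement_def)
    then show ?thesis by (simp add: e defines_line_def)
  qed
  show "s = t" if st: "s \<in> line_coeffs ` A" "t \<in> line_coeffs ` A" "\<exists>\<mu>. proportional s t \<mu>" for s t
  proof -
    obtain H H' where "H \<in> A" "s = line_coeffs H" "H' \<in> A" "t = line_coeffs H'" using st(1,2) by blast
    moreover from this have "affine_line H" "affine_line H'" using assms by (auto simp: line_arrangement_def)
    ultimately show ?thesis using st(3) line_coeffs_inj by metis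
  qed
qed

subsection \<open>Logarithmic derivations modulo the Euler derivation\<close>

lemma derivation_add: "\<theta> \<in> derivations \<Longrightarrow> \<theta> (p + q) = \<theta> p + \<theta> q"
  and derivation_Const_mult: "\<theta> \<in> derivations \<Longrightarrow> \<theta> (Const c * p) = Const c * \<theta> p"
  by (auto simp: derivations_def)

lemma derivation_linform:
  assumes "\<theta> \<in> derivations"
  shows "\<theta> (linform (a, b, c)) = Const a * \<theta> (Var 1) + Const b * \<theta> (Var 2) + Const c * \<theta> (Var 3)"
  using assms by (simp add: linform_def derivation_add derivation_Const_mult)

lemma linform_proportional:
  assumes "proportional s t \<mu>"
  shows "linform s = Const \<mu> * linform t"
proof -
  obtain a' b' c' a b c where e: "s = (a', b', c')" "t = (a, b, c)" by (metis prod_cases3)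
  have \<mu>: "a' = \<mu> * a" "b' = \<mu> * b" "c' = \<mu> * c" using assms by (simp_all add: e proportional_def)
  show ?thesis
    by (simp only: e \<mu> linform_def prod.case Const_mult distrib_left mult.assoc)
qed

text \<open>One equation per line is enough, since any other is a nonzero scalar multiple of it.\<close>

lemma log_der_iff:
  assumes A: "line_arrangement A" and \<theta>: "\<theta> \<in> derivations"
  shows "\<theta> \<in> log_der A \<longleftrightarrow> Var 3 dvd \<theta> (Var 3) \<and> (\<forall>t\<in>line_coeffs ` A. linform t dvd \<theta> (linform t))"
proof -
  have cone: "cone_forms A = insert (Var 3) {linform (a, b, c) | a b c. \<exists>H\<in>A. defines_line a b c H}"
    by (simp add: cone_forms_def linform_def)
  have "linform (a, b, c) dvd \<theta> (linform (a, b, c))"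
    if H: "H \<in> A" "defines_line a b c H" and d: "linform (line_coeffs H) dvd \<theta> (linform (line_coeffs H))" for a b c H
  proof -
    obtain a' b' c' where e: "line_coeffs H = (a', b', c')" by (cases "line_coeffs H")
    have "affine_line H" using A H(1) by (simp add: line_arrangement_def)
    then obtain \<mu> where \<mu>: "\<mu> \<noteq> 0" "proportional (a, b, c) (a', b', c') \<mu>"
      using defines_line_subset_proportional[OF defines_line_coeffs[OF _ e] H(2)] by blast
    obtain q where "\<theta> (linform (a', b', c')) = linform (a', b', c') * q" using d e by (auto elim: dvdE)
    then have "\<theta> (linform (a, b, c)) = linform (a, b, c) * q"
      unfolding linform_proportional[OF \<mu>(2)] by (simp add: derivation_Const_mult[OF \<theta>] mult.assoc)
    then show ?thesis by simp
  qed
  note all = this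
  have mem: "linform (line_coeffs H) \<in> cone_forms A" if "H \<in> A" for H
  proof -
    obtain a b c where e: "line_coeffs H = (a, b, c)" by (cases "line_coeffs H")
    have "defines_line a b c H"
      by (rule defines_line_coeffs[OF _ e]) (use A that in \<open>simp add: line_arrangement_def\<close>)
    then show ?thesis unfolding cone e using that by blast
  qed
  show ?thesis
  proof
    assume "\<theta> \<in> log_der A"
    then have "\<forall>\<alpha>\<in>cone_forms A. \<alpha> dvd \<theta> \<alpha>" by (simp add: log_der_def)
    moreover have "Var 3 \<in> cone_forms A" by (simp add: cone_forms_def)
    ultimately show "Var 3 dvd \<theta> (Var 3) \<and> (\<forall>t\<in>line_coeffs ` A. linform t dvd \<theta> (linform t))"
      using mem by blast
  next
    assume h: "Var 3 dvd \<theta> (Var 3) \<and> (\<forall>t\<in>line_coeffs ` A. linform t dvd \<theta> (linform t))"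
    have "\<alpha> dvd \<theta> \<alpha>" if "\<alpha> \<in> cone_forms A" for \<alpha>
      using that unfolding cone
    proof
      assume "\<alpha> \<in> {linform (a, b, c) | a b c. \<exists>H\<in>A. defines_line a b c H}"
      then obtain a b c H where "\<alpha> = linform (a, b, c)" "H \<in> A" "defines_line a b c H" by blast
      then show ?thesis using all h by blast
    qed (use h in simp)
    then show "\<theta> \<in> log_der A" using \<theta> by (simp add: log_der_def)
  qed
qed

abbreviation der_of :: "'k::field mpoly3 \<times> 'k mpoly3 \<Rightarrow> 'k mpoly3 \<Rightarrow> 'k mpoly3" where
  "der_of v \<equiv> vfield (fst v) (snd v) 0"

lemma der_of_linform: "der_of v (linform t) = act t v"
  by (cases t) (simp add: derivation_linform[OF vfield_derivation] act_def)

lemma der_of_add: "der_of (v + w) = der_of v + der_of w"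
  by (rule ext) (simp add: vfield_def algebra_simps)

lemma der_of_fmult: "der_of (fmult p v) = der_scale p (der_of v)"
  by (rule ext) (simp add: vfield_def fmult_def der_scale_def algebra_simps)

lemma der_of_sum: "der_of (sum f I) = (\<Sum>i\<in>I. der_of (f i))"
proof (induction I rule: infinite_finite_induct)
  case (insert i I)
  then show ?case using der_of_add[of "f i" "sum f I"] by simp
qed (simp_all add: vfield_def fun_eq_iff)

lemma euler_der_linform: "euler_der (linform t) = linform t"
proof -
  have "euler_der (linform t) = vfield (Var 1) (Var 2) (Var 3) (linform t)" by (simp add: euler_der_vfield)
  also have "\<dots> = linform t"
  proof -
    obtain a b c where t: "t = (a, b, c)" by (cases t)
    have "vfield (Var 1) (Var 2) (Var 3) (linform t)
        = Const a * Var 1 + Const b * Var 2 + Const c * Var 3"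
      unfolding t derivation_linform[OF vfield_derivation] by simp
    then show ?thesis by (simp add: t linform_def)
  qed
  finally show ?thesis .
qed

lemma euler_der_Var [simp]: "euler_der (Var 1) = Var 1" "euler_der (Var 2) = Var 2" "euler_der (Var 3) = Var 3"
  by (simp_all add: euler_der_vfield)

lemma Var_ne_0 [simp]: "Var i \<noteq> (0 :: 'k::field mpoly3)"
proof
  assume "Var i = (0 :: 'k mpoly3)"
  then have "lookup (Var i :: 'k mpoly3) (single i 1) = 0" by simp
  then show False by (simp add: Var_def)
qed

lemma der_scale_derivation: "\<theta> \<in> derivations \<Longrightarrow> der_scale p \<theta> \<in> derivations"
  by (auto simp: derivations_def der_scale_def algebra_simps)

lemma add_derivation: "\<theta> \<in> derivations \<Longrightarrow> \<eta> \<in> derivations \<Longrightarrow> \<theta> + \<eta> \<in> derivations"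
  by (auto simp: derivations_def algebra_simps)

lemma subspace_log_der: "der.subspace (log_der A)"
proof (rule der.subspaceI)
  show "0 \<in> log_der A" by (auto simp: log_der_def derivations_def)
next
  fix x y assume "x \<in> log_der A" "y \<in> log_der A"
  then show "x + y \<in> log_der A" by (auto simp: log_der_def intro!: add_derivation dvd_add)
next
  fix c x assume "x \<in> log_der A"
  then show "der_scale c x \<in> log_der A"
    by (auto simp: log_der_def intro!: der_scale_derivation) (auto simp: der_scale_def)
qed

lemma euler_der_log_der:
  assumes "line_arrangement A"
  shows "euler_der \<in> log_der A"
proof -
  have "euler_der \<in> derivations" unfolding euler_der_vfield by (rule vfield_derivation)
  from log_der_iff[OF assms this] show ?thesis by (simp add: euler_der_linform)
qed

lemma der_of_log_der_iff:
  assumes "line_arrangement A"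
  shows "der_of v \<in> log_der A \<longleftrightarrow> (\<forall>t\<in>line_coeffs ` A. linform t dvd act t v)"
  using log_der_iff[OF assms vfield_derivation] by (simp add: der_of_linform)

text \<open>Subtracting \<open>\<theta>(z)/z\<close> times the Euler derivation makes a logarithmic derivation kill \<open>z\<close>.\<close>

lemma log_der_decompose:
  assumes A: "line_arrangement A" and \<theta>: "\<theta> \<in> log_der A"
  obtains g v where "\<theta> = der_scale g euler_der + der_of v" "der_of v \<in> log_der A"
    "\<theta> (Var 3) = g * Var 3" "fst v = \<theta> (Var 1) - g * Var 1" "snd v = \<theta> (Var 2) - g * Var 2"
proof -
  have der: "\<theta> \<in> derivations" using \<theta> by (simp add: log_der_def)
  obtain g where g: "\<theta> (Var 3) = Var 3 * g"
    using \<theta> log_der_iff[OF A der] by (auto elim: dvdE)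
  define v where "v = (\<theta> (Var 1) - g * Var 1, \<theta> (Var 2) - g * Var 2)"
  have E: "euler_der \<in> derivations" unfolding euler_der_vfield by (rule vfield_derivation)
  have eq: "\<theta> = der_scale g euler_der + der_of v"
  proof (rule derivation_ext[OF der])
    show "der_scale g euler_der + der_of v \<in> derivations"
      by (intro add_derivation der_scale_derivation E vfield_derivation)
    fix i :: 3
    show "\<theta> (Var i) = (der_scale g euler_der + der_of v) (Var i)"
      using exhaust_3[of i] g by (auto simp: der_scale_def v_def mult.commute)
  qed
  have "der_of v = \<theta> - der_scale g euler_der" using eq by simp
  then have "der_of v \<in> log_der A"
    using der.subspace_diff[OF subspace_log_der \<theta> der.subspace_scale[OF subspace_log_der euler_der_log_der[OF A]]]
    by metis
  moreover have "\<theta> (Var 3) = g * Var 3" using g by (simp only: mult.commute)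
  ultimately show thesis by (rule that[OF eq]) (simp_all add: v_def)
qed

lemma der_combination_eq_0:
  assumes "der_scale g euler_der + der_of v = 0"
  shows "g = 0" "v = 0"
proof -
  have 0: "(der_scale g euler_der + der_of v) p = 0" for p using assms by simp
  show g: "g = 0" using 0[of "Var 3"] by (simp add: der_scale_def)
  show "v = 0" using 0[of "Var 1"] 0[of "Var 2"] g by (simp add: der_scale_def prod_eq_iff)
qed

text \<open>Linear forms are homogeneous, so the logarithmic condition passes to homogeneous components.\<close>

lemma hcomp_log_fields:
  assumes "\<forall>t\<in>T. linform t dvd act t v"
  shows "(hcomp k (fst v), hcomp k (snd v)) \<in> log_fields T k"
proof -
  have hc: "hcomp k (Const a * p) = Const a * hcomp k p" for a p
    using hcomp_mult[OF homogeneous_Const, of k a p] by simp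
  have "linform t dvd act t (hcomp k (fst v), hcomp k (snd v))" if t: "t \<in> T" for t
  proof -
    obtain q where q: "act t v = linform t * q" using assms t by (auto elim: dvdE)
    have "act t (hcomp k (fst v), hcomp k (snd v)) = hcomp k (act t v)"
      by (simp add: act_def split_beta hcomp_add hc)
    also have "\<dots> = (if Suc 0 \<le> k then linform t * hcomp (k - Suc 0) q else 0)"
      unfolding q by (rule hcomp_mult[OF homogeneous_linform])
    finally show ?thesis by simp
  qed
  then show ?thesis by (simp add: log_fields_def)
qed

lemma pair_sum_hcomp:
  obtains N where "v = (\<Sum>k\<le>N. (hcomp k (fst v), hcomp k (snd v)))"
proof -
  obtain N1 where N1: "\<And>k. k > N1 \<Longrightarrow> hcomp k (fst v) = 0" using hcomp_bound by blast
  obtain N2 where N2: "\<And>k. k > N2 \<Longrightarrow> hcomp k (snd v) = 0" using hcomp_bound by blast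
  define N where "N = max N1 N2"
  have "fst v = (\<Sum>k\<le>N. hcomp k (fst v))" "snd v = (\<Sum>k\<le>N. hcomp k (snd v))"
    using sum_hcomp[of N] N1 N2 by (auto simp: N_def)
  then have "v = (\<Sum>k\<le>N. (hcomp k (fst v), hcomp k (snd v)))"
    by (simp add: prod_eq_iff fst_sum snd_sum)
  then show thesis using that by blast
qed

lemma der_span3: "x \<in> der.span {e, \<theta>1, \<theta>2} \<longleftrightarrow> (\<exists>g p q. x = der_scale g e + der_scale p \<theta>1 + der_scale q \<theta>2)"
proof
  assume "x \<in> der.span {e, \<theta>1, \<theta>2}"
  then obtain g p q where "x - der_scale g e - der_scale p \<theta>1 - der_scale q \<theta>2 = 0"
    unfolding der.span_breakdown_eq der.span_empty by blast
  then have "x = der_scale g e + der_scale p \<theta>1 + der_scale q \<theta>2" by (simp add: algebra_simps)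
  then show "\<exists>g p q. x = der_scale g e + der_scale p \<theta>1 + der_scale q \<theta>2" by blast
next
  assume "\<exists>g p q. x = der_scale g e + der_scale p \<theta>1 + der_scale q \<theta>2"
  then show "x \<in> der.span {e, \<theta>1, \<theta>2}"
    by (auto intro!: der.span_add der.span_scale intro: der.span_base)
qed

lemma der_independent3:
  assumes "distinct [e, \<theta>1, \<theta>2]"
  shows "der.independent {e, \<theta>1, \<theta>2} \<longleftrightarrow>
    (\<forall>g p q. der_scale g e + der_scale p \<theta>1 + der_scale q \<theta>2 = 0 \<longrightarrow> g = 0 \<and> p = 0 \<and> q = 0)"
proof -
  have sum: "(\<Sum>v\<in>{e, \<theta>1, \<theta>2}. der_scale (u v) v)
      = der_scale (u e) e + der_scale (u \<theta>1) \<theta>1 + der_scale (u \<theta>2) \<theta>2" for u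
    using assms by (simp add: add.assoc)
  have dep: "der.dependent {e, \<theta>1, \<theta>2} \<longleftrightarrow>
      (\<exists>u. (u e \<noteq> 0 \<or> u \<theta>1 \<noteq> 0 \<or> u \<theta>2 \<noteq> 0) \<and>
        der_scale (u e) e + der_scale (u \<theta>1) \<theta>1 + der_scale (u \<theta>2) \<theta>2 = 0)"
    using der.dependent_finite[of "{e, \<theta>1, \<theta>2}"] unfolding sum by simp
  show ?thesis
  proof
    assume ind: "der.independent {e, \<theta>1, \<theta>2}"
    show "\<forall>g p q. der_scale g e + der_scale p \<theta>1 + der_scale q \<theta>2 = 0 \<longrightarrow> g = 0 \<and> p = 0 \<and> q = 0"
    proof (intro allI impI)
      fix g p q assume 0: "der_scale g e + der_scale p \<theta>1 + der_scale q \<theta>2 = 0"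
      define u where "u = (\<lambda>x. if x = e then g else if x = \<theta>1 then p else q)"
      have u: "u e = g" "u \<theta>1 = p" "u \<theta>2 = q" using assms by (auto simp: u_def)
      show "g = 0 \<and> p = 0 \<and> q = 0"
        using ind 0 unfolding dep u[symmetric] by blast
    qed
  next
    assume "\<forall>g p q. der_scale g e + der_scale p \<theta>1 + der_scale q \<theta>2 = 0 \<longrightarrow> g = 0 \<and> p = 0 \<and> q = 0"
    then show "der.independent {e, \<theta>1, \<theta>2}" unfolding dep by blast
  qed
qed

lemma der_of_linear: "der_of (fmult p v + fmult q w) = der_scale p (der_of v) + der_scale q (der_of w)"
  unfolding der_of_add der_of_fmult ..

text \<open>Adding the Euler derivation to a basis of the fields that kill \<open>z\<close> gives a basis of all logarithmic
  derivations, by \<open>log_der_decompose\<close>.\<close>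

lemma free_fields_imp_free:
  assumes A: "line_arrangement A" and free: "free_fields (line_coeffs ` A) d1 d2"
  shows "free_with_exponents A d1 d2"
proof -
  let ?T = "line_coeffs ` A"
  obtain v1 v2 where v1: "v1 \<in> log_fields ?T d1" and v2: "v2 \<in> log_fields ?T d2"
    and gen: "\<forall>k. \<forall>v\<in>log_fields ?T k. \<exists>p q. v = fmult p v1 + fmult q v2"
    and ind: "\<forall>p q. fmult p v1 + fmult q v2 = 0 \<longrightarrow> p = 0 \<and> q = 0"
    using free unfolding free_fields_def by blast
  have hom: "homogeneous_der d (der_of v)" if "v \<in> log_fields ?T d" for v d
    unfolding homogeneous_der_def
  proof (intro conjI allI)
    show "homogeneous d (der_of v (Var i))" for i :: 3
      using exhaust_3[of i] that by (auto simp: log_fields_def)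
  qed (rule vfield_derivation)
  have "der_of v1 \<noteq> der_of v2"
  proof
    assume "der_of v1 = der_of v2"
    then have "v1 = v2" by (metis prod_eqI vfield_Var(1,2))
    then have "fmult 1 v1 + fmult (- 1) v2 = 0" by (simp add: fmult_def prod_eq_iff)
    then show False using ind one_neq_zero by blast
  qed
  moreover have "euler_der \<noteq> der_of v" for v :: "'a mpoly3 \<times> 'a mpoly3"
  proof
    assume "euler_der = der_of v"
    then have "euler_der (Var 3) = der_of v (Var 3)" by simp
    then show False by simp
  qed
  ultimately have dist: "distinct [euler_der, der_of v1, der_of v2]" by simp
  have indep: "der.independent {euler_der, der_of v1, der_of v2}"
    unfolding der_independent3[OF dist]
  proof (intro allI impI)
    fix g p q
    assume "der_scale g euler_der + der_scale p (der_of v1) + der_scale q (der_of v2) = 0"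
    then have "der_scale g euler_der + der_of (fmult p v1 + fmult q v2) = 0"
      by (simp only: der_of_linear add.assoc)
    from der_combination_eq_0[OF this] show "g = 0 \<and> p = 0 \<and> q = 0" using ind by blast
  qed
  have mem: "der_of v \<in> log_der A" if "v \<in> log_fields ?T d" for v d
    using that der_of_log_der_iff[OF A] by (auto simp: log_fields_def)
  have "der.span {euler_der, der_of v1, der_of v2} = log_der A"
  proof
    show "der.span {euler_der, der_of v1, der_of v2} \<subseteq> log_der A"
      by (rule der.span_minimal[OF _ subspace_log_der]) (use euler_der_log_der[OF A] mem v1 v2 in blast)
    show "log_der A \<subseteq> der.span {euler_der, der_of v1, der_of v2}"
    proof
      fix \<theta> assume "\<theta> \<in> log_der A"
      then obtain g v where \<theta>: "\<theta> = der_scale g euler_der + der_of v" "der_of v \<in> log_der A"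
        by (rule log_der_decompose[OF A])
      define w where "w = (\<lambda>k. (hcomp k (fst v), hcomp k (snd v)))"
      obtain N where N: "v = sum w {..N}" using pair_sum_hcomp unfolding w_def by blast
      have "der_of (w k) \<in> der.span {euler_der, der_of v1, der_of v2}" for k
      proof -
        have "w k \<in> log_fields ?T k"
          unfolding w_def using \<theta>(2) der_of_log_der_iff[OF A] by (intro hcomp_log_fields) blast
        then obtain p q where "w k = fmult p v1 + fmult q v2" using gen by blast
        then have "der_of (w k) = der_scale 0 euler_der + der_scale p (der_of v1) + der_scale q (der_of v2)"
          by (simp only: der_of_linear der.scale_zero_left add_0_left)
        then show ?thesis unfolding der_span3 by blast
      qed
      then have "(\<Sum>k\<le>N. der_of (w k)) \<in> der.span {euler_der, der_of v1, der_of v2}"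
        by (intro der.span_sum)
      moreover have "der_of v = (\<Sum>k\<le>N. der_of (w k))"
        using der_of_sum[of w "{..N}"] N by simp
      ultimately have "der_of v \<in> der.span {euler_der, der_of v1, der_of v2}" by simp
      moreover have "der_scale g euler_der \<in> der.span {euler_der, der_of v1, der_of v2}"
        by (intro der.span_scale der.span_base) simp
      ultimately show "\<theta> \<in> der.span {euler_der, der_of v1, der_of v2}"
        unfolding \<theta>(1) by (intro der.span_add)
    qed
  qed
  then show ?thesis
    unfolding free_with_exponents_def using hom v1 v2 dist indep by blast
qed

text \<open>Correcting the two basis elements by multiples of the Euler derivation keeps their degrees, because
  \<open>\<theta>(z)/z\<close> has degree one less than \<open>\<theta>\<close> (and vanishes when \<open>\<theta>\<close> has degree zero).\<close>

lemma free_imp_free_fields: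
  assumes A: "line_arrangement A" and free: "free_with_exponents A d1 d2"
  shows "free_fields (line_coeffs ` A) d1 d2"
proof -
  let ?T = "line_coeffs ` A"
  obtain \<theta>1 \<theta>2 where h: "homogeneous_der d1 \<theta>1" "homogeneous_der d2 \<theta>2"
    and dist: "distinct [euler_der, \<theta>1, \<theta>2]"
    and indep: "der.independent {euler_der, \<theta>1, \<theta>2}"
    and span: "der.span {euler_der, \<theta>1, \<theta>2} = log_der A"
    using free unfolding free_with_exponents_def by blast
  have red: "\<exists>g. \<exists>v\<in>log_fields ?T d. \<theta> = der_scale g euler_der + der_of v"
    if hom: "homogeneous_der d \<theta>" and \<theta>: "\<theta> \<in> log_der A" for d \<theta>
  proof -
    obtain g v where gv: "\<theta> = der_scale g euler_der + der_of v" "der_of v \<in> log_der A"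
      "\<theta> (Var 3) = g * Var 3" "fst v = \<theta> (Var 1) - g * Var 1" "snd v = \<theta> (Var 2) - g * Var 2"
      by (rule log_der_decompose[OF A \<theta>])
    have \<theta>hom: "homogeneous d (\<theta> (Var i))" for i using hom by (simp add: homogeneous_der_def)
    have 3: "homogeneous d (Var 3 * g)" using \<theta>hom[of 3] gv(3) by (simp add: mult.commute)
    have "homogeneous d (g * Var i)" for i :: 3
    proof (cases d)
      case 0
      then have "g = 0" using homogeneous_cofactor(2)[OF 3 homogeneous_Var Var_ne_0] by simp
      then show ?thesis by simp
    next
      case (Suc e)
      then have "homogeneous e g" using homogeneous_cofactor(1)[OF 3 homogeneous_Var Var_ne_0] by simp
      then show ?thesis using homogeneous_mult[OF _ homogeneous_Var, of e g i] Suc by simp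
    qed
    then have "homogeneous d (fst v)" "homogeneous d (snd v)"
      unfolding gv(4,5) using \<theta>hom homogeneous_diff by blast+
    then have "v \<in> log_fields ?T d"
      using gv(2) der_of_log_der_iff[OF A] by (simp add: log_fields_def)
    then show ?thesis using gv(1) by blast
  qed
  have "\<theta>1 \<in> log_der A" "\<theta>2 \<in> log_der A"
    unfolding span[symmetric] by (intro der.span_base; simp)+
  then obtain g1 v1 g2 v2 where v1: "v1 \<in> log_fields ?T d1" "\<theta>1 = der_scale g1 euler_der + der_of v1"
    and v2: "v2 \<in> log_fields ?T d2" "\<theta>2 = der_scale g2 euler_der + der_of v2"
    using red[OF h(1)] red[OF h(2)] by blast
  have comb: "der_scale g euler_der + der_scale p \<theta>1 + der_scale q \<theta>2
      = der_scale (g + p * g1 + q * g2) euler_der + der_of (fmult p v1 + fmult q v2)" for g p q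
    unfolding v1(2) v2(2) der_of_linear
    by (rule ext) (simp add: der_scale_def algebra_simps)
  have gen: "\<exists>p q. v = fmult p v1 + fmult q v2" if v: "v \<in> log_fields ?T k" for v k
  proof -
    have "der_of v \<in> log_der A" using v der_of_log_der_iff[OF A] by (simp add: log_fields_def)
    then obtain g p q where "der_of v = der_scale g euler_der + der_scale p \<theta>1 + der_scale q \<theta>2"
      unfolding span[symmetric] der_span3 by blast
    then have eq: "der_of v = der_scale (g + p * g1 + q * g2) euler_der + der_of (fmult p v1 + fmult q v2)"
      unfolding comb .
    have at: "der_of v x = (der_scale (g + p * g1 + q * g2) euler_der + der_of (fmult p v1 + fmult q v2)) x" for x
      using eq by (rule fun_cong)
    have "g + p * g1 + q * g2 = 0" using at[of "Var 3"] by (simp add: der_scale_def)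
    then have "v = fmult p v1 + fmult q v2"
      using at[of "Var 1"] at[of "Var 2"] by (simp add: der_scale_def prod_eq_iff)
    then show ?thesis by blast
  qed
  have ind: "p = 0 \<and> q = 0" if "fmult p v1 + fmult q v2 = 0" for p q
  proof -
    have "der_scale (- p * g1 - q * g2) euler_der + der_scale p \<theta>1 + der_scale q \<theta>2 = 0"
      unfolding comb that by (rule ext) (simp add: der_scale_def vfield_def)
    then show ?thesis using indep unfolding der_independent3[OF dist] by blast
  qed
  show ?thesis
    unfolding free_fields_def using v1(1) v2(1) gen ind by blast
qed

lemma free_arrangement_iff:
  assumes "line_arrangement A"
  shows "free_arrangement A \<longleftrightarrow> (\<exists>d1 d2. free_fields (line_coeffs ` A) d1 d2)"
  unfolding free_arrangement_def using free_fields_imp_free[OF assms] free_imp_free_fields[OF assms] by blast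

section \<open>The intersection poset and the characteristic polynomial\<close>

definition crossings :: "('k::field ^ 2) set set \<Rightarrow> ('k ^ 2) set" where
  "crossings A = {p. \<exists>H\<in>A. \<exists>H'\<in>A. H \<noteq> H' \<and> p \<in> H \<and> p \<in> H'}"

definition lines_through :: "('k::field ^ 2) set set \<Rightarrow> 'k ^ 2 \<Rightarrow> nat" where
  "lines_through A p = card {H \<in> A. p \<in> H}"

definition betti2 :: "('k::field ^ 2) set set \<Rightarrow> nat" where
  "betti2 A = (\<Sum>p\<in>crossings A. lines_through A p - 1)"

definition points_on :: "('k::field ^ 2) set \<Rightarrow> ('k ^ 2) set set \<Rightarrow> nat" where
  "points_on H A = card {p \<in> H. \<exists>H'\<in>A. p \<in> H'}"

context plane_line
begin

definition point :: "'k \<Rightarrow> 'k ^ 2" where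
  "point s = (\<chi> i. if i = 1 then x0 - b * s else y0 + a * s)"

lemma point_component [simp]: "point s $ 1 = x0 - b * s" "point s $ 2 = y0 + a * s"
  by (simp_all add: point_def)

lemma inj_point: "inj point"
proof (rule injI)
  fix s t assume "point s = point t"
  then have "b * s = b * t" "a * s = a * t"
    by (metis add_left_cancel diff_add_cancel point_component diff_right_commute diff_left_imp_eq,
        metis add_left_cancel point_component(2))
  then show "s = t" using det by algebra
qed

lemma range_point:
  assumes "defines_line a b c H"
  shows "H = range point"
proof (intro equalityI subsetI)
  fix p assume "p \<in> H"
  then have 0: "a * p $ 1 + b * p $ 2 + c = 0" using assms by (simp add: defines_line_def)
  have "p $ 1 = x0 - b * (l1 * p $ 1 + l2 * p $ 2 + l3)" "p $ 2 = y0 + a * (l1 * p $ 1 + l2 * p $ 2 + l3)"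
    using 0 det on_line base by algebra+
  then have "p = point (l1 * p $ 1 + l2 * p $ 2 + l3)"
    by (simp add: vec_eq_iff forall_2)
  then show "p \<in> range point" by blast
next
  fix p assume "p \<in> range point"
  then obtain s where "p = point s" by blast
  moreover have "a * (x0 - b * s) + b * (y0 + a * s) + c = 0" using on_line by algebra
  ultimately show "p \<in> H" using assms by (simp add: defines_line_def)
qed

lemma point_mem_iff:
  assumes "defines_line a' b' c' H'"
  shows "point s \<in> H' \<longleftrightarrow> poly (restr (linform (a', b', c'))) s = 0"
proof -
  have eq: "a' * (x0 - b * s) + b' * (y0 + a * s) + c' = a' * x0 + b' * y0 + c' + s * (b' * a - a' * b)"
    by (simp add: algebra_simps)
  have "point s \<in> H' \<longleftrightarrow> a' * (x0 - b * s) + b' * (y0 + a * s) + c' = 0"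
    using assms by (simp add: defines_line_def)
  also have "\<dots> \<longleftrightarrow> poly (restr (linform (a', b', c'))) s = 0"
    unfolding eq by (simp add: restr_linform)
  finally show ?thesis .
qed

end

lemma affine_line_obtains:
  assumes "affine_line H"
  obtains a b c x0 y0 l1 l2 l3 where "plane_line a b c x0 y0 l1 l2 l3" "defines_line a b c H"
    "line_coeffs H = (a, b, c)"
proof -
  obtain a b c where e: "line_coeffs H = (a, b, c)" by (metis prod_cases3)
  have d: "defines_line a b c H" by (rule defines_line_coeffs[OF assms e])
  then have "a \<noteq> 0 \<or> b \<noteq> 0" by (simp add: defines_line_def)
  then show thesis using plane_line_exists that d e by metis
qed

lemma affine_line_subset_eq:
  assumes "affine_line H" "affine_line H'" "H \<subseteq> H'"
  shows "H = H'"
proof -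
  obtain a b c a' b' c' where d: "defines_line a b c H" "defines_line a' b' c' H'"
    using assms(1,2) by (auto simp: affine_line_def)
  then show ?thesis
    using defines_line_subset_proportional[OF d assms(3)] proportional_same_line[OF d] by metis
qed

lemma affine_line_two_points:
  assumes "affine_line H"
  obtains p q where "p \<in> H" "q \<in> H" "p \<noteq> q"
proof -
  obtain a b c x0 y0 l1 l2 l3 where "plane_line a b c x0 y0 l1 l2 l3" and d: "defines_line a b c H"
    using assms by (rule affine_line_obtains)
  then interpret plane_line a b c x0 y0 l1 l2 l3 by simp
  have "point 0 \<noteq> point 1" using inj_point by (simp add: inj_eq)
  then show thesis using that[of "point 0" "point 1"] range_point[OF d] by blast
qed

lemma affine_line_meet_unique:
  assumes "affine_line H" "affine_line H'" "H \<noteq> H'" "p \<in> H" "p \<in> H'" "q \<in> H" "q \<in> H'"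
  shows "p = q"
proof -
  obtain a b c x0 y0 l1 l2 l3 where "plane_line a b c x0 y0 l1 l2 l3" and d: "defines_line a b c H"
    using assms(1) by (rule affine_line_obtains)
  then interpret plane_line a b c x0 y0 l1 l2 l3 by simp
  obtain a' b' c' where d': "defines_line a' b' c' H'" using assms(2) by (auto simp: affine_line_def)
  obtain s t where st: "p = point s" "q = point t" using assms(4,6) range_point[OF d] by blast
  have "restr (linform (a', b', c')) \<noteq> 0"
    using assms(3) restr_linform_eq_0 proportional_same_line[OF d d'] by metis
  moreover have "poly (restr (linform (a', b', c'))) s = 0" "poly (restr (linform (a', b', c'))) t = 0"
    using assms(5,7) point_mem_iff[OF d'] st by simp_all
  moreover define e d where "e = a' * x0 + b' * y0 + c'" and "d = b' * a - a' * b"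
  ultimately have 0: "\<not> (e = 0 \<and> d = 0)" "e + s * d = 0" "e + t * d = 0"
    by (simp_all add: restr_linform)
  then have "d \<noteq> 0" by auto
  moreover have "(s - t) * d = 0" using 0(2,3) by algebra
  ultimately have "s = t" by simp
  then show ?thesis using st by simp
qed

lemma affine_line_ne_UNIV:
  assumes "affine_line H"
  shows "H \<noteq> UNIV"
proof
  assume U: "H = UNIV"
  obtain a b c where d: "defines_line a b c H" using assms by (auto simp: affine_line_def)
  have v: "a * x + b * y + c = 0" for x y
  proof -
    have "(\<chi> i. if i = 1 then x else y) \<in> H" using U by simp
    then show ?thesis using d by (simp add: defines_line_def)
  qed
  have "a = 0" "b = 0" using v[of 0 0] v[of 1 0] v[of 0 1] by simp_all
  then show False using d by (simp add: defines_line_def)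
qed

lemma affine_line_ne_singleton: "affine_line H \<Longrightarrow> H \<noteq> {p}"
  using affine_line_two_points by (metis singletonD)

lemma UNIV_ne_singleton: "(UNIV :: ('k::field ^ 2) set) \<noteq> {p}"
proof
  assume "(UNIV :: ('k ^ 2) set) = {p}"
  then have "(0 :: 'k ^ 2) = (\<chi> i. 1)" by (metis UNIV_I singletonD)
  then have "(0 :: 'k) = 1" by (metis vec_lambda_beta zero_index)
  then show False by simp
qed

context
  fixes A :: "('k::field ^ 2) set set"
  assumes A: "line_arrangement A"
begin

lemma finite_arrangement: "finite A" and affine_line_mem: "H \<in> A \<Longrightarrow> affine_line H"
  using A by (auto simp: line_arrangement_def)

lemma Inter_two_lines:
  assumes "H \<in> A" "H' \<in> A" "H \<noteq> H'" "p \<in> H" "p \<in> H'"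
  shows "H \<inter> H' = {p}"
  using assms affine_line_meet_unique[OF affine_line_mem[of H] affine_line_mem[of H']] by blast

lemma finite_crossings: "finite (crossings A)"
proof -
  let ?S = "{(H, H') \<in> A \<times> A. H \<noteq> H'}"
  have "finite ?S"
    using finite_arrangement by (auto intro: finite_subset[of _ "A \<times> A"])
  moreover have "finite (fst K \<inter> snd K)" if "K \<in> ?S" for K
  proof (cases "fst K \<inter> snd K = {}")
    case False
    then obtain p where p: "p \<in> fst K" "p \<in> snd K" by blast
    have "fst K \<in> A" "snd K \<in> A" "fst K \<noteq> snd K" using that by auto
    then have "fst K \<inter> snd K = {p}" using p by (rule Inter_two_lines)
    then show ?thesis by simp
  qed simp
  ultimately have "finite (\<Union>K\<in>?S. fst K \<inter> snd K)" by blast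
  moreover have "crossings A \<subseteq> (\<Union>K\<in>?S. fst K \<inter> snd K)"
    by (force simp: crossings_def)
  ultimately show ?thesis by (rule finite_subset[rotated])
qed

text \<open>Two distinct lines meet in at most one point, so a nonempty intersection of at least two lines is
  a crossing point.\<close>

lemma int_poset_eq: "int_poset A = insert UNIV (A \<union> (\<lambda>p. {p}) ` crossings A)"
proof (intro equalityI subsetI)
  fix X assume "X \<in> int_poset A"
  then obtain B where B: "B \<subseteq> A" "X = \<Inter>B" "X \<noteq> {}" by (auto simp: int_poset_def)
  show "X \<in> insert UNIV (A \<union> (\<lambda>p. {p}) ` crossings A)"
  proof (cases "\<exists>H\<in>B. \<exists>H'\<in>B. H \<noteq> H'")
    case True
    then obtain H H' where H: "H \<in> B" "H' \<in> B" "H \<noteq> H'" by blast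
    obtain p where p: "p \<in> X" using B(3) by blast
    then have pH: "p \<in> H" "p \<in> H'" using B(2) H by auto
    have "H \<inter> H' = {p}" using Inter_two_lines[of H H' p] H pH B(1) by blast
    then have "X = {p}" using p B(2) H(1,2) by blast
    moreover have "H \<in> A" "H' \<in> A" using H B(1) by auto
    then have "p \<in> crossings A" unfolding crossings_def using H(3) pH by blast
    ultimately show ?thesis by blast
  next
    case False
    then have "B = {} \<or> (\<exists>H. B = {H})" by blast
    then show ?thesis using B(1,2) by auto
  qed
next
  fix X assume "X \<in> insert UNIV (A \<union> (\<lambda>p. {p}) ` crossings A)"
  then consider "X = UNIV" | "X \<in> A" | p where "p \<in> crossings A" "X = {p}" by blast
  then show "X \<in> int_poset A"
  proof cases
    case 1
    then show ?thesis by (auto simp: int_poset_def intro!: exI[of _ "{}"])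
  next
    case 2
    then have "X \<noteq> {}" using affine_line_two_points[OF affine_line_mem] by blast
    then show ?thesis using 2 by (auto simp: int_poset_def intro!: exI[of _ "{X}"])
  next
    case 3
    then obtain H H' where H: "H \<in> A" "H' \<in> A" "H \<noteq> H'" "p \<in> H" "p \<in> H'" by (auto simp: crossings_def)
    have "\<Inter>{H, H'} = X" using Inter_two_lines[OF H] 3 by simp
    then show ?thesis using H(1,2) 3 unfolding int_poset_def by blast
  qed
qed

lemma lines_through_ge_2:
  assumes "p \<in> crossings A"
  shows "2 \<le> lines_through A p"
proof -
  obtain H H' where H: "H \<in> A" "H' \<in> A" "H \<noteq> H'" "p \<in> H" "p \<in> H'"
    using assms by (auto simp: crossings_def)
  have "card {H, H'} \<le> card {H \<in> A. p \<in> H}"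
    using H finite_arrangement by (intro card_mono) auto
  then show ?thesis using H(3) by (simp add: lines_through_def)
qed

lemma moebius_line:
  assumes H: "H \<in> A"
  shows "moebius A H = - 1"
proof -
  have "{Y \<in> int_poset A. H \<subset> Y} = {UNIV}"
  proof -
    have "H \<noteq> UNIV" using affine_line_ne_UNIV[OF affine_line_mem[OF H]] .
    moreover have "\<not> H \<subset> H'" if "H' \<in> A" for H'
      using affine_line_subset_eq[OF affine_line_mem[OF H] affine_line_mem[OF that]] by blast
    moreover have "\<not> H \<subset> {p}" for p
      using affine_line_two_points[OF affine_line_mem[OF H]] by (metis psubsetD singletonD)
    ultimately show ?thesis unfolding int_poset_eq by blast
  qed
  then show ?thesis
    using affine_line_ne_UNIV[OF affine_line_mem[OF H]] finite_arrangement
    by (subst moebius.simps) (simp add: moebius.simps[of A UNIV])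
qed

lemma moebius_point:
  assumes p: "p \<in> crossings A"
  shows "moebius A {p} = int (lines_through A p - 1)"
proof -
  have "{Y \<in> int_poset A. {p} \<subset> Y} = insert UNIV {H \<in> A. p \<in> H}"
    unfolding int_poset_eq using affine_line_ne_singleton[OF affine_line_mem] UNIV_ne_singleton by blast
  moreover have "UNIV \<notin> {H \<in> A. p \<in> H}" using affine_line_ne_UNIV[OF affine_line_mem] by blast
  moreover have "(\<Sum>Y\<in>{H \<in> A. p \<in> H}. moebius A Y) = - int (lines_through A p)"
    using moebius_line by (simp add: lines_through_def)
  ultimately have "(\<Sum>Y\<in>{Y \<in> int_poset A. {p} \<subset> Y}. moebius A Y) = 1 - int (lines_through A p)"
    using finite_arrangement by (simp add: moebius.simps[of A UNIV])
  then show ?thesis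
    using UNIV_ne_singleton[of p] finite_arrangement lines_through_ge_2[OF p]
    by (subst moebius.simps) (simp add: of_nat_diff eq_commute)
qed

end

lemma aff_dim_plane_UNIV: "aff_dim_plane (UNIV :: ('k::field ^ 2) set) = 2"
proof -
  have "{u - v | u v. u \<in> (UNIV :: ('k ^ 2) set) \<and> v \<in> UNIV} = UNIV"
    by (auto intro: exI[of _ 0]) (metis diff_zero)
  then show ?thesis by (simp add: aff_dim_plane_def card_cart_basis)
qed

lemma aff_dim_plane_singleton: "aff_dim_plane {p} = 0"
  by (simp add: aff_dim_plane_def)

lemma aff_dim_plane_line:
  assumes "affine_line (H :: ('k::field ^ 2) set)"
  shows "aff_dim_plane H = 1"
proof -
  obtain a b c x0 y0 l1 l2 l3 where "plane_line a b c x0 y0 l1 l2 l3" and d: "defines_line a b c H"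
    using assms by (rule affine_line_obtains)
  then interpret plane_line a b c x0 y0 l1 l2 l3 by simp
  define w :: "'k ^ 2" where "w = (\<chi> i. if i = 1 then - b else a)"
  have w: "point s - point t = (s - t) *s w" for s t
    by (simp add: vec_eq_iff forall_2 w_def algebra_simps)
  have "{u - v | u v. u \<in> H \<and> v \<in> H} = vec.span {w}"
  proof (intro equalityI subsetI)
    fix x assume "x \<in> {u - v | u v. u \<in> H \<and> v \<in> H}"
    then obtain s t where "x = point s - point t" using range_point[OF d] by auto
    then show "x \<in> vec.span {w}" unfolding w by (auto simp: vec.span_singleton)
  next
    fix x assume "x \<in> vec.span {w}"
    then obtain k where "x = k *s w" by (auto simp: vec.span_singleton)
    then have "x = point k - point 0" by (simp add: w)
    then show "x \<in> {u - v | u v. u \<in> H \<and> v \<in> H}" using range_point[OF d] by blast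
  qed
  moreover have "w \<noteq> 0"
  proof
    assume "w = 0"
    then have "w $ 1 = 0" "w $ 2 = 0" by simp_all
    then show False using det by (simp add: w_def)
  qed
  ultimately show ?thesis by (simp add: aff_dim_plane_def)
qed

lemma sum_const_poly: "(\<Sum>i\<in>I. [:f i:]) = [:\<Sum>i\<in>I. f i:]"
  by (induction I rule: infinite_finite_induct) auto

theorem char_poly_arr_eq:
  assumes A: "line_arrangement A"
  shows "char_poly_arr A = [:int (betti2 A), - int (card A), 1:]"
proof -
  let ?f = "\<lambda>X. monom (moebius A X) (aff_dim_plane X)"
  have disj: "A \<inter> (\<lambda>p. {p}) ` crossings A = {}"
    using affine_line_ne_singleton[OF affine_line_mem[OF A]] by blast
  have U: "UNIV \<notin> A \<union> (\<lambda>p. {p}) ` crossings A"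
    using affine_line_ne_UNIV[OF affine_line_mem[OF A]] UNIV_ne_singleton by blast
  have "char_poly_arr A = ?f UNIV + (sum ?f A + sum ?f ((\<lambda>p. {p}) ` crossings A))"
    unfolding char_poly_arr_def int_poset_eq[OF A]
    using U disj finite_arrangement[OF A] finite_crossings[OF A] by (simp add: sum.union_disjoint)
  also have "?f UNIV = monom 1 2" by (simp add: moebius.simps[of A UNIV] aff_dim_plane_UNIV)
  also have "sum ?f A = (\<Sum>H\<in>A. monom (- 1) 1)"
    using moebius_line[OF A] aff_dim_plane_line[OF affine_line_mem[OF A]] by (intro sum.cong) auto
  also have "\<dots> = monom (- int (card A)) 1"
    by (simp add: monom_altdef of_nat_poly)
  also have "sum ?f ((\<lambda>p. {p}) ` crossings A) = (\<Sum>p\<in>crossings A. ?f {p})"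
    by (rule sum.reindex_cong[of "\<lambda>p. {p}"]) (auto simp: inj_on_def)
  also have "\<dots> = (\<Sum>p\<in>crossings A. [:int (lines_through A p - 1):])"
    using moebius_point[OF A] by (intro sum.cong refl) (simp add: aff_dim_plane_singleton monom_0)
  also have "\<dots> = [:int (betti2 A):]"
    by (simp add: betti2_def sum_const_poly)
  finally show ?thesis by (simp add: monom_altdef numeral_2_eq_2)
qed

lemma betti2_superset:
  assumes A: "line_arrangement A" and F: "finite F" "crossings A \<subseteq> F"
  shows "betti2 A = (\<Sum>p\<in>F. lines_through A p - 1)"
  unfolding betti2_def
proof (rule sum.mono_neutral_left[OF F])
  show "\<forall>p\<in>F - crossings A. lines_through A p - 1 = 0"
  proof
    fix p assume "p \<in> F - crossings A"
    then have "\<forall>H\<in>{H \<in> A. p \<in> H}. \<forall>H'\<in>{H \<in> A. p \<in> H}. H = H'" by (auto simp: crossings_def)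
    then have "lines_through A p \<le> 1"
      unfolding lines_through_def using card_le_Suc0_iff_eq[of "{H \<in> A. p \<in> H}"] finite_arrangement[OF A] by simp
    then show "lines_through A p - 1 = 0" by simp
  qed
qed

text \<open>The multiplicity goes up by one at exactly the points where \<open>H\<close> meets the lines of \<open>A\<close>. A simple point of
  \<open>A\<close> contributes zero before, which is why the sum may be taken over the larger set of crossings.\<close>

lemma betti2_insert:
  assumes A: "line_arrangement (insert H A)" and H: "H \<notin> A"
  shows "betti2 (insert H A) = betti2 A + points_on H A"
proof -
  let ?F = "crossings (insert H A)"
  let ?X = "{p \<in> H. \<exists>H'\<in>A. p \<in> H'}"
  have A': "line_arrangement A" using A by (auto simp: line_arrangement_def)
  have fin: "finite ?F" by (rule finite_crossings[OF A])
  have "crossings A \<subseteq> ?F" by (auto simp: crossings_def)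
  then have old: "betti2 A = (\<Sum>p\<in>?F. lines_through A p - 1)"
    by (rule betti2_superset[OF A' fin])
  have "?X \<subseteq> ?F" using H by (auto simp: crossings_def)
  then have "{p \<in> ?F. p \<in> ?X} = ?X" by blast
  then have "points_on H A = (\<Sum>p\<in>{p \<in> ?F. p \<in> ?X}. 1)"
    by (simp only: points_on_def card_eq_sum)
  also have "\<dots> = (\<Sum>p\<in>?F. if p \<in> ?X then 1 else 0)"
    by (rule sum.inter_filter[OF fin])
  finally have on: "points_on H A = (\<Sum>p\<in>?F. if p \<in> ?X then 1 else 0)" .
  have "lines_through (insert H A) p - 1 = (lines_through A p - 1) + (if p \<in> ?X then 1 else 0)"
    if p: "p \<in> ?F" for p
  proof (cases "p \<in> H")
    case False
    then have "{K \<in> insert H A. p \<in> K} = {K \<in> A. p \<in> K}" by auto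
    then show ?thesis using False by (simp add: lines_through_def)
  next
    case True
    then have "p \<in> ?X" using p by (auto simp: crossings_def)
    then have "0 < lines_through A p"
      unfolding lines_through_def using finite_arrangement[OF A'] by (auto simp: card_gt_0_iff)
    moreover have "{K \<in> insert H A. p \<in> K} = insert H {K \<in> A. p \<in> K}" using True by auto
    then have "lines_through (insert H A) p = Suc (lines_through A p)"
      using H finite_arrangement[OF A'] by (simp add: lines_through_def)
    ultimately show ?thesis using \<open>p \<in> ?X\<close> by simp
  qed
  then have "betti2 (insert H A)
      = (\<Sum>p\<in>?F. (lines_through A p - 1) + (if p \<in> ?X then 1 else 0))"
    unfolding betti2_def by (rule sum.cong[OF refl])
  also have "\<dots> = betti2 A + points_on H A"
    unfolding old on by (rule sum.distrib)
  finally show ?thesis .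
qed

text \<open>The geometric count of points on the line agrees with the count of roots of restricted linear
  forms.\<close>

lemma line_deletion_obtains:
  assumes A: "line_arrangement (insert H A)" and H: "H \<notin> A"
  obtains a b c x0 y0 l1 l2 l3 where "line_deletion a b c x0 y0 l1 l2 l3 (line_coeffs ` A)"
    "line_coeffs H = (a, b, c)"
    "line_deletion.npoints a b x0 y0 (line_coeffs ` A) = points_on H A"
proof -
  have "affine_line H" using A by (simp add: line_arrangement_def)
  then obtain a b c x0 y0 l1 l2 l3 where pl: "plane_line a b c x0 y0 l1 l2 l3"
    and d: "defines_line a b c H" and e: "line_coeffs H = (a, b, c)"
    by (rule affine_line_obtains)
  have dist: "distinct_lines (insert (a, b, c) (line_coeffs ` A))"
    using distinct_lines_coeffs[OF A] e by simp
  have new: "(a, b, c) \<notin> line_coeffs ` A"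
    using inj_on_line_coeffs[OF A] H e by (auto simp: inj_on_def)
  interpret line_deletion a b c x0 y0 l1 l2 l3 "line_coeffs ` A"
    using pl dist new by (simp add: line_deletion_def line_deletion_axioms_def)
  have mem: "point s \<in> H' \<longleftrightarrow> poly (restr (linform (line_coeffs H'))) s = 0" if "H' \<in> A" for H' s
  proof -
    obtain a' b' c' where e': "line_coeffs H' = (a', b', c')" by (metis prod_cases3)
    have "defines_line a' b' c' H'"
      by (rule defines_line_coeffs[OF _ e']) (use A that in \<open>simp add: line_arrangement_def\<close>)
    then show ?thesis using point_mem_iff e' by simp
  qed
  have "{p \<in> H. \<exists>H'\<in>A. p \<in> H'} = point ` points"
  proof (intro equalityI subsetI)
    fix p assume "p \<in> {p \<in> H. \<exists>H'\<in>A. p \<in> H'}"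
    then obtain H' s where H': "H' \<in> A" "p \<in> H'" "p = point s" using range_point[OF d] by blast
    then have "line_coeffs H' \<in> through s" using mem by simp
    then have "s \<in> points" unfolding points_def by blast
    then show "p \<in> point ` points" using H'(3) by blast
  next
    fix p assume "p \<in> point ` points"
    then obtain s t where s: "p = point s" "t \<in> through s" unfolding points_def by blast
    then obtain H' where "H' \<in> A" "t = line_coeffs H'" by blast
    then have "p \<in> H'" using mem s by simp
    then show "p \<in> {p \<in> H. \<exists>H'\<in>A. p \<in> H'}" using s(1) range_point[OF d] \<open>H' \<in> A\<close> by blast
  qed
  then have "points_on H A = npoints"
    unfolding points_on_def npoints_def
    by (simp only: card_image[OF inj_on_subset[OF inj_point subset_UNIV]])
  then show thesis using that[OF line_deletion_axioms e] by simp
qed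

text \<open>Both sides change by \<open>points_on H A\<close> when a line is added.\<close>

lemma second_betti_arrangement:
  assumes "line_arrangement A"
  shows "second_betti (line_coeffs ` A) (int (betti2 A))"
proof -
  have "finite A" using assms by (simp add: line_arrangement_def)
  then show ?thesis using assms
  proof (induction A rule: finite_induct)
    case empty
    then show ?case using second_betti_empty by (simp add: betti2_def crossings_def)
  next
    case (insert H A)
    have A: "line_arrangement A" using insert(4) by (auto simp: line_arrangement_def)
    obtain a b c x0 y0 l1 l2 l3 where ld: "line_deletion a b c x0 y0 l1 l2 l3 (line_coeffs ` A)"
      and e: "line_coeffs H = (a, b, c)"
      and n: "line_deletion.npoints a b x0 y0 (line_coeffs ` A) = points_on H A"
      using line_deletion_obtains[OF insert(4,2)] by metis
    show ?case
      using line_deletion.second_betti_insert[OF ld insert(3)[OF A]]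
      by (simp add: n e betti2_insert[OF insert(4,2)])
  qed
qed

lemma points_on_le:
  assumes A: "line_arrangement (insert H A)" and H: "H \<notin> A"
  shows "points_on H A \<le> card A"
proof -
  obtain a b c x0 y0 l1 l2 l3 where ld: "line_deletion a b c x0 y0 l1 l2 l3 (line_coeffs ` A)"
    and n: "line_deletion.npoints a b x0 y0 (line_coeffs ` A) = points_on H A"
    using line_deletion_obtains[OF A H] by metis
  have "card (line_coeffs ` A) \<le> card A"
    using A by (intro card_image_le) (simp add: line_arrangement_def)
  then show ?thesis using line_deletion.npoints_le[OF ld] n by simp
qed

theorem free_pair_iff:
  assumes A: "line_arrangement (insert H A)" and H: "H \<notin> A"
  shows "free_pair (insert H A) A \<longleftrightarrow>
    int (betti2 A) = int (points_on H A) * (int (card A) - int (points_on H A))"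
proof -
  have A': "line_arrangement A" using A by (auto simp: line_arrangement_def)
  obtain a b c x0 y0 l1 l2 l3 where ld: "line_deletion a b c x0 y0 l1 l2 l3 (line_coeffs ` A)"
    and e: "line_coeffs H = (a, b, c)"
    and n: "line_deletion.npoints a b x0 y0 (line_coeffs ` A) = points_on H A"
    using line_deletion_obtains[OF A H] by metis
  have card: "card (line_coeffs ` A) = card A"
    by (rule card_image[OF inj_on_line_coeffs[OF A']])
  show ?thesis
    unfolding free_pair_def free_arrangement_iff[OF A] free_arrangement_iff[OF A'] image_insert e
    using line_deletion.both_free_iff[OF ld second_betti_arrangement[OF A']] points_on_le[OF A H]
    by (simp add: n card of_nat_diff conj_commute)
qed

text \<open>The two polynomials differ by \<open>t - n\<close>, so \<open>n\<close> is the only candidate.\<close>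

lemma common_root_iff:
  assumes A: "line_arrangement (insert H A)" and H: "H \<notin> A"
  shows "(\<exists>t::complex. poly (map_poly of_int (char_poly_arr (insert H A))) t = 0 \<and>
      poly (map_poly of_int (char_poly_arr A)) t = 0) \<longleftrightarrow>
    int (betti2 A) = int (points_on H A) * (int (card A) - int (points_on H A))"
proof -
  define n where "n = points_on H A"
  define m where "m = card A"
  define \<beta> where "\<beta> = betti2 A"
  have A': "line_arrangement A" using A by (auto simp: line_arrangement_def)
  have card: "card (insert H A) = Suc m"
    using H A' by (simp add: line_arrangement_def m_def)
  have 1: "poly (map_poly of_int (char_poly_arr (insert H A))) t
      = of_nat \<beta> + of_nat n - (of_nat m + 1) * t + t * t" for t :: complex
    unfolding char_poly_arr_eq[OF A] card betti2_insert[OF A H]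
    by (simp add: map_poly_pCons \<beta>_def n_def algebra_simps)
  have 2: "poly (map_poly of_int (char_poly_arr A)) t = of_nat \<beta> - of_nat m * t + t * t" for t :: complex
    unfolding char_poly_arr_eq[OF A'] by (simp add: map_poly_pCons \<beta>_def m_def algebra_simps)
  have "(of_nat \<beta> - of_nat m * of_nat n + of_nat n * of_nat n = (0::complex))
      \<longleftrightarrow> of_int (int \<beta> - int m * int n + int n * int n) = (of_int 0 :: complex)"
    by simp
  also have "\<dots> \<longleftrightarrow> int \<beta> = int n * (int m - int n)"
    unfolding of_int_eq_iff by (auto simp: algebra_simps)
  finally have 3: "(of_nat \<beta> - of_nat m * of_nat n + of_nat n * of_nat n = (0::complex))
      \<longleftrightarrow> int \<beta> = int n * (int m - int n)" .
  show ?thesis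
    unfolding 1 2 n_def[symmetric] m_def[symmetric] \<beta>_def[symmetric] 3[symmetric]
  proof
    assume "\<exists>t::complex. of_nat \<beta> + of_nat n - (of_nat m + 1) * t + t * t = 0
        \<and> of_nat \<beta> - of_nat m * t + t * t = 0"
    then obtain t :: complex where t: "of_nat \<beta> + of_nat n - (of_nat m + 1) * t + t * t = 0"
      "of_nat \<beta> - of_nat m * t + t * t = 0" by blast
    have "t = of_nat n" using t by algebra
    then show "of_nat \<beta> - of_nat m * of_nat n + of_nat n * of_nat n = (0::complex)" using t(2) by simp
  next
    assume 0: "of_nat \<beta> - of_nat m * of_nat n + of_nat n * of_nat n = (0::complex)"
    have "of_nat \<beta> + of_nat n - (of_nat m + 1) * of_nat n + of_nat n * of_nat n = (0::complex)"
      using 0 by algebra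
    with 0 show "\<exists>t::complex. of_nat \<beta> + of_nat n - (of_nat m + 1) * t + t * t = 0
        \<and> of_nat \<beta> - of_nat m * t + t * t = 0" by blast
  qed
qed

section \<open>Combinatorial invariance\<close>

abbreviation flat_points :: "('k::field ^ 2) set set \<Rightarrow> ('k ^ 2) set set" where
  "flat_points A \<equiv> int_poset A - insert UNIV A"

lemma flat_points_eq:
  assumes "line_arrangement A"
  shows "flat_points A = (\<lambda>p. {p}) ` crossings A"
  unfolding int_poset_eq[OF assms]
  using affine_line_ne_singleton[OF affine_line_mem[OF assms]] UNIV_ne_singleton by blast

lemma betti2_flat_points:
  assumes "line_arrangement A"
  shows "betti2 A = (\<Sum>X\<in>flat_points A. card {H \<in> A. X \<subseteq> H} - 1)"
  unfolding flat_points_eq[OF assms] betti2_def lines_through_def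
  by (subst sum.reindex) (auto simp: inj_on_def)

lemma points_on_flat_points:
  assumes A: "line_arrangement (insert H A)" and H: "H \<notin> A"
  shows "points_on H A = card {X \<in> flat_points (insert H A). X \<subseteq> H}"
proof -
  have "{X \<in> flat_points (insert H A). X \<subseteq> H} = (\<lambda>p. {p}) ` {p \<in> H. \<exists>H'\<in>A. p \<in> H'}"
    unfolding flat_points_eq[OF A] using H by (auto simp: crossings_def)
  then show ?thesis by (simp add: points_on_def card_image inj_on_def)
qed

text \<open>The lines are the coatoms of the intersection poset.\<close>

lemma lines_iff_coatoms:
  assumes A: "line_arrangement A" and X: "X \<in> int_poset A"
  shows "X \<in> A \<longleftrightarrow> X \<noteq> UNIV \<and> (\<forall>Y\<in>int_poset A. X \<subseteq> Y \<longrightarrow> Y = X \<or> Y = UNIV)"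
proof
  assume XA: "X \<in> A"
  have "Y = X \<or> Y = UNIV" if Y: "Y \<in> int_poset A" "X \<subseteq> Y" for Y
  proof -
    have "Y \<noteq> {p}" for p
      using affine_line_two_points[OF affine_line_mem[OF A XA]] Y(2) by (metis singletonD subsetD)
    then have "Y = UNIV \<or> Y \<in> A" using Y(1) unfolding int_poset_eq[OF A] by blast
    then show ?thesis using affine_line_subset_eq[OF affine_line_mem[OF A XA] affine_line_mem[OF A]] Y(2) by blast
  qed
  then show "X \<noteq> UNIV \<and> (\<forall>Y\<in>int_poset A. X \<subseteq> Y \<longrightarrow> Y = X \<or> Y = UNIV)"
    using affine_line_ne_UNIV[OF affine_line_mem[OF A XA]] by blast
next
  assume h: "X \<noteq> UNIV \<and> (\<forall>Y\<in>int_poset A. X \<subseteq> Y \<longrightarrow> Y = X \<or> Y = UNIV)"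
  show "X \<in> A"
  proof (rule ccontr)
    assume "X \<notin> A"
    then obtain p where p: "X = {p}" "p \<in> crossings A" using X h unfolding int_poset_eq[OF A] by blast
    then obtain H where H: "H \<in> A" "p \<in> H" by (auto simp: crossings_def)
    then have "H \<in> int_poset A" "X \<subseteq> H" using p unfolding int_poset_eq[OF A] by auto
    then have "H = X \<or> H = UNIV" using h by blast
    then show False
      using affine_line_ne_UNIV[OF affine_line_mem[OF A H(1)]] affine_line_ne_singleton[OF affine_line_mem[OF A H(1)]] p(1)
      by blast
  qed
qed

text \<open>The isomorphism preserves the top element and the coatoms, hence lines and points, and with them
  the incidences that define the three numbers.\<close>

lemma comb_invariants:
  assumes A: "line_arrangement (insert H A)" "H \<notin> A" and B: "line_arrangement (insert K B)" "K \<notin> B"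
    and eqv: "comb_equiv_pairs (insert H A) A (insert K B) B"
  shows "card A = card B" "betti2 (insert H A) = betti2 (insert K B)" "points_on H A = points_on K B"
proof -
  let ?A = "insert H A" and ?B = "insert K B"
  obtain \<phi> where bij: "bij_betw \<phi> (int_poset ?A) (int_poset ?B)"
    and ord: "\<And>X Y. X \<in> int_poset ?A \<Longrightarrow> Y \<in> int_poset ?A \<Longrightarrow> X \<subseteq> Y \<longleftrightarrow> \<phi> X \<subseteq> \<phi> Y"
    and im: "\<phi> ` A = B"
    using eqv unfolding comb_equiv_pairs_def by blast
  have inj: "inj_on \<phi> (int_poset ?A)" and onto: "\<phi> ` int_poset ?A = int_poset ?B"
    using bij by (auto simp: bij_betw_def)
  have UA: "UNIV \<in> int_poset ?A" and UB: "UNIV \<in> int_poset ?B"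
    using int_poset_eq[OF A(1)] int_poset_eq[OF B(1)] by auto
  have LA: "?A \<subseteq> int_poset ?A"
    using int_poset_eq[OF A(1)] by blast
  have U: "\<phi> UNIV = UNIV"
  proof -
    obtain Z where "Z \<in> int_poset ?A" "\<phi> Z = UNIV" using onto UB by (metis imageE)
    then show ?thesis using ord[OF _ UA, of Z] by auto
  qed
  have line_iff: "X \<in> ?A \<longleftrightarrow> \<phi> X \<in> ?B" if X: "X \<in> int_poset ?A" for X
  proof -
    have \<phi>X: "\<phi> X \<in> int_poset ?B" using X onto by blast
    have 1: "X = UNIV \<longleftrightarrow> \<phi> X = UNIV" using inj X UA U by (metis inj_onD)
    have 2: "(\<forall>Y\<in>int_poset ?A. X \<subseteq> Y \<longrightarrow> Y = X \<or> Y = UNIV)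
        \<longleftrightarrow> (\<forall>Y\<in>int_poset ?B. \<phi> X \<subseteq> Y \<longrightarrow> Y = \<phi> X \<or> Y = UNIV)"
    proof -
      have "Y = X \<longleftrightarrow> \<phi> Y = \<phi> X" "Y = UNIV \<longleftrightarrow> \<phi> Y = UNIV" if "Y \<in> int_poset ?A" for Y
        using inj X UA U that by (metis inj_onD)+
      then show ?thesis unfolding onto[symmetric] using ord[OF X] by auto
    qed
    show ?thesis
      by (simp only: lines_iff_coatoms[OF A(1) X] lines_iff_coatoms[OF B(1) \<phi>X] 1 2)
  qed
  have lines: "\<phi> ` ?A = ?B"
  proof (intro equalityI subsetI)
    fix Y assume "Y \<in> \<phi> ` ?A"
    then show "Y \<in> ?B" using line_iff LA by blast
  next
    fix Y assume Y: "Y \<in> ?B"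
    then have "Y \<in> int_poset ?B" using int_poset_eq[OF B(1)] by blast
    then obtain X where "X \<in> int_poset ?A" "Y = \<phi> X" using onto by blast
    then show "Y \<in> \<phi> ` ?A" using line_iff Y by blast
  qed
  have injA: "inj_on \<phi> ?A" using inj LA by (rule inj_on_subset)
  have "card (\<phi> ` A) = card A" by (rule card_image) (rule inj_on_subset[OF injA], blast)
  then show "card A = card B" using im by simp
  have \<phi>H: "\<phi> H = K"
  proof -
    have "\<phi> H \<notin> \<phi> ` A" using injA A(2) by (auto simp: inj_on_def)
    moreover have "\<phi> H \<in> ?B" using lines by blast
    ultimately show ?thesis unfolding im by blast
  qed
  have flat: "\<phi> ` flat_points ?A = flat_points ?B"
  proof -
    have "\<phi> ` flat_points ?A = \<phi> ` int_poset ?A - \<phi> ` insert UNIV ?A"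
      using UA LA by (intro inj_on_image_set_diff[OF inj]) auto
    then show ?thesis by (simp only: onto image_insert U lines[unfolded image_insert])
  qed
  have injF: "inj_on \<phi> (flat_points ?A)" using inj by (rule inj_on_subset) blast
  have "card {L \<in> ?B. \<phi> X \<subseteq> L} = card {L \<in> ?A. X \<subseteq> L}" if X: "X \<in> flat_points ?A" for X
  proof -
    have "{L \<in> ?B. \<phi> X \<subseteq> L} = \<phi> ` {L \<in> ?A. X \<subseteq> L}"
      unfolding lines[symmetric] using ord LA X by blast
    moreover have "inj_on \<phi> {L \<in> ?A. X \<subseteq> L}" using injA by (rule inj_on_subset) blast
    ultimately show ?thesis by (simp add: card_image)
  qed
  then have "(\<Sum>X\<in>flat_points ?A. card {L \<in> ?A. X \<subseteq> L} - 1)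
      = (\<Sum>X\<in>flat_points ?A. card {L \<in> ?B. \<phi> X \<subseteq> L} - 1)"
    by (intro sum.cong) simp_all
  also have "\<dots> = (\<Sum>X\<in>flat_points ?B. card {L \<in> ?B. X \<subseteq> L} - 1)"
    unfolding flat[symmetric] by (simp only: sum.reindex[OF injF] o_def)
  finally show "betti2 ?A = betti2 ?B"
    unfolding betti2_flat_points[OF A(1)] betti2_flat_points[OF B(1)] .
  have "\<phi> X \<subseteq> K \<longleftrightarrow> X \<subseteq> H" if "X \<in> flat_points ?A" for X
  proof -
    have "X \<in> int_poset ?A" "H \<in> int_poset ?A" using that LA by blast+
    then show ?thesis using ord \<phi>H by simp
  qed
  then have "{X \<in> flat_points ?A. \<phi> X \<subseteq> K} = {X \<in> flat_points ?A. X \<subseteq> H}"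
    by (intro Collect_cong conj_cong refl)
  then have "{Y \<in> \<phi> ` flat_points ?A. Y \<subseteq> K} = \<phi> ` {X \<in> flat_points ?A. X \<subseteq> H}"
    by (simp only: Compr_image_eq)
  then have "{X \<in> flat_points ?B. X \<subseteq> K} = \<phi> ` {X \<in> flat_points ?A. X \<subseteq> H}"
    by (simp only: flat)
  moreover have "inj_on \<phi> {X \<in> flat_points ?A. X \<subseteq> H}" using injF by (rule inj_on_subset) blast
  ultimately show "points_on H A = points_on K B"
    unfolding points_on_flat_points[OF A] points_on_flat_points[OF B] by (simp add: card_image)
qed

lemma deletion_pair_obtains:
  assumes "deletion_pair A A'"
  obtains H where "A = insert H A'" "H \<notin> A'" "line_arrangement (insert H A')"
proof -
  have A: "line_arrangement A" "A' \<subseteq> A" "card A' + 1 = card A"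
    using assms by (auto simp: deletion_pair_def)
  have fin: "finite A'" using A(1,2) finite_subset by (auto simp: line_arrangement_def)
  have "card (A - A') = 1" using card_Diff_subset[OF fin A(2)] A(3) by simp
  then obtain H where H: "A - A' = {H}" by (auto simp: card_1_singleton_iff)
  then have "A = insert H A'" using A(2) by blast
  moreover have "H \<notin> A'" using H by blast
  ultimately show thesis using that A(1) by blast
qed

theorem corollary1p5:
  shows "(\<forall>A A' :: ('k::field ^ 2) set set. deletion_pair A A' \<longrightarrow>
            (free_pair A A' \<longleftrightarrow>
              (\<exists>t::complex. poly (map_poly of_int (char_poly_arr A)) t = 0 \<and>
                            poly (map_poly of_int (char_poly_arr A')) t = 0))) \<and>
         (\<forall>A1 A1' A2 A2' :: ('k ^ 2) set set.
            deletion_pair A1 A1' \<longrightarrow> deletion_pair A2 A2' \<longrightarrow> comb_equiv_pairs A1 A1' A2 A2' \<longrightarrow>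
            (free_pair A1 A1' \<longleftrightarrow> free_pair A2 A2'))"
proof (intro conjI allI impI)
  fix A A' :: "('k ^ 2) set set"
  assume "deletion_pair A A'"
  then obtain H where H: "A = insert H A'" "H \<notin> A'" "line_arrangement (insert H A')"
    by (rule deletion_pair_obtains)
  show "free_pair A A' \<longleftrightarrow> (\<exists>t::complex. poly (map_poly of_int (char_poly_arr A)) t = 0 \<and>
      poly (map_poly of_int (char_poly_arr A')) t = 0)"
    unfolding H(1) free_pair_iff[OF H(3,2)] common_root_iff[OF H(3,2)] ..
next
  fix A1 A1' A2 A2' :: "('k ^ 2) set set"
  assume "deletion_pair A1 A1'" "deletion_pair A2 A2'" and eqv: "comb_equiv_pairs A1 A1' A2 A2'"
  then obtain H K where H: "A1 = insert H A1'" "H \<notin> A1'" "line_arrangement (insert H A1')"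
    and K: "A2 = insert K A2'" "K \<notin> A2'" "line_arrangement (insert K A2')"
    using deletion_pair_obtains by metis
  note inv = comb_invariants[OF H(3,2) K(3,2) eqv[unfolded H(1) K(1)]]
  have "betti2 A1' = betti2 A2'"
    using inv(2,3) betti2_insert[OF H(3,2)] betti2_insert[OF K(3,2)] by simp
  then show "free_pair A1 A1' \<longleftrightarrow> free_pair A2 A2'"
    unfolding H(1) K(1) free_pair_iff[OF H(3,2)] free_pair_iff[OF K(3,2)] using inv(1,3) by simp
qed

end
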